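(* Let $(R_N)_{N\ge 1}$ be a sequence of positive reals with $R_N/\sqrt{N}\to\infty$ and $R_N/N\to 0$ as $N\to\infty$. Let $g\in V_\infty$ be a simple function. Then, as $N\to\infty$, the Monge–Kantorovich distance between the measure $\nu_{N,R_N}$ on the ball $R_NB_N$ and its image $\nu_{N,R_N}\ast g$ under the right multiplication $f\mapsto f\ast g$ converges to zero. Equivalently, for every $1$-Lipschitz function $F\colon L^2(\mathbb{I},\mathfrak{k})\to\mathbb{R}$ satisfying $\|F\|_\infty\le 1$, $$\int F(f)\,d\nu_{N,R_N}(f)-\int F(f)\,d(\nu_{N,R_N}\ast g)(f)\to 0\quad\text{as }N\to\infty,$$ and the convergence is uniform over all such $F$.
   Context: $\mathbb{I}=[0,1]$. $K$ is a compact connected Lie group realized as a matrix subgroup of an orthogonal group, with Lie algebra $\mathfrak{k}$ of dimension $d$, equipped with an $\mathrm{Ad}$-invariant inner product; $L^2(\mathbb{I},\mathfrak{k})$ is the corresponding real Hilbert space with norm $\|\cdot\|_2$. $\mathrm{Ad}_u x=uxu^{-1}$, applied pointwise to functions: $(\mathrm{Ad}_r g)(t)=\mathrm{Ad}_{r(t)}g(t)$. Product integral. For $f\in L^2(\mathbb{I},\mathfrak{k})$, $\Pi\exp f$ denotes the function $t\mapsto\prod_0^t\exp f(s)\,ds\in K$. It is the unique absolutely continuous $r\colon\mathbb{I}\to K$ with $r(0)=e$ and $r'(t)r(t)^{-1}=f(t)$ for a.e. $t$. For a step function $f$ constant on each $[t_i,t_{i+1})$ (with $t_0=0$) and $t\in[t_j,t_{j+1})$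 it equals $\exp((t-t_j)f(t_j))\exp((t_j-t_{j-1})f(t_{j-1}))\cdots\exp(t_1f(0))$. Group law. $L^2(\mathbb{I},\mathfrak{k})$ carries the group law $f\ast g=f+\mathrm{Ad}_{\Pi\exp f}\,g$. Spaces and measures. $P_N$ is the uniform partition of $\mathbb{I}$ into $N$ subintervals of length $1/N$. $V_N\subset L^2(\mathbb{I},\mathfrak{k})$ is the $Nd$-dimensional Euclidean space of functions that are a.e. constant on the elements of $P_N$, and $V_\infty=\bigcup_{N\ge1}V_N$. $B_N$ is the unit ball of $V_N$ (for $\|\cdot\|_2$). For $R>0$, $\nu_{N,R}$ is the restriction of Lebesgue measure on $V_N$ to the ball $RB_N$, normalized to be a probability measure. $\nu_{N,R}\ast g$ is the pushforward of $\nu_{N,R}$ under $f\mapsto f\ast g$. The Monge–Kantorovich (mass transportation) distance between probability measures on $L^2(\mathbb{I},\mathfrak{k})$ is formed with respect to the metric $\min\{\|f-g\|_2,1\}$. *)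

theory Defs
  imports "HOL-Analysis.Analysis"
begin

text \<open>
  A compact subgroup of an orthogonal group is closed, hence a Lie group, so no separate
  smoothness condition is required.
\<close>

definition compact_connected_orthogonal_group :: "(real^'n^'n) set \<Rightarrow> bool" where
  "compact_connected_orthogonal_group K \<longleftrightarrow>
     (\<forall>u\<in>K. orthogonal_matrix u) \<and>
     mat 1 \<in> K \<and>
     (\<forall>u\<in>K. \<forall>v\<in>K. u ** v \<in> K) \<and>
     (\<forall>u\<in>K. matrix_inv u \<in> K) \<and>
     compact K \<and> connected K"

definition mexp :: "real^'n^'n \<Rightarrow> real^'n^'n" where
  "mexp A = (\<Sum>k. (1 / fact k) *\<^sub>R ((\<lambda>M. A ** M) ^^ k) (mat 1))"

definition lie_algebra :: "(real^'n^'n) set \<Rightarrow> (real^'n^'n) set" where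
  "lie_algebra K = {X. \<forall>t::real. mexp (t *\<^sub>R X) \<in> K}"

definition Ad :: "real^'n^'n \<Rightarrow> real^'n^'n \<Rightarrow> real^'n^'n" where
  "Ad u x = u ** x ** matrix_inv u"

text \<open>
  The inner product is an arbitrary one on the subspace \<open>V\<close>; its values off \<open>V\<close> play no role.
\<close>

definition inner_product_on :: "'a::real_vector set \<Rightarrow> ('a \<Rightarrow> 'a \<Rightarrow> real) \<Rightarrow> bool" where
  "inner_product_on V ip \<longleftrightarrow>
     (\<forall>x\<in>V. \<forall>y\<in>V. ip x y = ip y x) \<and>
     (\<forall>x\<in>V. \<forall>y\<in>V. \<forall>z\<in>V. ip (x + y) z = ip x z + ip y z) \<and>
     (\<forall>a. \<forall>x\<in>V. \<forall>y\<in>V. ip (a *\<^sub>R x) y = a * ip x y) \<and>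
     (\<forall>x\<in>V. x \<noteq> 0 \<longrightarrow> 0 < ip x x)"

definition Ad_invariant ::
  "(real^'n^'n) set \<Rightarrow> (real^'n^'n \<Rightarrow> real^'n^'n \<Rightarrow> real) \<Rightarrow> bool" where
  "Ad_invariant K ip \<longleftrightarrow>
     (\<forall>u\<in>K. \<forall>x\<in>lie_algebra K. \<forall>y\<in>lie_algebra K. ip (Ad u x) (Ad u y) = ip x y)"

text \<open>
  Elements are represented by functions instead of classes of almost everywhere equal functions,
  and values outside the unit interval are irrelevant. Thus \<open>L2_dist\<close> is a pseudometric; its open
  sets are unions of classes, so Borel probability measures, couplings and Lipschitz functions
  for it are the same thing as those on the Hilbert space of classes.
\<close>

definition L2_space ::
  "(real^'n^'n) set \<Rightarrow> (real^'n^'n \<Rightarrow> real^'n^'n \<Rightarrow> real) \<Rightarrow> (real \<Rightarrow> real^'n^'n) set" where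
  "L2_space K ip =
     {f. (\<forall>t\<in>{0..1}. f t \<in> lie_algebra K) \<and>
         f \<in> borel_measurable (lebesgue_on {0..1}) \<and>
         integrable (lebesgue_on {0..1}) (\<lambda>t. ip (f t) (f t))}"

definition L2_norm :: "('a \<Rightarrow> 'a \<Rightarrow> real) \<Rightarrow> (real \<Rightarrow> 'a) \<Rightarrow> real" where
  "L2_norm ip f = sqrt (\<integral>t. ip (f t) (f t) \<partial>lebesgue_on {0..1})"

definition L2_dist ::
  "('a::real_vector \<Rightarrow> 'a \<Rightarrow> real) \<Rightarrow> (real \<Rightarrow> 'a) \<Rightarrow> (real \<Rightarrow> 'a) \<Rightarrow> real" where
  "L2_dist ip f h = L2_norm ip (\<lambda>t. f t - h t)"

definition L2_borel ::
  "(real^'n^'n) set \<Rightarrow> (real^'n^'n \<Rightarrow> real^'n^'n \<Rightarrow> real) \<Rightarrow> (real \<Rightarrow> real^'n^'n) measure" where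
  "L2_borel K ip = sigma (L2_space K ip)
     {U. U \<subseteq> L2_space K ip \<and>
         (\<forall>f\<in>U. \<exists>e>0. \<forall>h\<in>L2_space K ip. L2_dist ip f h < e \<longrightarrow> h \<in> U)}"

definition absolutely_continuous_on ::
  "real set \<Rightarrow> (real \<Rightarrow> 'a::real_normed_vector) \<Rightarrow> bool" where
  "absolutely_continuous_on S r \<longleftrightarrow>
     (\<forall>\<epsilon>>0. \<exists>\<delta>>0. \<forall>D. finite D \<and>
        (\<forall>(a, b)\<in>D. a \<le> b \<and> {a..b} \<subseteq> S) \<and>
        disjoint_family_on (\<lambda>(a, b). {a<..<b}) D \<and>
        (\<Sum>(a, b)\<in>D. b - a) < \<delta>
        \<longrightarrow> (\<Sum>(a, b)\<in>D. norm (r b - r a)) < \<epsilon>)"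

text \<open>
  The extensional function space \<open>\<rightarrow>\<^sub>E\<close> only fixes the values of \<open>r\<close> outside the unit interval,
  which makes \<open>r\<close> unique as a function on the whole line.
\<close>

definition prod_integral ::
  "(real^'n^'n) set \<Rightarrow> (real \<Rightarrow> real^'n^'n) \<Rightarrow> real \<Rightarrow> real^'n^'n" where
  "prod_integral K f =
     (THE r. r \<in> {0..1} \<rightarrow>\<^sub>E K \<and>
        absolutely_continuous_on {0..1} r \<and>
        r 0 = mat 1 \<and>
        (AE t in lebesgue_on {0..1}.
           \<exists>r'. (r has_vector_derivative r') (at t within {0..1}) \<and>
                r' ** matrix_inv (r t) = f t))"

definition group_law ::
  "(real^'n^'n) set \<Rightarrow> (real \<Rightarrow> real^'n^'n) \<Rightarrow> (real \<Rightarrow> real^'n^'n) \<Rightarrow> real \<Rightarrow> real^'n^'n" where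
  "group_law K f g = (\<lambda>t. f t + Ad (prod_integral K f t) (g t))"

definition V ::
  "(real^'n^'n) set \<Rightarrow> (real^'n^'n \<Rightarrow> real^'n^'n \<Rightarrow> real) \<Rightarrow> nat \<Rightarrow> (real \<Rightarrow> real^'n^'n) set" where
  "V K ip N =
     {f \<in> L2_space K ip. \<forall>i<N. \<exists>c.
        AE t in lebesgue_on {real i / real N..real (Suc i) / real N}. f t = c}"

definition V_infinity ::
  "(real^'n^'n) set \<Rightarrow> (real^'n^'n \<Rightarrow> real^'n^'n \<Rightarrow> real) \<Rightarrow> (real \<Rightarrow> real^'n^'n) set" where
  "V_infinity K ip = (\<Union>N\<in>{1..}. V K ip N)"

definition orthonormal_basis_of ::
  "'a::real_vector set \<Rightarrow> ('a \<Rightarrow> 'a \<Rightarrow> real) \<Rightarrow> 'a set \<Rightarrow> bool" where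
  "orthonormal_basis_of W ip B \<longleftrightarrow>
     finite B \<and> B \<subseteq> W \<and> span B = W \<and>
     (\<forall>b\<in>B. \<forall>c\<in>B. ip b c = (if b = c then 1 else 0))"

text \<open>
  If \<open>B\<close> is an orthonormal basis of the Lie algebra, then the functions
  \<open>sqrt N * indicator {i/N..<(i+1)/N} * b\<close>, with \<open>i < N\<close> and \<open>b \<in> B\<close>, form an orthonormal
  basis of \<open>V\<close>. So \<open>step_of_coords\<close> is a linear isometry from the coordinate space onto \<open>V\<close> (up to
  almost everywhere equality), and the image of the product of one-dimensional Lebesgue measures
  is the Lebesgue measure of the Euclidean space \<open>V\<close>. It does not depend on the choice of \<open>B\<close>.
\<close>

definition step_of_coords ::
  "nat \<Rightarrow> 'a::real_vector set \<Rightarrow> (nat \<times> 'a \<Rightarrow> real) \<Rightarrow> real \<Rightarrow> 'a" where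
  "step_of_coords N B c = (\<lambda>t. \<Sum>(i, b)\<in>{..<N} \<times> B.
     (c (i, b) * sqrt (real N) * indicator {real i / real N..<real (Suc i) / real N} t) *\<^sub>R b)"

definition lebesgue_V ::
  "(real^'n^'n) set \<Rightarrow> (real^'n^'n \<Rightarrow> real^'n^'n \<Rightarrow> real) \<Rightarrow> nat
     \<Rightarrow> (real \<Rightarrow> real^'n^'n) measure" where
  "lebesgue_V K ip N =
     (let B = (SOME B. orthonormal_basis_of (lie_algebra K) ip B)
      in distr (\<Pi>\<^sub>M p\<in>{..<N} \<times> B. lborel) (restrict_space (L2_borel K ip) (V K ip N))
           (step_of_coords N B))"

definition nu ::
  "(real^'n^'n) set \<Rightarrow> (real^'n^'n \<Rightarrow> real^'n^'n \<Rightarrow> real) \<Rightarrow> nat \<Rightarrow> real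
     \<Rightarrow> (real \<Rightarrow> real^'n^'n) measure" where
  "nu K ip N R = uniform_measure (lebesgue_V K ip N) {f \<in> V K ip N. L2_norm ip f \<le> R}"

text \<open>
  \<open>nu\<close> is a measure on \<open>V\<close>. The next two are measures on the whole \<open>L\<^sup>2\<close> space: \<open>nu\<close>
  itself, transported along the inclusion, and its image under right multiplication by \<open>g\<close>.
\<close>

definition nu_L2 ::
  "(real^'n^'n) set \<Rightarrow> (real^'n^'n \<Rightarrow> real^'n^'n \<Rightarrow> real) \<Rightarrow> nat \<Rightarrow> real
     \<Rightarrow> (real \<Rightarrow> real^'n^'n) measure" where
  "nu_L2 K ip N R = distr (nu K ip N R) (L2_borel K ip) (\<lambda>f. f)"

definition nu_mult ::
  "(real^'n^'n) set \<Rightarrow> (real^'n^'n \<Rightarrow> real^'n^'n \<Rightarrow> real) \<Rightarrow> nat \<Rightarrow> real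
     \<Rightarrow> (real \<Rightarrow> real^'n^'n) \<Rightarrow> (real \<Rightarrow> real^'n^'n) measure" where
  "nu_mult K ip N R g = distr (nu K ip N R) (L2_borel K ip) (\<lambda>f. group_law K f g)"

definition couplings :: "'a measure \<Rightarrow> 'a measure \<Rightarrow> ('a \<times> 'a) measure set" where
  "couplings \<mu> \<mu>' =
     {\<gamma>. sets \<gamma> = sets (\<mu> \<Otimes>\<^sub>M \<mu>') \<and> distr \<gamma> \<mu> fst = \<mu> \<and> distr \<gamma> \<mu>' snd = \<mu>'}"

definition MK_dist :: "('a \<Rightarrow> 'a \<Rightarrow> real) \<Rightarrow> 'a measure \<Rightarrow> 'a measure \<Rightarrow> ennreal" where
  "MK_dist d \<mu> \<mu>' = (INF \<gamma>\<in>couplings \<mu> \<mu>'. \<integral>\<^sup>+(x, y). ennreal (d x y) \<partial>\<gamma>)"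

definition bounded_1_Lipschitz ::
  "(real^'n^'n) set \<Rightarrow> (real^'n^'n \<Rightarrow> real^'n^'n \<Rightarrow> real) \<Rightarrow> ((real \<Rightarrow> real^'n^'n) \<Rightarrow> real) set" where
  "bounded_1_Lipschitz K ip =
     {F. (\<forall>f\<in>L2_space K ip. \<forall>h\<in>L2_space K ip. \<bar>F f - F h\<bar> \<le> L2_dist ip f h) \<and>
         (\<forall>f\<in>L2_space K ip. \<bar>F f\<bar> \<le> 1)}"

end

theory Submission
  imports Defs "HOL-Real_Asymp.Real_Asymp"
begin

text \<open>
  In the orthonormal coordinates \<open>c\<close> of \<open>V_N\<close>, right multiplication by \<open>g\<close> is close in \<open>L\<^sup>2\<close>
  to the map \<open>T\<close> that adds to the value on the \<open>i\<close>-th interval the vector \<open>Ad u_i g_i\<close>, where \<open>g_i\<close>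
  is the value of \<open>g\<close> at the left end point and \<open>u_i\<close> is the value of the product integral there:
  the error is \<open>O(R_N / N)\<close> plus the discretization error of \<open>g\<close>. Since \<open>u_i\<close> depends only on
  the earlier coordinates, \<open>T\<close> is triangular and preserves Lebesgue measure.

  Write \<open>T c = c + h c\<close>. Then \<open>|T c|\<^sup>2 = |c|\<^sup>2 + 2 \<langle>c, h c\<rangle> + |h c|\<^sup>2\<close> with \<open>|h c|\<close> bounded, and
  reflecting single coordinates shows that the summands of \<open>\<langle>c, h c\<rangle>\<close> are orthogonal on the ball, so
  its second moment is \<open>O(R_N\<^sup>2 / N)\<close>. Hence \<open>T c\<close> stays, with probability close to one, in a
  ball of radius \<open>R'\<close> slightly larger than \<open>R_N\<close>. Because \<open>R_N / sqrt N\<close> tends to infinity, \<open>R'\<close> can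
  be chosen so that \<open>(R' / R_N) ^ (N d)\<close> tends to one, and then measure preservation shows that \<open>T c\<close>
  rarely leaves the original ball. Resampling in that case yields a coupling.
\<close>

section \<open>The matrix exponential\<close>

text \<open>The crude bound |T c| \<le> |c| + G is useless: the volume ratio (1 + G / R_N) ^ (N d)
  stays bounded only if R_N is at least of order N, which R_N / N \<rightarrow> 0 excludes. What
  helps is that the inner product of c with the shift is typically of size R_N / sqrt N only. The
  relative growth of |c|^2 is then about 1 / (R_N sqrt N), and multiplied by the dimension N d it is
  of order sqrt N / R_N, which tends to zero.

  Freezing u_i at the left end point makes this possible. With the moving product integral the
  shifted function would leave V_N, and the translation in a cell would depend on the coordinates of
  that cell, so neither exact measure preservation nor the reflection argument would apply. The
  price is the motion of the path inside a cell; this is where R_N / N \<rightarrow> 0 enters.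

  Two preliminaries are forced by the definitions: the Lie algebra, given by one-parameter groups,
  has to be shown to be a subspace, and the definite description of the product integral has to be
  resolved, which requires uniqueness among absolutely continuous paths.\<close>

lemma bounded_bilinear_matrix_mult:
  "bounded_bilinear ((**) :: real^'n^'n \<Rightarrow> real^'n^'n \<Rightarrow> real^'n^'n)"
proof -
  have "bilinear ((**) :: real^'n^'n \<Rightarrow> real^'n^'n \<Rightarrow> real^'n^'n)"
    unfolding bilinear_def
    by (auto intro!: linearI simp: matrix_matrix_mult_def vec_eq_iff sum.distrib sum_distrib_left algebra_simps)
  then show ?thesis by (simp add: bilinear_conv_bounded_bilinear)
qed

interpretation mm: bounded_bilinear "(**) :: real^'n^'n \<Rightarrow> real^'n^'n \<Rightarrow> real^'n^'n"
  by (rule bounded_bilinear_matrix_mult)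

lemma inner_matrix_mult_left:
  "inner (A ** B) C = inner B (transpose A ** C)" for A B C :: "real^'n^'n"
proof -
  have "inner (A ** B) C = (\<Sum>i\<in>UNIV. \<Sum>j\<in>UNIV. \<Sum>k\<in>UNIV. A$i$k * B$k$j * C$i$j)"
    by (simp add: inner_vec_def matrix_matrix_mult_def sum_distrib_right)
  also have "\<dots> = (\<Sum>k\<in>UNIV. \<Sum>j\<in>UNIV. \<Sum>i\<in>UNIV. A$i$k * B$k$j * C$i$j)"
    by (subst sum.swap, subst (2) sum.swap, rule sum.swap[THEN trans], rule refl)
  also have "\<dots> = inner B (transpose A ** C)"
    by (simp add: inner_vec_def matrix_matrix_mult_def sum_distrib_left transpose_def mult_ac)
  finally show ?thesis .
qed

lemma inner_transpose: "inner (transpose A) (transpose B) = inner A B" for A B :: "real^'n^'n"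
  by (simp add: inner_vec_def transpose_def) (rule sum.swap)

lemma norm_transpose: "norm (transpose A) = norm A" for A :: "real^'n^'n"
  by (simp add: norm_eq_sqrt_inner inner_transpose)

text \<open>The norm of a matrix as a vector of vectors is the Frobenius norm, which orthogonal
  factors preserve. This is why the estimates for exponentials and paths below hold with constant
  one.\<close>

lemma norm_orthogonal_mult_left:
  fixes A u :: "real^'n^'n"
  assumes "orthogonal_matrix u"
  shows "norm (u ** A) = norm A"
  using assms
  by (simp add: norm_eq_sqrt_inner inner_matrix_mult_left matrix_mul_assoc orthogonal_matrix)

lemma norm_orthogonal_mult_right:
  fixes A u :: "real^'n^'n"
  assumes "orthogonal_matrix u"
  shows "norm (A ** u) = norm A"
proof -
  have "norm (A ** u) = norm (transpose u ** transpose A)"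
    by (metis matrix_transpose_mul norm_transpose)
  also have "\<dots> = norm A"
    using assms by (simp add: norm_orthogonal_mult_left orthogonal_matrix_transpose norm_transpose)
  finally show ?thesis .
qed

lemma matrix_inv_orthogonal:
  fixes u :: "real^'n^'n"
  assumes "orthogonal_matrix u"
  shows "matrix_inv u = transpose u"
proof -
  have "u ** matrix_inv u = mat 1 \<and> matrix_inv u ** u = mat 1"
    unfolding matrix_inv_def by (rule someI[of _ "transpose u"]) (use assms in \<open>simp add: orthogonal_matrix_def\<close>)
  then show ?thesis
    using assms unfolding orthogonal_matrix_def by (metis matrix_mul_assoc matrix_mul_lid matrix_mul_rid)
qed

lemma transpose_add: "transpose (A + B) = transpose A + transpose B"
  by (simp add: transpose_def vec_eq_iff)

lemma transpose_scaleR: "transpose (c *\<^sub>R A) = c *\<^sub>R transpose A"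
  by (simp add: transpose_def vec_eq_iff)

lemma bounded_linear_transpose: "bounded_linear (transpose :: real^'n^'n \<Rightarrow> real^'n^'n)"
  by (intro linear_conv_bounded_linear[THEN iffD1] linearI transpose_add transpose_scaleR)

definition skew :: "real^'n^'n \<Rightarrow> bool" where
  "skew Z \<longleftrightarrow> transpose Z = - Z"

lemma inner_skew_mult:
  fixes u :: "real^'n^'n"
  assumes "skew Z"
  shows "inner (Z ** u) u = 0"
  using assms inner_matrix_mult_left[of Z u u]
  by (simp add: skew_def mm.minus_left inner_commute)

lemma skew_scaleR: "skew Z \<Longrightarrow> skew (a *\<^sub>R Z)"
  by (simp add: skew_def transpose_scaleR)

lemma skew_add: "skew X \<Longrightarrow> skew Y \<Longrightarrow> skew (X + Y)"
  by (simp add: skew_def transpose_add)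

section \<open>Powers and the exponential series\<close>

definition mpow :: "real^'n^'n \<Rightarrow> nat \<Rightarrow> real^'n^'n" where
  "mpow A k = ((\<lambda>M. A ** M) ^^ k) (mat 1)"

lemma mpow_0 [simp]: "mpow A 0 = mat 1"
  and mpow_Suc: "mpow A (Suc k) = A ** mpow A k"
  by (simp_all add: mpow_def)

lemma mpow_scaleR: "mpow (t *\<^sub>R A) k = t ^ k *\<^sub>R mpow A k"
  by (induction k) (simp_all add: mpow_Suc mm.scaleR_left mm.scaleR_right)

lemma mpow_Suc2: "mpow A (Suc k) = mpow A k ** A"
proof (induction k)
  case (Suc k)
  then show ?case
    by (simp only: mpow_Suc[of A "Suc k"] mpow_Suc[of A k] matrix_mul_assoc)
qed (simp add: mpow_Suc)

lemma norm_mpow_le: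
  fixes A :: "real^'n^'n"
  obtains C L :: real where "C \<ge> 0" "L \<ge> 0" "\<And>k. norm (mpow A k) \<le> C * L ^ k"
proof -
  obtain K where K: "K > 0" "\<And>(a :: real^'n^'n) (b :: real^'n^'n). norm (a ** b) \<le> norm a * norm b * K"
    using mm.pos_bounded[where 'n='n] by auto
  have "norm (mpow A k) \<le> norm (mat 1 :: real^'n^'n) * (norm A * K) ^ k" for k
  proof (induction k)
    case (Suc k)
    have "norm (mpow A (Suc k)) \<le> norm A * norm (mpow A k) * K"
      unfolding mpow_Suc by (rule K)
    also have "\<dots> \<le> norm A * (norm (mat 1 :: real^'n^'n) * (norm A * K) ^ k) * K"
      using Suc K by (intro mult_right_mono mult_left_mono) auto
    finally show ?case by (simp add: mult_ac)
  qed simp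
  then show ?thesis using K by (intro that[of "norm (mat 1 :: real^'n^'n)" "norm A * K"]) auto
qed

lemma summable_mexp: "summable (\<lambda>k. (1 / fact k) *\<^sub>R mpow A k)"
proof -
  obtain C L :: real where CL: "C \<ge> 0" "L \<ge> 0" "\<And>k. norm (mpow A k) \<le> C * L ^ k"
    using norm_mpow_le by blast
  have "summable (\<lambda>k. C * (L ^ k /\<^sub>R fact k))"
    by (intro summable_mult summable_exp_generic)
  then show ?thesis
    by (rule summable_comparison_test')
      (use CL in \<open>auto simp: field_simps\<close>)
qed

lemma mexp_sums: "(\<lambda>k. (1 / fact k) *\<^sub>R mpow A k) sums mexp A"
  unfolding mexp_def mpow_def[symmetric] by (rule summable_sums[OF summable_mexp])

lemma mexp_scaleR_sums: "(\<lambda>k. (t ^ k / fact k) *\<^sub>R mpow A k) sums mexp (t *\<^sub>R A)"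
  using mexp_sums[of "t *\<^sub>R A"] by (simp add: mpow_scaleR)

text \<open>Every coordinate of the curve is a real power series in \<open>t\<close>, so termwise
  differentiation reduces to the scalar case; \<open>diffs\<close> turns \<open>mpow A k\<close>
  into \<open>mpow A (Suc k)\<close>, which produces the factor \<open>A\<close>.\<close>

lemma mexp_has_vector_derivative:
  "((\<lambda>t. mexp (t *\<^sub>R A)) has_vector_derivative (A ** mexp (t *\<^sub>R A))) (at t within S)"
proof -
  have "((\<lambda>t. mexp (t *\<^sub>R A) \<bullet> e) has_real_derivative ((A ** mexp (t *\<^sub>R A)) \<bullet> e)) (at t)"
    if "e \<in> Basis" for e
  proof -
    define c where "c k = (mpow A k \<bullet> e) / fact k" for k
    have s: "(\<lambda>k. c k * x ^ k) sums (mexp (x *\<^sub>R A) \<bullet> e)" for x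
      using bounded_linear.sums[OF bounded_linear_inner_left[of e] mexp_scaleR_sums[of x A]]
      by (simp add: c_def mult_ac)
    have "(\<lambda>k. diffs c k * t ^ k) sums ((A ** mexp (t *\<^sub>R A)) \<bullet> e)"
    proof -
      have "(\<lambda>k. (A ** ((t ^ k / fact k) *\<^sub>R mpow A k)) \<bullet> e) sums ((A ** mexp (t *\<^sub>R A)) \<bullet> e)"
        by (intro bounded_linear.sums[OF mm.bounded_linear_right]
            bounded_linear.sums[OF bounded_linear_inner_left] mexp_scaleR_sums)
      moreover have "diffs c k * t ^ k = (A ** ((t ^ k / fact k) *\<^sub>R mpow A k)) \<bullet> e" for k
        by (simp add: diffs_def c_def mm.scaleR_right mpow_Suc[symmetric])
      ultimately show ?thesis by simp
    qed
    moreover have "((\<lambda>t. \<Sum>k. c k * t ^ k) has_real_derivative (\<Sum>k. diffs c k * t ^ k)) (at t)"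
      by (intro termdiffs_strong_converges_everywhere) (use s in \<open>auto simp: sums_iff\<close>)
    moreover have "(\<lambda>t. \<Sum>k. c k * t ^ k) = (\<lambda>t. mexp (t *\<^sub>R A) \<bullet> e)"
      using s by (auto simp: sums_iff)
    ultimately show ?thesis by (simp add: sums_iff)
  qed
  then have "((\<lambda>t. mexp (t *\<^sub>R A)) has_vector_derivative (A ** mexp (t *\<^sub>R A))) (at t)"
    unfolding has_vector_derivative_def
    by (subst has_derivative_componentwise_within)
      (auto simp: has_field_derivative_def mult_commute_abs)
  then show ?thesis
    using has_vector_derivative_at_within by blast
qed

lemma mexp_0 [simp]: "mexp (0 :: real^'n^'n) = mat 1"
proof -
  have "mpow (0 :: real^'n^'n) k = (if k = 0 then mat 1 else 0)" for k
    by (cases k) (auto simp: mpow_Suc mm.zero_left)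
  then have "(\<lambda>k. (1 / fact k) *\<^sub>R mpow (0 :: real^'n^'n) k) sums (mat 1 :: real^'n^'n)"
    using sums_single[of 0 "\<lambda>_. mat 1 :: real^'n^'n"]
    by (auto elim!: sums_cong[THEN iffD1, rotated] simp: fun_eq_iff simp del: scaleR_left_distrib)
  then show ?thesis using mexp_sums sums_unique2 by blast
qed

lemma transpose_mexp: "transpose (mexp A) = mexp (transpose A)"
proof -
  have "transpose (mpow A k) = mpow (transpose A) k" for k
  proof (induction k)
    case (Suc k)
    then show ?case
      by (simp only: mpow_Suc[of A] mpow_Suc2[of "transpose A"] matrix_transpose_mul)
  qed simp
  then show ?thesis
    using bounded_linear.sums[OF bounded_linear_transpose mexp_sums[of A]]
      mexp_sums[of "transpose A"] by (simp add: transpose_scaleR sums_unique2)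
qed

lemma mexp_conj:
  fixes u v :: "real^'n^'n"
  assumes "v ** u = mat 1"
  shows "mexp (u ** A ** v) = u ** mexp A ** v"
proof -
  have uv: "u ** v = mat 1" by (rule iffD1[OF matrix_left_right_inverse assms])
  have "mpow (u ** A ** v) k = u ** mpow A k ** v" for k
  proof (induction k)
    case (Suc k)
    have "mpow (u ** A ** v) (Suc k) = u ** A ** (v ** u) ** mpow A k ** v"
      unfolding mpow_Suc Suc by (simp add: matrix_mul_assoc)
    also have "\<dots> = u ** mpow A (Suc k) ** v"
      by (simp add: assms mpow_Suc matrix_mul_assoc)
    finally show ?case .
  qed (simp add: uv)
  moreover have "bounded_linear (\<lambda>M. u ** M ** v)"
    by (intro bounded_linear_compose[OF mm.bounded_linear_left mm.bounded_linear_right])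
  note bounded_linear.sums[OF this mexp_sums[of A]]
  ultimately show ?thesis
    using mexp_sums[of "u ** A ** v"]
    by (simp add: mm.scaleR_left mm.scaleR_right sums_unique2)
qed

section \<open>One-parameter groups of skew matrices\<close>

lemma has_vector_derivative_zero_const:
  fixes F :: "real \<Rightarrow> 'a::banach"
  assumes "\<And>t. (F has_vector_derivative 0) (at t)"
  shows "F s = F t"
proof -
  have "F t = F s"
    by (rule has_derivative_zero_unique[of UNIV]) (use assms in \<open>auto simp: has_vector_derivative_def\<close>)
  then show ?thesis by simp
qed

text \<open>A skew \<open>Z\<close> generates norm-preserving flows, so
  \<open>F t \<bullet> F t\<close> is constant and no Gronwall estimate is required.\<close>

lemma skew_ode_unique:
  fixes F :: "real \<Rightarrow> real^'n^'n"
  assumes "skew Z" and F: "\<And>t. (F has_vector_derivative (Z ** F t)) (at t)" and "F 0 = 0"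
  shows "F t = 0"
proof -
  have "((\<lambda>t. F t \<bullet> F t) has_vector_derivative (F t \<bullet> (Z ** F t) + (Z ** F t) \<bullet> F t)) (at t)" for t
    by (rule bounded_bilinear.has_vector_derivative[OF bounded_bilinear_inner F F])
  then have "((\<lambda>t. F t \<bullet> F t) has_vector_derivative 0) (at t)" for t
    using inner_skew_mult[OF assms(1)] by (simp add: inner_commute)
  from has_vector_derivative_zero_const[OF this, of t 0] show ?thesis
    using assms(3) by simp
qed

text \<open>As functions of \<open>t\<close>, both sides solve the same linear equation with the
  same value at \<open>0\<close>.\<close>

lemma mexp_add_scaleR:
  assumes "skew Z"
  shows "mexp ((t + s) *\<^sub>R Z) = mexp (t *\<^sub>R Z) ** mexp (s *\<^sub>R Z)"
proof -
  define F where "F t = mexp ((t + s) *\<^sub>R Z) - mexp (t *\<^sub>R Z) ** mexp (s *\<^sub>R Z)" for t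
  have "(F has_vector_derivative (Z ** F t)) (at t)" for t
  proof -
    have "((\<lambda>t. t + s) has_vector_derivative 1) (at t)"
      by (auto intro!: derivative_eq_intros)
    then have "((\<lambda>t. mexp ((t + s) *\<^sub>R Z)) has_vector_derivative (Z ** mexp ((t + s) *\<^sub>R Z))) (at t)"
      using vector_diff_chain_at[of "\<lambda>t. t + s" 1 t "\<lambda>t. mexp (t *\<^sub>R Z)" "Z ** mexp ((t + s) *\<^sub>R Z)"]
        mexp_has_vector_derivative[of Z "t + s" UNIV]
      by (auto simp: o_def)
    moreover have "((\<lambda>t. mexp (t *\<^sub>R Z) ** mexp (s *\<^sub>R Z)) has_vector_derivative
        ((Z ** mexp (t *\<^sub>R Z)) ** mexp (s *\<^sub>R Z))) (at t)"
      by (intro bounded_linear.has_vector_derivative[OF mm.bounded_linear_left]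
          mexp_has_vector_derivative)
    ultimately show ?thesis
      unfolding F_def by (auto intro!: derivative_eq_intros simp: mm.diff_right matrix_mul_assoc)
  qed
  from skew_ode_unique[OF assms this, of t] show ?thesis
    by (simp add: F_def)
qed

lemma orthogonal_mexp:
  assumes "skew Z"
  shows "orthogonal_matrix (mexp Z)"
proof -
  have "transpose (mexp Z) ** mexp Z = mexp ((-1) *\<^sub>R Z) ** mexp (1 *\<^sub>R Z)"
    using assms by (simp add: transpose_mexp skew_def)
  also have "\<dots> = mat 1"
    unfolding mexp_add_scaleR[OF assms, symmetric] by simp
  finally show ?thesis by (simp add: orthogonal_matrix)
qed

text \<open>Differentiate the orthogonality relation at \<open>t = 0\<close>.\<close>

lemma skew_if_orthogonal_mexp:
  assumes "\<And>t. orthogonal_matrix (mexp (t *\<^sub>R Z))"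
  shows "skew Z"
proof -
  have T: "(transpose (mexp (t *\<^sub>R Z)) ** mexp (t *\<^sub>R Z)) = mat 1" for t
    using assms[of t] by (simp add: orthogonal_matrix)
  have "((\<lambda>t. transpose (mexp (t *\<^sub>R Z)) ** mexp (t *\<^sub>R Z)) has_vector_derivative
     (transpose (mexp (0 *\<^sub>R Z)) ** (Z ** mexp (0 *\<^sub>R Z))
      + transpose (Z ** mexp (0 *\<^sub>R Z)) ** mexp (0 *\<^sub>R Z))) (at 0)"
    by (intro mm.has_vector_derivative mexp_has_vector_derivative
        bounded_linear.has_vector_derivative[OF bounded_linear_transpose])
  then have "((\<lambda>t. mat 1) has_vector_derivative (Z + transpose Z)) (at 0)"
    by (simp add: T transpose_mat)
  then have "Z + transpose Z = 0"
    using vector_derivative_unique_at has_vector_derivative_const by blast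
  then show ?thesis by (simp add: skew_def add_eq_0_iff)
qed

text \<open>Duhamel: \<open>(exp tA)\<^sup>T exp tB\<close> has derivative \<open>(exp tA)\<^sup>T (B - A) exp tB\<close>.\<close>

lemma norm_mexp_diff_le:
  assumes "skew A" "skew B"
  shows "norm (mexp A - mexp B) \<le> norm (A - B)"
proof -
  define W where "W t = transpose (mexp (t *\<^sub>R A)) ** mexp (t *\<^sub>R B)" for t
  have o: "orthogonal_matrix (mexp (t *\<^sub>R A))" "orthogonal_matrix (mexp (t *\<^sub>R B))" for t
    using assms by (auto intro: orthogonal_mexp skew_scaleR)
  have d: "(W has_vector_derivative (transpose (mexp (t *\<^sub>R A)) ** ((B - A) ** mexp (t *\<^sub>R B)))) (at t)" for t
  proof -
    have "(W has_vector_derivative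
     (transpose (mexp (t *\<^sub>R A)) ** (B ** mexp (t *\<^sub>R B))
      + transpose (A ** mexp (t *\<^sub>R A)) ** mexp (t *\<^sub>R B))) (at t)"
      unfolding W_def by (intro mm.has_vector_derivative mexp_has_vector_derivative
        bounded_linear.has_vector_derivative[OF bounded_linear_transpose])
    then show ?thesis
      using assms by (simp add: skew_def matrix_transpose_mul mm.diff_left mm.diff_right mm.minus_right mm.minus_left matrix_mul_assoc)
  qed
  have "norm (transpose (mexp (t *\<^sub>R A)) ** ((B - A) ** mexp (t *\<^sub>R B))) = norm (B - A)" for t
    using o by (simp add: norm_orthogonal_mult_left norm_orthogonal_mult_right orthogonal_matrix_transpose)
  then have "norm (W 1 - W 0) \<le> norm (B - A) * norm (1 - 0 :: real)"
    using d by (intro differentiable_bound[of UNIV W "\<lambda>t h. h *\<^sub>R (transpose (mexp (t *\<^sub>R A)) ** ((B - A) ** mexp (t *\<^sub>R B)))"])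
      (auto simp: has_vector_derivative_def onorm_scaleR_left onorm_id intro!: onorm_le)
  then have "norm (W 1 - mat 1) \<le> norm (B - A)"
    by (simp add: W_def transpose_mat)
  moreover have "mexp A ** (W 1 - mat 1) = mexp B - mexp A"
    using o(1)[of 1] by (simp add: mm.diff_right W_def matrix_mul_assoc orthogonal_matrix_def)
  moreover have "norm (mexp A ** (W 1 - mat 1)) = norm (W 1 - mat 1)"
    using o(1)[of 1] by (simp add: norm_orthogonal_mult_left)
  ultimately show ?thesis by (simp add: norm_minus_commute)
qed

text \<open>Telescoping: orthogonal factors do not amplify errors, so \<open>k\<close> factors cost
  \<open>k\<close> times the error of one. In the Trotter argument this is \<open>n\<close> times an
  error of order \<open>o(1/n)\<close>.\<close>

lemma norm_mpow_diff_le: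
  assumes "orthogonal_matrix A" "orthogonal_matrix B"
  shows "norm (mpow A k - mpow B k) \<le> k * norm (A - B)"
proof (induction k)
  case (Suc k)
  have o: "orthogonal_matrix (mpow B k)"
    by (induction k) (auto simp: mpow_Suc intro: orthogonal_matrix_mul orthogonal_matrix_id assms)
  have "mpow A (Suc k) - mpow B (Suc k) = A ** (mpow A k - mpow B k) + (A - B) ** mpow B k"
    by (simp add: mpow_Suc mm.diff_left mm.diff_right)
  also have "norm \<dots> \<le> norm (mpow A k - mpow B k) + norm (A - B)"
    using norm_triangle_ineq[of "A ** (mpow A k - mpow B k)" "(A - B) ** mpow B k"]
    unfolding norm_orthogonal_mult_left[OF assms(1)] norm_orthogonal_mult_right[OF o] .
  also have "\<dots> \<le> k * norm (A - B) + norm (A - B)"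
    using Suc by simp
  finally show ?case by (simp add: algebra_simps)
qed simp

lemma mpow_mexp:
  assumes "skew Z"
  shows "mpow (mexp Z) k = mexp (real k *\<^sub>R Z)"
proof (induction k)
  case (Suc k)
  then show ?case
    using mexp_add_scaleR[OF assms, of 1 k] by (simp add: mpow_Suc)
qed simp

text \<open>The error of a single factor is \<open>o(1/n)\<close> because both curves have derivative \<open>X + Y\<close> at \<open>0\<close>.\<close>

lemma trotter_product:
  assumes "skew X" "skew Y"
  shows "(\<lambda>n. mpow (mexp ((1 / real n) *\<^sub>R X) ** mexp ((1 / real n) *\<^sub>R Y)) n) \<longlonglongrightarrow> mexp (X + Y)"
proof -
  define F where "F h = mexp (h *\<^sub>R X) ** mexp (h *\<^sub>R Y) - mexp (h *\<^sub>R (X + Y))" for h :: real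
  have "(F has_vector_derivative
     ((mexp (0 *\<^sub>R X) ** (Y ** mexp (0 *\<^sub>R Y)) + (X ** mexp (0 *\<^sub>R X)) ** mexp (0 *\<^sub>R Y))
       - (X + Y) ** mexp (0 *\<^sub>R (X + Y)))) (at 0)"
    unfolding F_def by (intro has_vector_derivative_diff mm.has_vector_derivative mexp_has_vector_derivative)
  then have "(F has_vector_derivative 0) (at 0)" by simp
  then have lim: "((\<lambda>h. norm (F h) / \<bar>h\<bar>) \<longlongrightarrow> 0) (at 0)"
    unfolding has_vector_derivative_def has_derivative_at by (simp add: F_def)
  have "filterlim (\<lambda>n. 1 / real n) (at 0) sequentially"
    by (intro filterlim_atI lim_1_over_n) (auto intro: eventually_sequentiallyI[of 1])
  from filterlim_compose[OF lim this]
  have lim: "(\<lambda>n. norm (F (1 / n)) / \<bar>1 / real n\<bar>) \<longlonglongrightarrow> 0" by simp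
  have "norm (mpow (mexp ((1 / real n) *\<^sub>R X) ** mexp ((1 / real n) *\<^sub>R Y)) n - mexp (X + Y))
      \<le> norm (F (1 / n)) / \<bar>1 / real n\<bar>" if "n \<ge> 1" for n
  proof -
    have "mpow (mexp ((1 / real n) *\<^sub>R (X + Y))) n = mexp (X + Y)"
      using that by (subst mpow_mexp) (auto intro!: skew_scaleR skew_add assms simp del: scaleR_add_right)
    moreover have "norm (mpow (mexp ((1 / real n) *\<^sub>R X) ** mexp ((1 / real n) *\<^sub>R Y)) n -
        mpow (mexp ((1 / real n) *\<^sub>R (X + Y))) n) \<le> n * norm (F (1 / n))"
      unfolding F_def
      by (intro norm_mpow_diff_le orthogonal_matrix_mul orthogonal_mexp skew_scaleR skew_add assms)
    ultimately show ?thesis by (simp add: mult.commute)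
  qed
  then show ?thesis
    by (intro Lim_transform_bound[OF _ lim, THEN LIM_zero_cancel] eventually_sequentiallyI[of 1]) auto
qed

section \<open>Absolutely continuous functions\<close>

abbreviation interval_family :: "real set \<Rightarrow> real \<Rightarrow> (real \<times> real) set \<Rightarrow> bool" where
  "interval_family S \<delta> D \<equiv> finite D \<and> (\<forall>(a, b)\<in>D. a \<le> b \<and> {a..b} \<subseteq> S) \<and>
    disjoint_family_on (\<lambda>(a, b). {a<..<b}) D \<and> (\<Sum>(a, b)\<in>D. b - a) < \<delta>"

text \<open>A gauge replaces the Vitali covering theorem. In a sufficiently fine tagged division the
  cells tagged in the exceptional null set \<open>E\<close> have total length below
  \<open>\<delta>\<close>, so absolute continuity bounds their increments; on every other cell the
  increment is at most \<open>e\<close> times the length.\<close>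

lemma zero_derivative_ae_imp_constant:
  fixes f :: "real \<Rightarrow> 'a::real_normed_vector"
  assumes ac: "absolutely_continuous_on {0..1} f"
    and ae: "AE t in lebesgue_on {0..1}. (f has_vector_derivative 0) (at t within {0..1})"
    and t: "t \<in> {0..1}"
  shows "f t = f 0"
proof -
  have "norm (f t - f 0) \<le> 2 * e" if "e > 0" for e
  proof -
    obtain \<delta> where "\<delta> > 0" and \<delta>: "\<forall>D. interval_family {0..1} \<delta> D
        \<longrightarrow> (\<Sum>(a, b)\<in>D. norm (f b - f a)) < e"
      using ac[unfolded absolutely_continuous_on_def, THEN spec, THEN mp, OF \<open>e > 0\<close>]
      by (elim exE conjE) (rule that)
    define E where "E = {x \<in> {0..1}. \<not> (f has_vector_derivative 0) (at x within {0..1})}"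
    have "AE x in lebesgue. x \<notin> E"
      using ae by (subst (asm) AE_restrict_space_iff) (auto simp: E_def)
    then have "negligible E"
      unfolding eventually_ae_filter
      by auto (meson negligible_iff_null_sets negligible_subset)
    \<comment> \<open>The Riemann sums of this null integral are precisely the total lengths of the
      cells tagged in \<open>E\<close>, which is what makes them small.\<close>
    then have "(indicator E has_integral (0::real)) (cbox 0 t)"
      unfolding negligible_def by blast
    then obtain \<gamma>1 where "gauge \<gamma>1" and \<gamma>1: "\<forall>p. p tagged_division_of cbox 0 t \<and> \<gamma>1 fine p
        \<longrightarrow> norm ((\<Sum>(x, k)\<in>p. measure lborel k *\<^sub>R indicator E x) - (0::real)) < \<delta>"
      unfolding has_integral using \<open>\<delta> > 0\<close> by (elim allE[of _ \<delta>] impE exE conjE) (auto intro: that)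
    have "\<exists>d>0. x \<in> {0..1} - E \<longrightarrow> (\<forall>y\<in>{0..1}. \<bar>y - x\<bar> < d \<longrightarrow> norm (f y - f x) \<le> e * \<bar>y - x\<bar>)" for x
    proof (cases "x \<in> {0..1} - E")
      case True
      then have "(f has_derivative (\<lambda>h. 0)) (at x within {0..1})"
        by (auto simp: E_def has_vector_derivative_def)
      then show ?thesis
        using \<open>e > 0\<close> unfolding has_derivative_within_alt by (auto simp: True)
    qed (auto intro: exI[of _ 1])
    then obtain d where d: "\<And>x. d x > 0"
      "\<And>x y. x \<in> {0..1} - E \<Longrightarrow> y \<in> {0..1} \<Longrightarrow> \<bar>y - x\<bar> < d x \<Longrightarrow> norm (f y - f x) \<le> e * \<bar>y - x\<bar>"
      by metis
    have "gauge (\<lambda>x. \<gamma>1 x \<inter> ball x (d x))"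
      using \<open>gauge \<gamma>1\<close> d(1) by (intro gauge_Int gauge_ball_dependent) auto
    then obtain p where p: "p tagged_division_of {0..t}" "(\<lambda>x. \<gamma>1 x \<inter> ball x (d x)) fine p"
      using fine_division_exists_real by metis
    have fin: "finite p" using p(1) by (rule tagged_division_of_finite)
    have elem: "\<exists>a b. k = {a..b} \<and> a \<le> b \<and> Inf k = a \<and> Sup k = b \<and> x \<in> {a..b} \<and> {a..b} \<subseteq> {0..1}
        \<and> {a..b} \<subseteq> ball x (d x) \<and> measure lborel k = b - a"
      if xk: "(x, k) \<in> p" for x k
    proof -
      obtain a b where k: "k = {a..b}" using tagged_division_ofD(4)[OF p(1) xk] by auto
      moreover have "x \<in> k" "k \<subseteq> {0..t}" using tagged_division_ofD(2,3)[OF p(1) xk] by auto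
      moreover have "k \<subseteq> ball x (d x)" using p(2) xk by (auto simp: fine_def)
      ultimately show ?thesis using t by (intro exI[of _ a] exI[of _ b]) auto
    qed
    define B where "B = {(x, k) \<in> p. x \<in> E}"
    have "B \<subseteq> p" by (auto simp: B_def)
    have fB: "finite B" using fin \<open>B \<subseteq> p\<close> finite_subset by blast
    define h where "h = (\<lambda>(x::real, k::real set). (Inf k, Sup k))"
    \<comment> \<open>The map \<open>h\<close> forgets tags, so two cells of \<open>B\<close> may
      yield the same pair of end points. Disjoint interiors permit this only for degenerate cells,
      which contribute nothing to a sum with \<open>G a a = 0\<close>.\<close>
    have same: "Inf k = Sup k" if xy: "(x, k) \<in> B" "(y, l) \<in> B" "(x, k) \<noteq> (y, l)" "h (x, k) = h (y, l)" for x k y l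
    proof -
      obtain a b where k: "k = {a..b}" "a \<le> b" "Inf k = a" "Sup k = b"
        using elem[of x k] xy \<open>B \<subseteq> p\<close> by blast
      obtain a' b' where l: "l = {a'..b'}" "a' \<le> b'" "Inf l = a'" "Sup l = b'"
        using elem[of y l] xy \<open>B \<subseteq> p\<close> by blast
      have "interior k \<inter> interior l = {}"
        using tagged_division_ofD(5)[OF p(1), of x k y l] xy \<open>B \<subseteq> p\<close> by blast
      then show ?thesis using k l xy(4) by (auto simp: h_def)
    qed
    have sumB: "(\<Sum>(a, b)\<in>h ` B. G a b) = (\<Sum>(x, k)\<in>B. G (Inf k) (Sup k))"
      if "\<And>a. G a a = 0" for G :: "real \<Rightarrow> real \<Rightarrow> real"
    proof (subst sum.reindex_nontrivial[OF fB], goal_cases)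
      case (1 x y)
      then show ?case using same[of "fst x" "snd x" "fst y" "snd y"] that
        by (auto simp: h_def split: prod.splits)
    qed (simp add: h_def case_prod_unfold)
    have "(\<Sum>(a, b)\<in>h ` B. b - a) = (\<Sum>(x, k)\<in>B. Sup k - Inf k)"
      by (rule sumB) simp
    also have "\<dots> = (\<Sum>(x, k)\<in>p. measure lborel k *\<^sub>R indicator E x)"
      using fin elem \<open>B \<subseteq> p\<close>
      by (intro sum.mono_neutral_cong_left) (fastforce simp: B_def)+
    also have "\<dots> < \<delta>"
    proof -
      have "\<gamma>1 fine p" using p(2) by (auto simp: fine_def)
      then have "norm ((\<Sum>(x, k)\<in>p. measure lborel k *\<^sub>R indicator E x) - (0::real)) < \<delta>"
        using p(1) by (intro \<gamma>1[THEN spec, THEN mp]) simp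
      then show ?thesis unfolding real_norm_def by linarith
    qed
    finally have len: "(\<Sum>(a, b)\<in>h ` B. b - a) < \<delta>" .
    have "(\<Sum>(a, b)\<in>h ` B. norm (f b - f a)) < e"
    proof (rule \<delta>[THEN spec, THEN mp], intro conjI)
      show "(\<Sum>(a, b)\<in>h ` B. b - a) < \<delta>" by (rule len)
      show "\<forall>(a, b)\<in>h ` B. a \<le> b \<and> {a..b} \<subseteq> {0..1}"
      proof
        fix m assume "m \<in> h ` B"
        then obtain x k where xk: "(x, k) \<in> B" "m = (Inf k, Sup k)" by (auto simp: h_def)
        moreover from xk(1) \<open>B \<subseteq> p\<close> have "(x, k) \<in> p" by blast
        from elem[OF this] obtain a b where "a \<le> b" "Inf k = a" "Sup k = b" "{a..b} \<subseteq> {0..1}"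
          by blast
        ultimately show "case m of (a, b) \<Rightarrow> a \<le> b \<and> {a..b} \<subseteq> {0..1}" by simp
      qed
      show "disjoint_family_on (\<lambda>(a, b). {a<..<b}) (h ` B)"
        unfolding disjoint_family_on_def
      proof (intro ballI impI)
        fix m n assume m: "m \<in> h ` B" and n: "n \<in> h ` B" and "m \<noteq> n"
        from m obtain x k where xk: "(x, k) \<in> B" "m = h (x, k)" by auto
        from n obtain y l where yl: "(y, l) \<in> B" "n = h (y, l)" by auto
        obtain a b where k: "k = {a..b}" "Inf k = a" "Sup k = b"
          using elem[of x k] xk \<open>B \<subseteq> p\<close> by blast
        obtain a' b' where l: "l = {a'..b'}" "Inf l = a'" "Sup l = b'"
          using elem[of y l] yl \<open>B \<subseteq> p\<close> by blast
        have "interior k \<inter> interior l = {}"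
          using tagged_division_ofD(5)[OF p(1), of x k y l] xk yl \<open>m \<noteq> n\<close> \<open>B \<subseteq> p\<close> by blast
        then show "(case m of (a, b) \<Rightarrow> {a<..<b}) \<inter> (case n of (a, b) \<Rightarrow> {a<..<b}) = {}"
          using k l xk yl by (simp add: h_def)
      qed
    qed (use fB in auto)
    then have bad: "(\<Sum>(x, k)\<in>B. norm (f (Sup k) - f (Inf k))) < e"
      by (subst (asm) sumB) auto
    have good: "(\<Sum>(x, k)\<in>p - B. norm (f (Sup k) - f (Inf k))) \<le> e"
    proof -
      \<comment> \<open>Straddling: the tag lies between the end points, so its distances to them
        add up to the length of the cell.\<close>
      have "norm (f (Sup k) - f (Inf k)) \<le> e * measure lborel k" if xk: "(x, k) \<in> p - B" for x k
      proof -
        from xk elem obtain a b where k: "k = {a..b}" "a \<le> b" "Inf k = a" "Sup k = b"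
          "x \<in> {a..b}" "{a..b} \<subseteq> {0..1}" "{a..b} \<subseteq> ball x (d x)" "measure lborel k = b - a" by blast
        have x: "x \<in> {0..1} - E" using xk k by (auto simp: B_def)
        have "a \<in> ball x (d x)" "b \<in> ball x (d x)" "a \<in> {0..1}" "b \<in> {0..1}"
          using k by (auto simp: subset_eq)
        then have "norm (f a - f x) \<le> e * \<bar>a - x\<bar>" "norm (f b - f x) \<le> e * \<bar>b - x\<bar>"
          using d(2)[OF x] by (auto simp: dist_real_def abs_minus_commute)
        moreover have "norm (f b - f a) \<le> norm (f b - f x) + norm (f a - f x)"
          using norm_triangle_ineq4[of "f b - f x" "f a - f x"] by simp
        ultimately show ?thesis using k by (auto simp: algebra_simps abs_if split: if_splits)
      qed
      then have "(\<Sum>(x, k)\<in>p - B. norm (f (Sup k) - f (Inf k))) \<le> (\<Sum>(x, k)\<in>p - B. e * measure lborel k)"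
        by (intro sum_mono) auto
      also have "\<dots> \<le> (\<Sum>(x, k)\<in>p. e * measure lborel k)"
        using \<open>e > 0\<close> fin by (intro sum_mono2) auto
      also have "\<dots> = e * (\<Sum>(x, k)\<in>p. measure lborel k)"
        by (simp add: sum_distrib_left case_prod_unfold)
      also have "(\<Sum>(x, k)\<in>p. measure lborel k) = t"
        using additive_content_tagged_division[of p 0 t] p(1) t by simp
      also have "e * t \<le> e" using \<open>e > 0\<close> t by simp
      finally show ?thesis .
    qed
    have "f t - f 0 = (\<Sum>(x, k)\<in>p. f (Sup k) - f (Inf k))"
      using additive_tagged_division_1[OF _ p(1), of f] t by simp
    then have "norm (f t - f 0) \<le> (\<Sum>(x, k)\<in>p. norm (f (Sup k) - f (Inf k)))"
      using norm_sum[of "\<lambda>(x, k). f (Sup k) - f (Inf k)" p] by (simp add: case_prod_unfold)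
    also have "\<dots> = (\<Sum>(x, k)\<in>p - B. norm (f (Sup k) - f (Inf k))) + (\<Sum>(x, k)\<in>B. norm (f (Sup k) - f (Inf k)))"
      by (rule sum.subset_diff[OF \<open>B \<subseteq> p\<close> fin])
    finally show ?thesis using bad good by linarith
  qed
  from this[of "norm (f t - f 0) / 4"] show ?thesis by (cases "f t = f 0") auto
qed

text \<open>Needed for the squared distance between a candidate path and a Lipschitz path; with
  \<open>M = 0\<close> it also covers Lipschitz functions themselves.\<close>

lemma absolutely_continuous_on_dominated:
  assumes f: "absolutely_continuous_on S f" and "M \<ge> 0" "L \<ge> 0"
    and F: "\<And>a b. a \<in> S \<Longrightarrow> b \<in> S \<Longrightarrow> a \<le> b \<Longrightarrow> norm (F b - F a) \<le> M * norm (f b - f a) + L * (b - a)"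
  shows "absolutely_continuous_on S F"
  unfolding absolutely_continuous_on_def
proof (intro allI impI)
  fix e :: real assume "e > 0"
  define e1 where "e1 = e / (M + 1) / 2"
  define e2 where "e2 = e / (L + 1) / 2"
  have "e1 > 0" "e2 > 0" using \<open>e > 0\<close> assms(2,3) by (simp_all add: e1_def e2_def)
  have "M / (M + 1) * (e / 2) \<le> 1 * (e / 2)"
    using assms(2) \<open>e > 0\<close> by (intro mult_right_mono) auto
  then have Me: "M * e1 \<le> e / 2" by (simp add: e1_def)
  have "L / (L + 1) * (e / 2) < 1 * (e / 2)"
    using assms(3) \<open>e > 0\<close> by (intro mult_strict_right_mono) auto
  then have Le: "L * e2 < e / 2" by (simp add: e2_def)
  obtain \<delta> where "\<delta> > 0" and \<delta>: "\<forall>D. interval_family S \<delta> D \<longrightarrow> (\<Sum>(a, b)\<in>D. norm (f b - f a)) < e1"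
    using f[unfolded absolutely_continuous_on_def, THEN spec, THEN mp, OF \<open>e1 > 0\<close>]
    by (elim exE conjE) (rule that)
  show "\<exists>\<delta>>0. \<forall>D. interval_family S \<delta> D \<longrightarrow> (\<Sum>(a, b)\<in>D. norm (F b - F a)) < e"
  proof (intro exI[of _ "min \<delta> e2"] conjI allI impI)
    show "min \<delta> e2 > 0" using \<open>\<delta> > 0\<close> \<open>e2 > 0\<close> by simp
    fix D :: "(real \<times> real) set"
    assume D: "interval_family S (min \<delta> e2) D"
    have "(\<Sum>(a, b)\<in>D. norm (F b - F a)) \<le> (\<Sum>(a, b)\<in>D. M * norm (f b - f a) + L * (b - a))"
    proof (intro sum_mono, clarify)
      fix a b assume "(a, b) \<in> D"
      then have "a \<le> b" "{a..b} \<subseteq> S" using D by auto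
      then show "norm (F b - F a) \<le> M * norm (f b - f a) + L * (b - a)" by (intro F) auto
    qed
    also have "\<dots> = M * (\<Sum>(a, b)\<in>D. norm (f b - f a)) + L * (\<Sum>(a, b)\<in>D. b - a)"
      by (simp only: sum_distrib_left case_prod_unfold sum.distrib)
    also have "\<dots> \<le> M * e1 + L * e2"
    proof (intro add_mono mult_left_mono assms(2,3))
      have "(\<Sum>(a, b)\<in>D. norm (f b - f a)) < e1" using D by (intro \<delta>[THEN spec, THEN mp]) simp
      then show "(\<Sum>(a, b)\<in>D. norm (f b - f a)) \<le> e1" by simp
      show "(\<Sum>(a, b)\<in>D. b - a) \<le> e2" using D by simp
    qed
    finally show "(\<Sum>(a, b)\<in>D. norm (F b - F a)) < e" using Me Le by linarith
  qed
qed

lemma lipschitz_imp_absolutely_continuous_on: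
  fixes f :: "real \<Rightarrow> 'a::real_normed_vector"
  assumes "\<And>s t. s \<in> S \<Longrightarrow> t \<in> S \<Longrightarrow> norm (f t - f s) \<le> L * \<bar>t - s\<bar>" "L \<ge> 0"
  shows "absolutely_continuous_on S f"
proof (rule absolutely_continuous_on_dominated[of S "\<lambda>_. 0 :: real" 0 L])
  show "absolutely_continuous_on S (\<lambda>_. 0 :: real)"
    unfolding absolutely_continuous_on_def by (auto intro: exI[of _ 1])
  show "norm (f b - f a) \<le> 0 * norm (0 - 0 :: real) + L * (b - a)"
    if "a \<in> S" "b \<in> S" "a \<le> b" for a b using assms(1)[OF that(1,2)] that(3) by simp
qed (simp_all add: assms(2))

abbreviation "grid_interval (N :: nat) i \<equiv> {real i / real N..real (Suc i) / real N}"
abbreviation "grid_cell (N :: nat) i \<equiv> {real i / real N..<real (Suc i) / real N}"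

lemma AE_interior_of_grid:
  assumes "N \<ge> 1"
  shows "AE t in lebesgue_on {0..1}. \<exists>j<N. real j / real N < t \<and> t < real (Suc j) / real N"
proof -
  define G where "G = (\<lambda>i. real i / real N) ` {..N}"
  have "AE t in lebesgue. t \<notin> G"
    by (intro AE_not_in) (auto simp: G_def negligible_iff_null_sets[symmetric] intro: negligible_finite)
  then have "AE t in lebesgue. t \<in> {0..1} \<longrightarrow> (\<exists>j<N. real j / real N < t \<and> t < real (Suc j) / real N)"
  proof eventually_elim
    case (elim t)
    show ?case
    proof
      assume t: "t \<in> {0..1}"
      define j where "j = nat \<lfloor>t * N\<rfloor>"
      have j: "real j \<le> t * N" "t * N < real j + 1"
        using t assms by (auto simp: j_def of_nat_nat)
      have ne: "t \<noteq> real i / real N" if "i \<le> N" for i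
        using elim that by (auto simp: G_def)
      have "t * N \<le> N" using t assms by (simp add: mult_left_le_one_le)
      then have "j \<le> N" using j(1) by (metis of_nat_le_iff order_trans)
      have "t \<noteq> 1" using ne[of N] assms by auto
      then have "t * N < N" using t assms by auto
      then have "j < N" using j(1) by linarith
      moreover have "real j / N < t"
        using j(1) ne[OF \<open>j \<le> N\<close>] assms by (simp add: field_simps)
      moreover have "t < real (Suc j) / N"
        using j(2) assms by (simp add: field_simps)
      ultimately show "\<exists>j<N. real j / real N < t \<and> t < real (Suc j) / real N" by blast
    qed
  qed
  then show ?thesis by (subst AE_restrict_space_iff) auto
qed

section \<open>Product integrals of step functions\<close>

locale compact_matrix_group =
  fixes K :: "(real^'n^'n) set"
  assumes K: "compact_connected_orthogonal_group K"
begin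

lemma K_orthogonal: "u \<in> K \<Longrightarrow> orthogonal_matrix u"
  and K_one: "mat 1 \<in> K"
  and K_mult: "u \<in> K \<Longrightarrow> v \<in> K \<Longrightarrow> u ** v \<in> K"
  and K_closed: "closed K"
  using K by (auto simp: compact_connected_orthogonal_group_def compact_imp_closed)

abbreviation "lie \<equiv> lie_algebra K"

lemma lie_mexp: "X \<in> lie \<Longrightarrow> mexp (t *\<^sub>R X) \<in> K"
  by (simp add: lie_algebra_def)

lemma lie_skew: "X \<in> lie \<Longrightarrow> skew X"
  by (intro skew_if_orthogonal_mexp K_orthogonal lie_mexp)

text \<open>Closure under addition is the only real issue: by the Trotter formula the exponential of
  a sum is a limit of products of elements of \<open>K\<close>, and \<open>K\<close> is
  closed.\<close>

lemma subspace_lie_algebra: "subspace lie"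
  unfolding subspace_def
proof (intro conjI ballI allI)
  show "0 \<in> lie" by (simp add: lie_algebra_def K_one)
  fix X assume X: "X \<in> lie"
  show "c *\<^sub>R X \<in> lie" for c
    using lie_mexp[OF X] by (simp add: lie_algebra_def)
  fix Y assume Y: "Y \<in> lie"
  have "mexp (t *\<^sub>R X + t *\<^sub>R Y) \<in> K" for t
  proof (rule closed_sequentially[OF K_closed _ trotter_product])
    show "mpow (mexp ((1 / real n) *\<^sub>R (t *\<^sub>R X)) ** mexp ((1 / real n) *\<^sub>R (t *\<^sub>R Y))) n \<in> K" for n
    proof -
      have "mexp ((1 / real n) *\<^sub>R (t *\<^sub>R X)) ** mexp ((1 / real n) *\<^sub>R (t *\<^sub>R Y)) \<in> K"
        using lie_mexp[OF X] lie_mexp[OF Y] by (intro K_mult) auto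
      then have "mpow (mexp ((1 / real n) *\<^sub>R (t *\<^sub>R X)) ** mexp ((1 / real n) *\<^sub>R (t *\<^sub>R Y))) k \<in> K" for k
        by (induction k) (auto simp: mpow_Suc K_one intro: K_mult)
      then show ?thesis .
    qed
  qed (intro skew_scaleR lie_skew X Y)+
  then show "X + Y \<in> lie"
    by (simp add: lie_algebra_def scaleR_add_right)
qed

lemma Ad_eq: "u \<in> K \<Longrightarrow> Ad u X = u ** X ** transpose u"
  by (simp add: Ad_def matrix_inv_orthogonal K_orthogonal)

lemma Ad_lie:
  assumes "u \<in> K" "X \<in> lie"
  shows "Ad u X \<in> lie"
  unfolding lie_algebra_def
proof (intro CollectI allI)
  fix t :: real
  have tu: "transpose u \<in> K"
    using assms K by (metis K_orthogonal compact_connected_orthogonal_group_def matrix_inv_orthogonal)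
  have "t *\<^sub>R Ad u X = u ** (t *\<^sub>R X) ** transpose u"
    by (simp add: Ad_eq assms mm.scaleR_left mm.scaleR_right)
  also have "mexp \<dots> = u ** mexp (t *\<^sub>R X) ** transpose u"
    using K_orthogonal[OF assms(1)] by (intro mexp_conj) (simp add: orthogonal_matrix_def)
  also have "\<dots> \<in> K"
    using tu assms lie_mexp by (intro K_mult) auto
  finally show "mexp (t *\<^sub>R Ad u X) \<in> K" .
qed

lemma Ad_diff: "Ad u (X - Y) = Ad u X - Ad u Y"
  by (simp add: Ad_def mm.diff_left mm.diff_right)

end

text \<open>The time spent in the \<open>i\<close>-th cell up to time \<open>t\<close>. With it one
  product formula describes the path on the whole line, without a case distinction on the current
  cell.\<close>

definition grid_clamp :: "nat \<Rightarrow> nat \<Rightarrow> real \<Rightarrow> real" where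
  "grid_clamp N i t = max 0 (min (1 / real N) (t - real i / real N))"

text \<open>
  \<open>step_path N c k\<close> is the product integral of the step function that equals \<open>c i\<close> on the
  \<open>i\<close>-th interval for \<open>i < k\<close> and vanishes afterwards.
\<close>

primrec step_path :: "nat \<Rightarrow> (nat \<Rightarrow> real^'n^'n) \<Rightarrow> nat \<Rightarrow> real \<Rightarrow> real^'n^'n" where
  "step_path N c 0 t = mat 1"
| "step_path N c (Suc i) t = mexp (grid_clamp N i t *\<^sub>R c i) ** step_path N c i t"

lemma grid_clamp_bounds: "0 \<le> grid_clamp N i t" "grid_clamp N i t \<le> 1 / real N"
  by (auto simp: grid_clamp_def)

lemma grid_clamp_lipschitz: "\<bar>grid_clamp N i t - grid_clamp N i s\<bar> \<le> \<bar>t - s\<bar>"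
  by (auto simp: grid_clamp_def max_def min_def)

lemma grid_clamp_before: "t \<le> real i / real N \<Longrightarrow> grid_clamp N i t = 0"
  by (auto simp: grid_clamp_def)

lemma grid_clamp_after: "real (Suc i) / real N \<le> t \<Longrightarrow> grid_clamp N i t = 1 / real N"
  by (auto simp: grid_clamp_def field_simps add_divide_distrib)

lemma grid_clamp_inside:
  "real i / real N \<le> t \<Longrightarrow> t \<le> real (Suc i) / real N \<Longrightarrow> grid_clamp N i t = t - real i / real N"
  by (auto simp: grid_clamp_def field_simps add_divide_distrib)

lemma skew_0: "skew 0"
  by (simp add: skew_def transpose_def vec_eq_iff)

lemma step_path_orthogonal:
  "(\<And>i. i < k \<Longrightarrow> skew (c i)) \<Longrightarrow> orthogonal_matrix (step_path N c k t)"
  by (induction k) (auto intro!: orthogonal_matrix_mul orthogonal_mexp skew_scaleR simp: orthogonal_matrix_id)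

lemma step_path_cong: "(\<And>i. i < k \<Longrightarrow> c i = c' i) \<Longrightarrow> step_path N c k t = step_path N c' k t"
  by (induction k) auto

lemma step_path_0: "step_path N c k 0 = mat 1"
  by (induction k) (auto simp: grid_clamp_before)

text \<open>The common induction step for product paths: change one factor at a time, the other one
  being orthogonal.\<close>

lemma norm_mexp_mult_diff_le:
  assumes "skew A" "skew B" "orthogonal_matrix S"
  shows "norm (mexp A ** S - mexp B ** S') \<le> norm (A - B) + norm (S - S')"
proof -
  have "mexp A ** S - mexp B ** S' = (mexp A - mexp B) ** S + mexp B ** (S - S')"
    by (simp add: mm.diff_left mm.diff_right)
  also have "norm \<dots> \<le> norm (mexp A - mexp B) + norm (S - S')"
    using norm_triangle_ineq[of "(mexp A - mexp B) ** S" "mexp B ** (S - S')"]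
    unfolding norm_orthogonal_mult_left[OF orthogonal_mexp[OF assms(2)]]
      norm_orthogonal_mult_right[OF assms(3)] .
  finally show ?thesis using norm_mexp_diff_le[OF assms(1,2)] by simp
qed

lemma step_path_lipschitz:
  assumes "\<And>i. i < k \<Longrightarrow> skew (c i)"
  shows "norm (step_path N c k t - step_path N c k s) \<le> (\<Sum>i<k. norm (c i)) * \<bar>t - s\<bar>"
  using assms
proof (induction k)
  case (Suc k)
  have "norm (step_path N c (Suc k) t - step_path N c (Suc k) s)
     \<le> norm (grid_clamp N k t *\<^sub>R c k - grid_clamp N k s *\<^sub>R c k)
        + norm (step_path N c k t - step_path N c k s)"
    using Suc.prems by (simp, intro norm_mexp_mult_diff_le skew_scaleR step_path_orthogonal) auto
  also have "norm (grid_clamp N k t *\<^sub>R c k - grid_clamp N k s *\<^sub>R c k) \<le> \<bar>t - s\<bar> * norm (c k)"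
    using grid_clamp_lipschitz[of N k t s] unfolding scaleR_diff_left[symmetric] norm_scaleR
    by (intro mult_right_mono) auto
  also have "norm (step_path N c k t - step_path N c k s) \<le> (\<Sum>i<k. norm (c i)) * \<bar>t - s\<bar>"
    using Suc by auto
  finally show ?case by (simp add: algebra_simps)
qed simp

text \<open>Each cell lasts at most \<open>1 / N\<close> and later orthogonal factors do not enlarge
  the difference. The measurability of the group law and of the triangular shift rests on
  this.\<close>

lemma step_path_diff_le:
  assumes "\<And>i. i < k \<Longrightarrow> skew (c i)" "\<And>i. i < k \<Longrightarrow> skew (c' i)"
  shows "norm (step_path N c k t - step_path N c' k t) \<le> (\<Sum>i<k. norm (c i - c' i)) / real N"
  using assms
proof (induction k)
  case (Suc k)
  have "norm (step_path N c (Suc k) t - step_path N c' (Suc k) t)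
     \<le> norm (grid_clamp N k t *\<^sub>R c k - grid_clamp N k t *\<^sub>R c' k)
        + norm (step_path N c k t - step_path N c' k t)"
    using Suc.prems by (simp, intro norm_mexp_mult_diff_le skew_scaleR step_path_orthogonal) auto
  also have "norm (grid_clamp N k t *\<^sub>R c k - grid_clamp N k t *\<^sub>R c' k) \<le> (1 / N) * norm (c k - c' k)"
    using grid_clamp_bounds[of N k t] unfolding scaleR_diff_right[symmetric] norm_scaleR
    by (intro mult_right_mono) auto
  also have "norm (step_path N c k t - step_path N c' k t) \<le> (\<Sum>i<k. norm (c i - c' i)) / real N"
    using Suc by auto
  finally show ?case by (simp add: add_divide_distrib)
qed simp

lemma step_path_before:
  assumes "t \<le> real j / real N" "j \<le> k"
  shows "step_path N c k t = step_path N c j t"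
  using assms(2)
proof (induction k rule: dec_induct)
  case (step i)
  have "real j / real N \<le> real i / real N" using step by (simp add: divide_right_mono)
  then show ?case using step assms by (simp add: grid_clamp_before)
qed simp

lemma step_path_after:
  assumes "real k / real N \<le> t"
  shows "step_path N c k t = step_path N c k (real k / real N)"
  using assms
proof (induction k arbitrary: t)
  case (Suc k)
  have *: "real k / real N \<le> real (Suc k) / real N" by (simp add: divide_right_mono)
  show ?case using Suc.IH[of t] Suc.IH[of "real (Suc k) / real N"] Suc.prems *
    by (simp add: grid_clamp_after del: of_nat_Suc)
qed simp

lemma step_path_inside:
  assumes "real j / real N \<le> t" "t \<le> real (Suc j) / real N" "j < k"
  shows "step_path N c k t = mexp ((t - real j / real N) *\<^sub>R c j) ** step_path N c j (real j / real N)"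
proof -
  have "step_path N c k t = step_path N c (Suc j) t"
    using assms by (intro step_path_before) auto
  then show ?thesis
    using assms step_path_after[of j N t c] by (simp add: grid_clamp_inside del: of_nat_Suc)
qed

lemma step_path_has_vector_derivative:
  assumes "real j / real N < t" "t < real (Suc j) / real N" "j < k"
  shows "(step_path N c k has_vector_derivative c j ** step_path N c k t) (at t within S)"
proof -
  let ?f = "\<lambda>t. mexp ((t - real j / real N) *\<^sub>R c j) ** step_path N c j (real j / real N)"
  have d: "((\<lambda>t. t - real j / real N) has_vector_derivative 1) (at t)"
    by (auto intro!: derivative_eq_intros)
  have "((\<lambda>t. mexp ((t - real j / real N) *\<^sub>R c j)) has_vector_derivative
      c j ** mexp ((t - real j / real N) *\<^sub>R c j)) (at t)"
    using vector_diff_chain_at[OF d mexp_has_vector_derivative] by (simp add: o_def)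
  then have "(?f has_vector_derivative (c j ** mexp ((t - real j / real N) *\<^sub>R c j)) ** step_path N c j (real j / real N)) (at t)"
    by (rule bounded_linear.has_vector_derivative[OF mm.bounded_linear_left])
  then have "(?f has_vector_derivative c j ** step_path N c k t) (at t)"
    unfolding step_path_inside[OF less_imp_le[OF assms(1)] less_imp_le[OF assms(2)] assms(3)]
      matrix_mul_assoc .
  then have "(step_path N c k has_vector_derivative c j ** step_path N c k t) (at t)"
    by (rule has_vector_derivative_transform_within_open[of _ _ _ "{real j / real N<..<real (Suc j) / real N}"])
      (use assms(1,2) step_path_inside[OF less_imp_le less_imp_le assms(3), of N _ c] in auto)
  then show ?thesis by (rule has_vector_derivative_at_within)
qed

text \<open>The cost of freezing the path at the left end point of a cell; after integration over
  all cells it becomes the error of order \<open>r / N\<close> in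
  \<open>shift_approximates_group_law\<close>.\<close>

lemma step_path_near_grid:
  assumes "real j / real N \<le> t" "t \<le> real (Suc j) / real N" "j < k" "\<And>i. i < k \<Longrightarrow> skew (c i)"
  shows "norm (step_path N c k t - step_path N c j (real j / real N)) \<le> norm (c j) / real N"
proof -
  have o: "orthogonal_matrix (step_path N c j (real j / real N))"
    using assms by (intro step_path_orthogonal) auto
  have "norm (step_path N c k t - mexp 0 ** step_path N c j (real j / real N))
      \<le> norm ((t - real j / real N) *\<^sub>R c j - 0)
        + norm (step_path N c j (real j / real N) - step_path N c j (real j / real N))"
    unfolding step_path_inside[OF assms(1-3)]
    by (rule norm_mexp_mult_diff_le[OF skew_scaleR[OF assms(4)[OF assms(3)]] skew_0 o])
  moreover have "norm ((t - real j / real N) *\<^sub>R c j) \<le> (1 / N) * norm (c j)"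
    unfolding norm_scaleR using assms(1,2) by (intro mult_right_mono) (auto simp: add_divide_distrib)
  ultimately show ?thesis by simp
qed

context compact_matrix_group
begin

lemma step_path_in_K: "(\<And>i. i < k \<Longrightarrow> c i \<in> lie) \<Longrightarrow> step_path N c k t \<in> K"
  by (induction k) (auto intro!: K_mult K_one lie_mexp)

lemma AE_grid_values:
  assumes "N \<ge> 1"
    and f: "\<And>i. i < N \<Longrightarrow> AE t in lebesgue_on (grid_interval N i). f t = c i"
  shows "AE t in lebesgue_on {0..1}.
      \<exists>j<N. real j / real N < t \<and> t < real (Suc j) / real N \<and> f t = c j"
proof -
  have "AE t in lebesgue. \<forall>i\<in>{..<N}. t \<in> grid_interval N i \<longrightarrow> f t = c i"
    using f by (intro AE_finite_allI) (auto simp: AE_restrict_space_iff)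
  moreover have "AE t in lebesgue. t \<in> {0..1} \<longrightarrow> (\<exists>j<N. real j / real N < t \<and> t < real (Suc j) / real N)"
    using AE_interior_of_grid[OF assms(1)] by (auto simp: AE_restrict_space_iff)
  ultimately have "AE t in lebesgue. t \<in> {0..1} \<longrightarrow>
      (\<exists>j<N. real j / real N < t \<and> t < real (Suc j) / real N \<and> f t = c j)"
  proof eventually_elim
    case (elim t)
    then show ?case by (metis atLeastAtMost_iff lessThan_iff less_imp_le)
  qed
  then show ?thesis
    by (auto simp: AE_restrict_space_iff)
qed

text \<open>Resolves the definite description. For uniqueness, the difference \<open>u\<close> of
  two solutions satisfies \<open>u' = c j ** u\<close> almost everywhere with \<open>c j\<close>
  skew, so \<open>u \<bullet> u\<close> has derivative zero almost everywhere; being absolutely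
  continuous, it is constant.\<close>

lemma prod_integral_eq_step_path:
  assumes "N \<ge> 1" and c: "\<And>i. i < N \<Longrightarrow> c i \<in> lie"
    and f: "\<And>i. i < N \<Longrightarrow> AE t in lebesgue_on (grid_interval N i). f t = c i"
  shows "prod_integral K f = restrict (step_path N c N) {0..1}"
proof -
  have skc: "skew (c i)" if "i < N" for i using lie_skew c that by blast
  have sK: "step_path N c N t \<in> K" for t using c by (intro step_path_in_K)
  have ae: "AE t in lebesgue_on {0..1}.
      \<exists>j<N. real j / real N < t \<and> t < real (Suc j) / real N \<and> f t = c j"
    by (rule AE_grid_values[OF assms(1) f])
  let ?s = "restrict (step_path N c N) {0..1}"
  have ds: "(?s has_vector_derivative c j ** step_path N c N t) (at t within {0..1})"
    if "real j / real N < t" "t < real (Suc j) / real N" "j < N" "t \<in> {0..1}" for j t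
    using step_path_has_vector_derivative[OF that(1-3), of c "{0..1}"] that(4)
    by (rule has_vector_derivative_transform[rotated 2]) auto
  let ?L = "\<Sum>i<N. norm (c i)"
  have Ls: "norm (?s t - ?s s) \<le> ?L * \<bar>t - s\<bar>" if "s \<in> {0..1}" "t \<in> {0..1}" for s t
    using that step_path_lipschitz[of N c N t s] skc by simp
  have acs: "absolutely_continuous_on {0..1} ?s"
    using Ls by (rule lipschitz_imp_absolutely_continuous_on) (auto intro: sum_nonneg)
  have Kinv: "u ** matrix_inv u = mat 1" "matrix_inv u ** u = mat 1" if "u \<in> K" for u
    using K_orthogonal[OF that] by (auto simp: matrix_inv_orthogonal orthogonal_matrix_def)
  have nK: "norm u = norm (mat 1 :: real^'n^'n)" if "u \<in> K" for u
    using norm_orthogonal_mult_left[OF K_orthogonal[OF that], of "mat 1"] by simp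
  show ?thesis
    unfolding prod_integral_def
  proof (rule the_equality, intro conjI)
    show "?s \<in> {0..1} \<rightarrow>\<^sub>E K" using sK by auto
    show "absolutely_continuous_on {0..1} ?s" by (rule acs)
    show "?s 0 = mat 1" by (simp add: step_path_0)
    show "AE t in lebesgue_on {0..1}. \<exists>r'. (?s has_vector_derivative r') (at t within {0..1}) \<and>
                r' ** matrix_inv (?s t) = f t"
      using ae AE_space
    proof eventually_elim
      case (elim t)
      then obtain j where j: "j < N" "real j / real N < t" "t < real (Suc j) / real N" "f t = c j" "t \<in> {0..1}"
        by auto
      have "(c j ** step_path N c N t) ** matrix_inv (?s t) = f t"
        using j Kinv(1)[OF sK] by (simp add: matrix_mul_assoc[symmetric])
      then show ?case using ds j by blast
    qed
    fix r assume "r \<in> {0..1} \<rightarrow>\<^sub>E K \<and> absolutely_continuous_on {0..1} r \<and> r 0 = mat 1 \<and>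
        (AE t in lebesgue_on {0..1}. \<exists>r'. (r has_vector_derivative r') (at t within {0..1}) \<and>
                r' ** matrix_inv (r t) = f t)"
    then have r: "r \<in> {0..1} \<rightarrow>\<^sub>E K" "absolutely_continuous_on {0..1} r" "r 0 = mat 1"
      and rae: "AE t in lebesgue_on {0..1}. \<exists>r'. (r has_vector_derivative r') (at t within {0..1}) \<and>
                r' ** matrix_inv (r t) = f t" by auto
    define u where "u t = r t - ?s t" for t
    \<comment> \<open>All elements of \<open>K\<close> have the norm of the identity, so
      \<open>M / 2\<close> bounds \<open>u\<close>, and \<open>M\<close> bounds the factor
      \<open>u b + u a\<close> in the difference of squares below.\<close>
    define M where "M = 4 * norm (mat 1 :: real^'n^'n)"
    have nu: "norm (u t) \<le> M / 2" if "t \<in> {0..1}" for t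
    proof -
      have "r t \<in> K" "?s t \<in> K" using that r sK by auto
      then show ?thesis
        using norm_triangle_ineq4[of "r t" "?s t"] nK[of "r t"] nK[of "?s t"] by (simp add: u_def M_def)
    qed
    have "M \<ge> 0" by (simp add: M_def)
    have "absolutely_continuous_on {0..1} (\<lambda>t. u t \<bullet> u t)"
    proof (rule absolutely_continuous_on_dominated[OF r(2) \<open>M \<ge> 0\<close>])
      show "M * ?L \<ge> 0" using \<open>M \<ge> 0\<close> by (intro mult_nonneg_nonneg sum_nonneg) auto
      fix a b :: real assume ab: "a \<in> {0..1}" "b \<in> {0..1}" "a \<le> b"
      have "u b \<bullet> u b - u a \<bullet> u a = (u b + u a) \<bullet> (u b - u a)"
        by (simp add: inner_add_left inner_diff_right inner_commute[of "u a" "u b"])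
      also have "norm \<dots> \<le> norm (u b + u a) * norm (u b - u a)"
        unfolding real_norm_def by (rule Cauchy_Schwarz_ineq2)
      also have "\<dots> \<le> M * (norm (r b - r a) + ?L * (b - a))"
      proof (intro mult_mono)
        show "norm (u b + u a) \<le> M"
          using norm_triangle_ineq[of "u b" "u a"] nu[OF ab(1)] nu[OF ab(2)] by simp
        have "u b - u a = (r b - r a) - (?s b - ?s a)" by (simp add: u_def)
        also have "norm \<dots> \<le> norm (r b - r a) + norm (?s b - ?s a)" by (rule norm_triangle_ineq4)
        finally show "norm (u b - u a) \<le> norm (r b - r a) + ?L * (b - a)"
          using Ls[OF ab(1,2)] ab(3) by simp
      qed (use \<open>M \<ge> 0\<close> in auto)
      finally show "norm (u b \<bullet> u b - u a \<bullet> u a) \<le> M * norm (r b - r a) + M * ?L * (b - a)"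
        by (simp only: distrib_left mult.assoc)
    qed
    moreover have "AE t in lebesgue_on {0..1}. ((\<lambda>t. u t \<bullet> u t) has_vector_derivative 0) (at t within {0..1})"
      using ae rae AE_space
    proof eventually_elim
      case (elim t)
      then obtain j where j: "j < N" "real j / real N < t" "t < real (Suc j) / real N" "f t = c j" "t \<in> {0..1}"
        by auto
      from elim obtain r' where r': "(r has_vector_derivative r') (at t within {0..1})"
        "r' ** matrix_inv (r t) = f t" by blast
      have "r t \<in> K" using r j by auto
      then have "r' = c j ** r t"
        using r'(2) j(4) Kinv(2)[of "r t"] by (metis matrix_mul_assoc matrix_mul_rid)
      then have du: "(u has_vector_derivative c j ** u t) (at t within {0..1})"
        unfolding u_def using has_vector_derivative_diff[OF r'(1) ds[OF j(2,3,1,5)]] j(5)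
        by (simp add: mm.diff_right)
      from bounded_bilinear.has_vector_derivative[OF bounded_bilinear_inner du du]
      show ?case using inner_skew_mult[OF skc[OF j(1)]] by (simp add: inner_commute)
    qed
    ultimately have "u t \<bullet> u t = u 0 \<bullet> u 0" if "t \<in> {0..1}" for t
      using zero_derivative_ae_imp_constant[of "\<lambda>t. u t \<bullet> u t"] that by blast
    moreover have "u 0 = 0" using r(3) by (simp add: u_def step_path_0)
    ultimately have "r t = ?s t" if "t \<in> {0..1}" for t
      using that by (simp add: u_def)
    then show "r = ?s"
      using r(1) by (intro PiE_ext[of _ "{0..1}" "\<lambda>_. UNIV"]) (auto simp: PiE_def)
  qed
qed

end

section \<open>Triangular shifts of Lebesgue measure\<close>

abbreviation lborel_pow :: "'a set \<Rightarrow> ('a \<Rightarrow> real) measure" where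
  "lborel_pow I \<equiv> (\<Pi>\<^sub>M p\<in>I. (lborel :: real measure))"

lemma space_lborel_pow: "space (lborel_pow I) = extensional I"
  by (simp add: space_PiM PiE_def)

text \<open>Openness refers to the sup distance over \<open>I\<close>. Such a set is a countable
  union of boxes with rational centres and radii \<open>1 / Suc k\<close>, and boxes are measurable
  in the product.\<close>

lemma open_in_coordinates_measurable:
  fixes I :: "'a set"
  assumes I: "finite I" and U: "U \<subseteq> extensional I"
    and op: "\<And>c. c \<in> U \<Longrightarrow> \<exists>e>0. \<forall>c'\<in>extensional I. (\<forall>p\<in>I. \<bar>c' p - c p\<bar> < e) \<longrightarrow> c' \<in> U"
  shows "U \<in> sets (lborel_pow I)"
proof -
  define box :: "('a \<Rightarrow> real) \<times> nat \<Rightarrow> ('a \<Rightarrow> real) set" where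
    "box = (\<lambda>(q, k). \<Pi>\<^sub>E p\<in>I. {q p - 1 / Suc k <..< q p + 1 / Suc k})"
  define Q where "Q = {x \<in> (\<Pi>\<^sub>E p\<in>I. \<rat>) \<times> (UNIV :: nat set). box x \<subseteq> U}"
  have "countable ((\<Pi>\<^sub>E p\<in>I. \<rat> :: real set) \<times> (UNIV :: nat set))"
    by (intro countable_SIGMA countable_PiE I countable_rat) auto
  then have "countable Q" by (rule countable_subset[rotated]) (auto simp: Q_def)
  have "U = (\<Union>x\<in>Q. box x)"
  proof
    show "(\<Union>x\<in>Q. box x) \<subseteq> U" by (auto simp: Q_def)
    show "U \<subseteq> (\<Union>x\<in>Q. box x)"
    proof
      fix c assume c: "c \<in> U"
      then obtain e where "e > 0" and e: "\<And>c'. c' \<in> extensional I \<Longrightarrow> (\<forall>p\<in>I. \<bar>c' p - c p\<bar> < e) \<Longrightarrow> c' \<in> U"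
        using op by blast
      \<comment> \<open>Half of \<open>e\<close> goes to the distance from \<open>c\<close> to the
        rational centre, half to the radius of the box.\<close>
      obtain k where k: "1 / Suc k < e / 2"
        using \<open>e > 0\<close> nat_approx_posE[of "e / 2"] by auto
      have "\<exists>r\<in>\<rat>. \<bar>r - c p\<bar> < 1 / Suc k" for p
        using Rats_dense_in_real[of "c p - 1 / Suc k" "c p + 1 / Suc k"]
        by (auto simp: abs_less_iff intro!: bexI)
      then obtain q where q: "\<And>p. q p \<in> \<rat>" "\<And>p. \<bar>q p - c p\<bar> < 1 / Suc k" by metis
      have "box (restrict q I, k) \<subseteq> U"
      proof
        fix c' assume c': "c' \<in> box (restrict q I, k)"
        show "c' \<in> U"
        proof (rule e)
          show "c' \<in> extensional I" using c' by (auto simp: box_def PiE_def)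
          show "\<forall>p\<in>I. \<bar>c' p - c p\<bar> < e"
          proof
            fix p assume "p \<in> I"
            then have "q p - 1 / Suc k < c' p" "c' p < q p + 1 / Suc k"
              using c' by (auto simp: box_def PiE_iff)
            then show "\<bar>c' p - c p\<bar> < e" using q(2)[of p] k by linarith
          qed
        qed
      qed
      moreover have "c \<in> box (restrict q I, k)"
      proof -
        have "q p - 1 / Suc k < c p \<and> c p < q p + 1 / Suc k" for p using q(2)[of p] by linarith
        then show ?thesis using c U by (auto simp: box_def PiE_iff)
      qed
      ultimately show "c \<in> (\<Union>x\<in>Q. box x)"
        using q(1) by (intro UN_I[of "(restrict q I, k)"]) (auto simp: Q_def)
    qed
  qed
  also have "\<dots> \<in> sets (lborel_pow I)"
    using \<open>countable Q\<close> by (intro sets.countable_UN') (auto simp: box_def I intro!: sets_PiM_I_finite)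
  finally show ?thesis .
qed

lemma affine_coordinate_measurable:
  assumes "p \<in> I" and h: "h \<in> borel_measurable (lborel_pow I)"
  shows "(\<lambda>c. c(p := a * c p + h c)) \<in> measurable (lborel_pow I) (lborel_pow I)"
proof (rule measurable_fun_upd[of I I p])
  show "(\<lambda>c. a * c p + h c) \<in> measurable (lborel_pow I) lborel"
    using assms measurable_component_singleton[of p I "\<lambda>_. lborel"] by simp
qed (use assms in auto)

text \<open>Integrate over the coordinate \<open>p\<close> first: with the others fixed, the map is
  a translation or a reflection of the line. Triangular shifts use \<open>a = 1\<close>, the
  orthogonality argument uses \<open>a = -1\<close>.\<close>

lemma distr_affine_coordinate:
  assumes I: "finite I" and p: "p \<in> I" and h[measurable]: "h \<in> borel_measurable (lborel_pow I)"
    and indep: "\<And>c y. h (c(p := y)) = h c" and a: "\<bar>a\<bar> = 1"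
  shows "distr (lborel_pow I) (lborel_pow I) (\<lambda>c. c(p := a * c p + h c)) = lborel_pow I"
proof (rule measure_eqI)
  interpret product_sigma_finite "\<lambda>_. lborel :: real measure" ..
  note m[measurable] = affine_coordinate_measurable[OF p h, of a]
  fix A assume "A \<in> sets (distr (lborel_pow I) (lborel_pow I) (\<lambda>c. c(p := a * c p + h c)))"
  then have A[measurable]: "A \<in> sets (lborel_pow I)" by simp
  define J where "J = I - {p}"
  have J: "finite J" "p \<notin> J" "I = insert p J" using I p by (auto simp: J_def)
  note ins = product_nn_integral_insert[OF J(1,2), folded J(3)]
  have up: "(\<lambda>y. x(p := y)) \<in> measurable lborel (lborel_pow I)" if "x \<in> space (lborel_pow J)" for x
    using measurable_fun_upd[of I J p "\<lambda>_. x" lborel "\<lambda>_. lborel" "\<lambda>y. y"] J that by auto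
  have "emeasure (distr (lborel_pow I) (lborel_pow I) (\<lambda>c. c(p := a * c p + h c))) A
      = (\<integral>\<^sup>+c. indicator A c \<partial>distr (lborel_pow I) (lborel_pow I) (\<lambda>c. c(p := a * c p + h c)))"
    using A by (intro nn_integral_indicator[symmetric]) simp
  also have "\<dots> = (\<integral>\<^sup>+c. indicator A (c(p := a * c p + h c)) \<partial>lborel_pow I)"
    by (rule nn_integral_distr[OF m]) (use A in simp)
  also have "\<dots> = (\<integral>\<^sup>+x. (\<integral>\<^sup>+y. indicator A (x(p := a * y + h x)) \<partial>lborel) \<partial>lborel_pow J)"
    by (subst ins[OF measurable_compose[OF m borel_measurable_indicator[OF A]]]) (simp add: indep)
  also have "\<dots> = (\<integral>\<^sup>+x. (\<integral>\<^sup>+y. indicator A (x(p := y)) \<partial>lborel) \<partial>lborel_pow J)"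
  proof (rule nn_integral_cong)
    fix x assume "x \<in> space (lborel_pow J)"
    from measurable_compose[OF up[OF this] borel_measurable_indicator[OF A]]
    have im: "(\<lambda>y. indicator A (x(p := y)) :: ennreal) \<in> borel_measurable borel" by simp
    show "(\<integral>\<^sup>+y. indicator A (x(p := a * y + h x)) \<partial>lborel) = (\<integral>\<^sup>+y. indicator A (x(p := y)) \<partial>lborel)"
      using nn_integral_real_affine[OF im, of a "h x"] a
      by (subst add.commute) (auto simp del: fun_upd_apply)
  qed
  also have "\<dots> = (\<integral>\<^sup>+c. indicator A c \<partial>lborel_pow I)"
    by (rule ins[OF borel_measurable_indicator[OF A], symmetric])
  also have "\<dots> = emeasure (lborel_pow I) A"
    by (rule nn_integral_indicator[OF A])
  finally show "emeasure (distr (lborel_pow I) (lborel_pow I) (\<lambda>c. c(p := a * c p + h c))) A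
      = emeasure (lborel_pow I) A" .
qed simp

text \<open>
  A translation of each coordinate by a function of the coordinates of smaller rank: the analogue
  of a unipotent triangular Jacobian.
\<close>

definition triangular_shift :: "'a set \<Rightarrow> ('a \<Rightarrow> ('a \<Rightarrow> real) \<Rightarrow> real) \<Rightarrow> ('a \<Rightarrow> real) \<Rightarrow> 'a \<Rightarrow> real" where
  "triangular_shift I h c = (\<lambda>p\<in>I. c p + h p c)"

text \<open>Ranks may repeat: in the application the rank is the index of the time cell, and all
  basis directions of one cell are translated at once by functions of the earlier cells.\<close>

locale triangular =
  fixes I :: "'a set" and h :: "'a \<Rightarrow> ('a \<Rightarrow> real) \<Rightarrow> real" and rk :: "'a \<Rightarrow> nat"
  assumes finI: "finite I"
    and hm: "\<And>p. p \<in> I \<Longrightarrow> h p \<in> borel_measurable (lborel_pow I)"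
    and h_cong: "\<And>p c c'. p \<in> I \<Longrightarrow> (\<And>q. q \<in> I \<Longrightarrow> rk q < rk p \<Longrightarrow> c q = c' q) \<Longrightarrow> h p c = h p c'"
begin

abbreviation "leb \<equiv> lborel_pow I"

lemma triangular_shift_measurable: "triangular_shift I h \<in> measurable leb leb"
proof -
  have "(\<lambda>c. c p + h p c) \<in> measurable leb lborel" if "p \<in> I" for p
    using that measurable_component_singleton[of p I "\<lambda>_. lborel"] hm[OF that] by simp
  then show ?thesis
    unfolding triangular_shift_def by (intro measurable_restrict) auto
qed

text \<open>The shift is a composition of single-coordinate shears, applied from the highest rank
  downwards, so that each shear still sees the original coordinates of smaller rank. The induction
  runs over sets \<open>J\<close> that are upward closed in this sense.\<close>

lemma distr_triangular_shift:
  "distr leb leb (triangular_shift I h) = leb"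
proof -
  define TJ where "TJ J c = (\<lambda>p. if p \<in> J then c p + h p c else c p)" for J c
  have "J \<subseteq> I \<Longrightarrow> (\<forall>p\<in>J. \<forall>q\<in>I - J. rk q \<le> rk p) \<Longrightarrow>
      TJ J \<in> measurable leb leb \<and> distr leb leb (TJ J) = leb"
    if "finite J" for J
    using that
  proof (induction "card J" arbitrary: J)
    case 0
    then have "J = {}" by simp
    then have "TJ J = (\<lambda>c. c)" by (auto simp: TJ_def)
    then show ?case by (simp add: distr_id)
  next
    case (Suc n)
    then have "J \<noteq> {}" "finite J" by auto
    then obtain p where p: "p \<in> J" "\<And>q. q \<in> J \<Longrightarrow> rk p \<le> rk q"
      using ex_min_if_finite[of "rk ` J"] by (metis (no_types, lifting) finite_imageI image_iff image_is_empty leI)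
    define L where "L = J - {p}"
    have pI: "p \<in> I" using p Suc by auto
    have L: "TJ L \<in> measurable leb leb" "distr leb leb (TJ L) = leb"
    proof -
      have "card L = n" "finite L" "L \<subseteq> I" using Suc p \<open>finite J\<close> by (auto simp: L_def)
      moreover have "\<forall>p\<in>L. \<forall>q\<in>I - L. rk q \<le> rk p" using Suc.prems p by (auto simp: L_def)
      ultimately show "TJ L \<in> measurable leb leb" "distr leb leb (TJ L) = leb"
        using Suc.hyps(1)[of L] by auto
    qed
    define S where "S c = c(p := 1 * c p + h p c)" for c
    have S: "S \<in> measurable leb leb"
      unfolding S_def by (rule affine_coordinate_measurable[OF pI hm[OF pI]])
    have S': "distr leb leb S = leb"
      unfolding S_def
    proof (rule distr_affine_coordinate[OF finI pI hm[OF pI]])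
      show "h p (c(p := y)) = h p c" for c y by (rule h_cong[OF pI]) auto
    qed simp
    \<comment> \<open>The coordinates already moved are those in \<open>L\<close>, all of rank at
      least \<open>rk p\<close>, and \<open>h p\<close> does not look at them.\<close>
    have "h p (TJ L c) = h p c" for c
      by (rule h_cong[OF pI]) (use p in \<open>auto simp: TJ_def L_def dest: leD\<close>)
    then have TJ: "TJ J = S \<circ> TJ L"
      using p by (auto simp: TJ_def S_def L_def fun_eq_iff)
    have "distr leb leb (TJ J) = distr (distr leb leb (TJ L)) leb S"
      unfolding TJ by (rule distr_distr[symmetric, OF S L(1)])
    then show ?case using TJ L S S' by (simp add: measurable_comp)
  qed
  from this[OF finI] have *: "distr leb leb (TJ I) = leb" by auto
  \<comment> \<open>\<open>TJ\<close> keeps values outside \<open>I\<close>, whereas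
    \<open>triangular_shift\<close> resets them; on extensional functions there is no
    difference.\<close>
  have "TJ I c = triangular_shift I h c" if "c \<in> space leb" for c
    using that by (auto simp: TJ_def triangular_shift_def space_lborel_pow extensional_def)
  then have "distr leb leb (triangular_shift I h) = distr leb leb (TJ I)"
    by (intro distr_cong) auto
  then show ?thesis using * by simp
qed

end

section \<open>Balls in coordinate space and the exit probability of a bounded shift\<close>

definition coord_ball :: "'a set \<Rightarrow> real \<Rightarrow> ('a \<Rightarrow> real) set" where
  "coord_ball I r = {c \<in> space (lborel_pow I). (\<Sum>p\<in>I. (c p)\<^sup>2) \<le> r\<^sup>2}"

lemma coord_measurable: "p \<in> I \<Longrightarrow> (\<lambda>c. c p) \<in> borel_measurable (lborel_pow I)"
  using measurable_component_singleton[of p I "\<lambda>_. lborel"] by simp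

lemma coord_ball_measurable: "coord_ball I r \<in> sets (lborel_pow I)"
proof -
  have "(\<lambda>c. \<Sum>p\<in>I. (c p)\<^sup>2) \<in> borel_measurable (lborel_pow I)"
    by (intro borel_measurable_sum borel_measurable_power coord_measurable)
  then show ?thesis unfolding coord_ball_def by measurable
qed

lemma emeasure_coord_ball:
  assumes "finite I" "r > 0"
  shows "emeasure (lborel_pow I) (coord_ball I r) = ennreal (unit_ball_vol (card I) * r ^ card I)"
proof -
  have "coord_ball I r = {f. sqrt (\<Sum>i\<in>I. (f i)\<^sup>2) \<le> r} \<inter> space (lborel_pow I)"
    using assms by (auto simp: coord_ball_def intro: real_le_lsqrt sum_nonneg dest: sqrt_le_D)
  then show ?thesis using emeasure_cball_aux[OF assms] by simp
qed

lemma measure_coord_ball: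
  assumes "finite I" "r > 0"
  shows "measure (lborel_pow I) (coord_ball I r) = unit_ball_vol (card I) * r ^ card I"
  using emeasure_coord_ball[OF assms] assms by (simp add: measure_def)

text \<open>\<open>G\<close> bounds the length of the shift, \<open>b\<close> the square of a single
  coordinate. In the application \<open>b\<close> is \<open>G\<^sup>2 / N\<close>; since only
  \<open>b\<close> enters the second moment of the drift, this factor \<open>1 / N\<close> is the
  decisive gain.\<close>

locale bounded_triangular = triangular I h rk
  for I :: "'a set" and h :: "'a \<Rightarrow> ('a \<Rightarrow> real) \<Rightarrow> real" and rk :: "'a \<Rightarrow> nat" +
  fixes G b :: real
  assumes h_coord: "\<And>p c. p \<in> I \<Longrightarrow> (h p c)\<^sup>2 \<le> b"
    and h_total: "\<And>c. (\<Sum>p\<in>I. (h p c)\<^sup>2) \<le> G\<^sup>2"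
begin

text \<open>The inner product of \<open>c\<close> with its shift, the cross term in the expansion of
  the squared length.\<close>

definition drift :: "('a \<Rightarrow> real) \<Rightarrow> real" where
  "drift c = (\<Sum>p\<in>I. c p * h p c)"

lemma drift_term_measurable: "p \<in> I \<Longrightarrow> (\<lambda>c. c p * h p c) \<in> borel_measurable leb"
  by (intro borel_measurable_times coord_measurable hm)

lemma drift_measurable: "drift \<in> borel_measurable leb"
  unfolding drift_def[abs_def] by (intro borel_measurable_sum drift_term_measurable)

lemma drift_term_square_le:
  assumes "p \<in> I" "c \<in> coord_ball I r"
  shows "(c p * h p c)\<^sup>2 \<le> b * (c p)\<^sup>2"
  using mult_left_mono[OF h_coord[OF assms(1)], of "(c p)\<^sup>2" c]
  by (simp add: power_mult_distrib mult.commute)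

lemma b_nonneg: "p \<in> I \<Longrightarrow> b \<ge> 0"
  using h_coord[of p undefined] by (metis order_trans zero_le_power2)

lemma coord_square_le:
  assumes "p \<in> I" "c \<in> coord_ball I r"
  shows "(c p)\<^sup>2 \<le> r\<^sup>2"
proof -
  have "(c p)\<^sup>2 \<le> (\<Sum>p\<in>I. (c p)\<^sup>2)"
    using assms finI by (intro member_le_sum) auto
  also have "\<dots> \<le> r\<^sup>2" using assms by (simp add: coord_ball_def)
  finally show ?thesis .
qed

lemma drift_term_abs_le:
  assumes "p \<in> I" "c \<in> coord_ball I r"
  shows "\<bar>c p * h p c\<bar> \<le> sqrt (b * r\<^sup>2)"
proof (rule real_le_rsqrt)
  have "\<bar>c p * h p c\<bar>\<^sup>2 \<le> b * (c p)\<^sup>2"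
    using drift_term_square_le[OF assms] by simp
  also have "\<dots> \<le> b * r\<^sup>2"
    using coord_square_le[OF assms] b_nonneg[OF assms(1)] by (rule mult_left_mono)
  finally show "\<bar>c p * h p c\<bar>\<^sup>2 \<le> b * r\<^sup>2" .
qed

lemma integrable_drift_terms:
  assumes "p \<in> I" "q \<in> I" "r > 0"
  shows "integrable leb (\<lambda>c. indicator (coord_ball I r) c *\<^sub>R ((c p * h p c) * (c q * h q c)))"
proof (rule integrableI_bounded_set_indicator[OF coord_ball_measurable])
  show "(\<lambda>c. (c p * h p c) * (c q * h q c)) \<in> borel_measurable leb"
    by (intro borel_measurable_times drift_term_measurable assms)
  show "emeasure leb (coord_ball I r) < \<infinity>"
    using emeasure_coord_ball[OF finI \<open>r > 0\<close>] by simp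
  show "AE c in leb. c \<in> coord_ball I r \<longrightarrow>
      norm ((c p * h p c) * (c q * h q c)) \<le> sqrt (b * r\<^sup>2) * sqrt (b * r\<^sup>2)"
  proof (intro AE_I2 impI)
    fix c assume "c \<in> coord_ball I r"
    then show "norm ((c p * h p c) * (c q * h q c)) \<le> sqrt (b * r\<^sup>2) * sqrt (b * r\<^sup>2)"
      unfolding real_norm_def abs_mult[of "c p * h p c"]
      using assms drift_term_abs_le b_nonneg by (intro mult_mono) auto
  qed
qed

text \<open>Reflecting the coordinate of higher rank changes the sign of the integrand.\<close>

lemma drift_terms_orthogonal:
  assumes "p \<in> I" "q \<in> I" "p \<noteq> q"
  shows "(\<integral>c. indicator (coord_ball I r) c *\<^sub>R ((c p * h p c) * (c q * h q c)) \<partial>leb) = 0"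
proof -
  have *: "(\<integral>c. indicator (coord_ball I r) c *\<^sub>R ((c p * h p c) * (c q * h q c)) \<partial>leb) = 0"
    if pq: "p \<in> I" "q \<in> I" "p \<noteq> q" "rk p \<le> rk q" for p q
  proof -
    define F where "F c = (indicator (coord_ball I r) c *\<^sub>R ((c p * h p c) * (c q * h q c)) :: real)" for c
    define S where "S c = c(q := (-1) * c q + 0)" for c :: "'a \<Rightarrow> real"
    have F: "F \<in> borel_measurable leb"
      unfolding F_def
      by (intro borel_measurable_scaleR borel_measurable_indicator coord_ball_measurable
          borel_measurable_times drift_term_measurable pq)
    have S: "S \<in> measurable leb leb"
      unfolding S_def by (rule affine_coordinate_measurable[OF pq(2)]) simp
    have dS: "distr leb leb S = leb"
      unfolding S_def by (rule distr_affine_coordinate[OF finI pq(2)]) auto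
    have FS: "F (S c) = - F c" if "c \<in> space leb" for c
    proof -
      have "h p (S c) = h p c" by (rule h_cong[OF pq(1)]) (use pq in \<open>auto simp: S_def\<close>)
      moreover have "h q (S c) = h q c" by (rule h_cong[OF pq(2)]) (auto simp: S_def)
      moreover have "S c p = c p" "S c q = - c q" using pq by (auto simp: S_def)
      moreover have "S c \<in> coord_ball I r \<longleftrightarrow> c \<in> coord_ball I r"
      proof -
        have "(\<Sum>p\<in>I. (S c p)\<^sup>2) = (\<Sum>p\<in>I. (c p)\<^sup>2)"
          by (intro sum.cong) (auto simp: S_def)
        then show ?thesis using measurable_space[OF S that] that by (simp add: coord_ball_def)
      qed
      ultimately show ?thesis by (simp add: F_def indicator_def)
    qed
    have "(\<integral>c. F c \<partial>leb) = (\<integral>c. F (S c) \<partial>leb)"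
      using integral_distr[OF S F] dS by simp
    also have "\<dots> = (\<integral>c. - F c \<partial>leb)"
      by (intro Bochner_Integration.integral_cong FS refl)
    also have "\<dots> = - (\<integral>c. F c \<partial>leb)" by simp
    finally have "(\<integral>c. F c \<partial>leb) = 0" by simp
    then show ?thesis unfolding F_def .
  qed
  show ?thesis
  proof (cases "rk p \<le> rk q")
    case True
    then show ?thesis by (rule *[OF assms])
  next
    case False
    then show ?thesis using *[OF assms(2,1)] assms(3) by (simp add: mult.commute)
  qed
qed

text \<open>Only the diagonal terms survive, and they add up to at most \<open>b\<close> times the
  squared length of \<open>c\<close>. Cauchy-Schwarz would merely give \<open>G\<^sup>2\<close> in
  place of \<open>b\<close>.\<close>

lemma drift_second_moment:
  assumes "r > 0" "b \<ge> 0"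
  shows "integrable leb (\<lambda>c. indicator (coord_ball I r) c *\<^sub>R (drift c)\<^sup>2)"
    and "(\<integral>c. indicator (coord_ball I r) c *\<^sub>R (drift c)\<^sup>2 \<partial>leb)
      \<le> b * r\<^sup>2 * measure leb (coord_ball I r)"
proof -
  let ?M = leb and ?D = "coord_ball I r"
  define F where "F p q c = (indicator ?D c *\<^sub>R ((c p * h p c) * (c q * h q c)) :: real)" for p q c
  have F: "integrable ?M (F p q)" if "p \<in> I" "q \<in> I" for p q
    unfolding F_def by (rule integrable_drift_terms[OF that \<open>r > 0\<close>])
  have sq: "(\<lambda>c. indicator ?D c *\<^sub>R (drift c)\<^sup>2) = (\<lambda>c. \<Sum>p\<in>I. \<Sum>q\<in>I. F p q c)"
    by (rule ext) (simp only: F_def drift_def power2_eq_square sum_product scaleR_sum_right)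
  show "integrable ?M (\<lambda>c. indicator ?D c *\<^sub>R (drift c)\<^sup>2)"
    unfolding sq by (intro Bochner_Integration.integrable_sum F)
  have "(\<integral>c. indicator ?D c *\<^sub>R (drift c)\<^sup>2 \<partial>?M) = (\<Sum>p\<in>I. \<Sum>q\<in>I. \<integral>c. F p q c \<partial>?M)"
    unfolding sq by (simp add: Bochner_Integration.integral_sum F Bochner_Integration.integrable_sum)
  also have "\<dots> = (\<Sum>p\<in>I. \<Sum>q\<in>I. if q = p then \<integral>c. F p p c \<partial>?M else 0)"
    using drift_terms_orthogonal[of _ _ r] by (intro sum.cong refl) (auto simp: F_def)
  also have "\<dots> = (\<Sum>p\<in>I. \<integral>c. F p p c \<partial>?M)"
    using finI by simp
  also have "\<dots> = (\<integral>c. (\<Sum>p\<in>I. F p p c) \<partial>?M)"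
    by (simp add: Bochner_Integration.integral_sum F)
  also have "\<dots> \<le> (\<integral>c. indicator ?D c *\<^sub>R (b * r\<^sup>2) \<partial>?M)"
  proof (intro integral_mono Bochner_Integration.integrable_sum F)
    show "integrable ?M (\<lambda>c. indicator ?D c *\<^sub>R (b * r\<^sup>2))"
      using emeasure_coord_ball[OF finI \<open>r > 0\<close>]
      by (intro integrableI_bounded_set_indicator[where B="b * r\<^sup>2"] coord_ball_measurable)
        (use \<open>b \<ge> 0\<close> in auto)
    fix c
    show "(\<Sum>p\<in>I. F p p c) \<le> indicator ?D c *\<^sub>R (b * r\<^sup>2)"
    proof (cases "c \<in> ?D")
      case True
      have "(\<Sum>p\<in>I. F p p c) \<le> (\<Sum>p\<in>I. b * (c p)\<^sup>2)"
        using drift_term_square_le[OF _ True] True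
        by (intro sum_mono) (auto simp: F_def power2_eq_square)
      also have "\<dots> \<le> b * r\<^sup>2"
        using True \<open>b \<ge> 0\<close> unfolding sum_distrib_left[symmetric]
        by (intro mult_left_mono) (auto simp: coord_ball_def)
      finally show ?thesis using True by simp
    qed (simp add: F_def)
  qed
  also have "\<dots> = b * r\<^sup>2 * measure ?M ?D"
    using coord_ball_measurable[of I r] sets.sets_into_space[OF coord_ball_measurable[of I r]]
    by (simp add: Int_absorb2 mult.commute)
  finally show "(\<integral>c. indicator ?D c *\<^sub>R (drift c)\<^sup>2 \<partial>?M) \<le> b * r\<^sup>2 * measure ?M ?D" .
qed

text \<open>A point that leaves the ball either leaves the ball of radius \<open>r'\<close> too,
  which by the choice of \<open>r'\<close> forces the drift above \<open>s\<close> and is rare by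
  Chebyshev, or it lands in the shell between the two balls, whose preimage is no larger than the
  shell because the shift preserves Lebesgue measure.\<close>

lemma triangular_shift_exit:
  assumes "r > 0" "b \<ge> 0" "s > 0" "r' > 0" "r'\<^sup>2 = r\<^sup>2 + G\<^sup>2 + 2 * s"
  shows "measure leb {c \<in> coord_ball I r. triangular_shift I h c \<notin> coord_ball I r}
    \<le> (b * r\<^sup>2 / s\<^sup>2 + ((r' / r) ^ card I - 1)) * measure leb (coord_ball I r)"
proof -
  let ?M = leb and ?D = "coord_ball I r" and ?T = "triangular_shift I h"
  note T = triangular_shift_measurable
  have finD: "emeasure ?M (coord_ball I x) \<noteq> \<infinity>" if "x > 0" for x
    using emeasure_coord_ball[OF finI that] by simp
  define E1 where "E1 = {c \<in> ?D. drift c > s}"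
  \<comment> \<open>The preimage is taken in the whole space instead of the ball, so that its
    measure is exactly that of the shell.\<close>
  define E2 where "E2 = ?T -` (coord_ball I r' - ?D) \<inter> space ?M"
  have E1m: "E1 \<in> sets ?M"
  proof -
    have "E1 = ?D \<inter> {c \<in> space ?M. drift c > s}" by (auto simp: E1_def coord_ball_def)
    then show ?thesis
      using borel_measurable_iff_greater[THEN iffD1, OF drift_measurable, rule_format, of s]
        coord_ball_measurable[of I r] by (simp only: sets.Int)
  qed
  have E2m: "E2 \<in> sets ?M"
    unfolding E2_def by (intro measurable_sets[OF T] sets.Diff coord_ball_measurable)
  have E1fin: "emeasure ?M E1 \<noteq> \<infinity>"
  proof -
    have "emeasure ?M E1 \<le> emeasure ?M ?D"
      by (rule emeasure_mono[OF _ coord_ball_measurable]) (auto simp: E1_def)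
    then show ?thesis using finD[OF \<open>r > 0\<close>] by (auto simp: top_unique)
  qed
  have emE2: "emeasure ?M E2 = emeasure ?M (coord_ball I r' - ?D)"
    using emeasure_distr[OF T, of "coord_ball I r' - ?D"] distr_triangular_shift
      sets.Diff[OF coord_ball_measurable[of I r'] coord_ball_measurable[of I r]]
    by (simp add: E2_def)
  have "r\<^sup>2 \<le> r'\<^sup>2" using assms by (simp add: zero_le_power2)
  then have sub: "?D \<subseteq> coord_ball I r'" by (auto simp: coord_ball_def)
  have "{c \<in> ?D. ?T c \<notin> ?D} \<subseteq> E1 \<union> E2"
  proof (rule subsetI, rule UnCI)
    fix c assume c: "c \<in> {c \<in> ?D. ?T c \<notin> ?D}" and "c \<notin> E2"
    then have cD: "c \<in> ?D" and cs: "c \<in> space ?M" by (auto simp: coord_ball_def)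
    then have "?T c \<in> space ?M" using measurable_space[OF T] by blast
    moreover have "?T c \<notin> coord_ball I r'" using c \<open>c \<notin> E2\<close> cs by (auto simp: E2_def)
    ultimately have "r'\<^sup>2 < (\<Sum>p\<in>I. (?T c p)\<^sup>2)" by (simp add: coord_ball_def)
    also have "\<dots> = (\<Sum>p\<in>I. (c p)\<^sup>2 + 2 * (c p * h p c) + (h p c)\<^sup>2)"
      by (intro sum.cong) (auto simp: triangular_shift_def power2_sum algebra_simps)
    also have "\<dots> = (\<Sum>p\<in>I. (c p)\<^sup>2) + 2 * drift c + (\<Sum>p\<in>I. (h p c)\<^sup>2)"
      by (simp add: sum.distrib drift_def sum_distrib_left)
    also have "\<dots> \<le> r\<^sup>2 + 2 * drift c + G\<^sup>2"
      using h_total cD by (intro add_mono) (auto simp: coord_ball_def)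
    finally have "drift c > s" using assms(5) by simp
    then show "c \<in> E1" using cD by (simp add: E1_def)
  qed
  moreover have "emeasure ?M (E1 \<union> E2) \<noteq> \<infinity>"
  proof -
    have "emeasure ?M E1 \<noteq> \<infinity>" by (rule E1fin)
    moreover have "emeasure ?M E2 \<noteq> \<infinity>"
      unfolding emE2 using emeasure_mono[of "coord_ball I r' - ?D" "coord_ball I r'" ?M] finD[OF \<open>r' > 0\<close>]
        coord_ball_measurable[of I r'] by (auto simp: top_unique)
    ultimately show ?thesis
      using emeasure_subadditive[OF E1m E2m] by (auto simp: top_unique)
  qed
  ultimately have "measure ?M {c \<in> ?D. ?T c \<notin> ?D} \<le> measure ?M (E1 \<union> E2)"
  proof (intro measure_mono_fmeasurable fmeasurableI)
    have "{c \<in> ?D. ?T c \<notin> ?D} = ?D \<inter> (?T -` (space ?M - ?D) \<inter> space ?M)"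
      using measurable_space[OF T] by (auto simp: coord_ball_def)
    moreover have "?T -` (space ?M - ?D) \<inter> space ?M \<in> sets ?M"
      by (intro measurable_sets[OF T] sets.compl_sets coord_ball_measurable)
    ultimately show "{c \<in> ?D. ?T c \<notin> ?D} \<in> sets ?M"
      using coord_ball_measurable[of I r] by (simp only: sets.Int)
  qed (use E1m E2m in \<open>auto simp: less_top\<close>)
  also have "\<dots> \<le> measure ?M E1 + measure ?M E2"
    using E1m E2m by (rule measure_Un_le)
  \<comment> \<open>Chebyshev's inequality, with the second moment of the drift.\<close>
  also have "measure ?M E1 \<le> b * r\<^sup>2 / s\<^sup>2 * measure ?M ?D"
  proof -
    have "s\<^sup>2 * measure ?M E1 = (\<integral>c. indicator E1 c *\<^sub>R s\<^sup>2 \<partial>?M)"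
      using sets.sets_into_space[OF E1m] by (simp add: Int_absorb2 mult.commute)
    also have "\<dots> \<le> (\<integral>c. indicator ?D c *\<^sub>R (drift c)\<^sup>2 \<partial>?M)"
    proof (rule integral_mono[OF _ drift_second_moment(1)[OF assms(1,2)]])
      have "emeasure ?M E1 < \<infinity>"
        using E1fin by (simp add: less_top)
      then show "integrable ?M (\<lambda>c. indicator E1 c *\<^sub>R s\<^sup>2)"
        by (intro integrableI_bounded_set_indicator[where B="s\<^sup>2"] E1m) auto
      fix c
      show "indicator E1 c *\<^sub>R s\<^sup>2 \<le> indicator ?D c *\<^sub>R (drift c)\<^sup>2"
        using \<open>s > 0\<close> by (auto simp: E1_def indicator_def)
    qed
    also have "\<dots> \<le> b * r\<^sup>2 * measure ?M ?D" by (rule drift_second_moment(2)[OF assms(1,2)])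
    finally show ?thesis using \<open>s > 0\<close> by (simp add: field_simps)
  qed
  also have "measure ?M E2 = ((r' / r) ^ card I - 1) * measure ?M ?D"
  proof -
    have "measure ?M E2 = measure ?M (coord_ball I r' - ?D)" using emE2 by (simp add: measure_def)
    also have "\<dots> = measure ?M (coord_ball I r') - measure ?M ?D"
      by (rule measure_Diff[OF finD[OF \<open>r' > 0\<close>] coord_ball_measurable coord_ball_measurable sub])
    also have "\<dots> = ((r' / r) ^ card I - 1) * measure ?M ?D"
      using assms by (simp add: measure_coord_ball finI power_divide field_simps)
    finally show ?thesis .
  qed
  finally show ?thesis by (simp add: algebra_simps)
qed

end

text \<open>Let \<open>N\<close> be the part of the image of \<open>\<mu>\<close> under
  \<open>T\<close> that lies in \<open>D\<close>. By \<open>dom\<close> it is dominated by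
  \<open>\<mu>\<close>, and \<open>\<mu> - N\<close> has the mass \<open>e\<close> of the points
  sent outside \<open>D\<close>. With \<open>\<kappa>\<close> the normalized difference, keeping
  \<open>T y\<close> inside \<open>D\<close> and drawing from \<open>\<kappa>\<close> otherwise has
  law \<open>N + e \<kappa> = \<mu>\<close>.\<close>

lemma resampling_measure:
  assumes one: "emeasure \<mu> (space \<mu>) = 1" and T[measurable]: "T \<in> measurable \<mu> \<mu>" and D[measurable]: "D \<in> sets \<mu>"
    and dom: "\<And>A. A \<in> sets \<mu> \<Longrightarrow> A \<subseteq> D \<Longrightarrow> emeasure \<mu> (T -` A \<inter> space \<mu>) \<le> emeasure \<mu> A"
  obtains \<kappa> where "sets \<kappa> = sets \<mu>" "emeasure \<kappa> (space \<kappa>) = 1"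
    "(\<lambda>(y, z). if T y \<in> D then T y else z) \<in> measurable (\<mu> \<Otimes>\<^sub>M \<kappa>) \<mu>"
    "distr (\<mu> \<Otimes>\<^sub>M \<kappa>) \<mu> (\<lambda>(y, z). if T y \<in> D then T y else z) = \<mu>"
proof -
  interpret mu: finite_measure \<mu> using one by (intro finite_measureI) simp
  define N where "N = density (distr \<mu> \<mu> T) (indicator D)"
  have N: "emeasure N A = emeasure \<mu> (T -` (A \<inter> D) \<inter> space \<mu>)" if "A \<in> sets \<mu>" for A
  proof -
    have "emeasure N A = emeasure (distr \<mu> \<mu> T) (A \<inter> D)"
    proof -
      have "(\<lambda>x. indicator D x * indicator A x :: ennreal) = indicator (A \<inter> D)"
        by (auto simp: indicator_def)
      then show ?thesis using that D by (simp add: N_def emeasure_density)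
    qed
    then show ?thesis using that by (simp add: emeasure_distr)
  qed
  have setsN[simp]: "sets N = sets \<mu>" "space N = space \<mu>" by (auto simp: N_def)
  have Nle: "emeasure N A \<le> emeasure \<mu> A" if "A \<in> sets \<mu>" for A
    using dom[of "A \<inter> D"] emeasure_mono[of "A \<inter> D" A \<mu>] that N[OF that] by (auto intro: order_trans)
  have finN: "finite_measure N"
    using Nle[of "space \<mu>"] one by (intro finite_measureI) (auto simp: top_unique)
  define \<kappa>0 where "\<kappa>0 = diff_measure \<mu> N"
  have \<kappa>0: "emeasure \<kappa>0 A = emeasure \<mu> A - emeasure N A" if "A \<in> sets \<mu>" for A
    unfolding \<kappa>0_def by (rule emeasure_diff_measure[OF mu.finite_measure_axioms finN]) (use Nle that in auto)
  define e where "e = emeasure \<mu> (T -` (space \<mu> - D) \<inter> space \<mu>)"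
  have e: "emeasure \<kappa>0 (space \<mu>) = e"
  proof -
    have "T -` (space \<mu> - D) \<inter> space \<mu> = space \<mu> - (T -` (space \<mu> \<inter> D) \<inter> space \<mu>)"
      using measurable_space[OF T] by auto
    then have "e = emeasure \<mu> (space \<mu>) - emeasure \<mu> (T -` (space \<mu> \<inter> D) \<inter> space \<mu>)"
      unfolding e_def by (subst emeasure_Diff[symmetric]) (use mu.emeasure_finite in auto)
    then show ?thesis by (simp add: \<kappa>0 N)
  qed
  have "e \<le> 1" unfolding e_def one[symmetric] by (rule emeasure_space)
  then have "e < \<infinity>" by (simp add: order_le_less_trans)
  \<comment> \<open>For \<open>e = 0\<close> resampling happens with probability zero and
    normalization is impossible, so some probability measure is chosen instead.\<close>
  define \<kappa> where "\<kappa> = (if e = 0 then \<mu> else scale_measure (1 / e) \<kappa>0)"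
  have s\<kappa>[simp]: "sets \<kappa> = sets \<mu>"
    by (auto simp: \<kappa>_def \<kappa>0_def)
  have [simp]: "space \<kappa> = space \<mu>"
    by (rule sets_eq_imp_space_eq) simp
  have "emeasure \<kappa> (space \<mu>) = 1"
    using one \<open>e < \<infinity>\<close> by (simp add: \<kappa>_def e ennreal_divide_times)
  then have one\<kappa>: "emeasure \<kappa> (space \<kappa>) = 1" by simp
  interpret ka: finite_measure \<kappa> using one\<kappa> by (intro finite_measureI) simp
  \<comment> \<open>Multiplying by \<open>e\<close> gives an identity valid in both cases, because
    \<open>\<kappa>0\<close> vanishes when \<open>e = 0\<close>.\<close>
  have ke: "emeasure \<kappa> A * e = emeasure \<kappa>0 A" if "A \<in> sets \<mu>" for A
  proof (cases "e = 0")
    case True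
    have "emeasure \<kappa>0 A \<le> emeasure \<kappa>0 (space \<mu>)"
      using emeasure_space[of \<kappa>0 A] by (simp add: \<kappa>0_def)
    then show ?thesis using True e by simp
  next
    case False
    have "emeasure \<kappa> A * e = emeasure \<kappa>0 A * (e / e)"
      using False by (simp add: \<kappa>_def ennreal_divide_times ennreal_times_divide mult.commute)
    then show ?thesis using False \<open>e < \<infinity>\<close> by simp
  qed
  let ?P = "\<mu> \<Otimes>\<^sub>M \<kappa>"
  define X where "X = (\<lambda>(y, z). if T y \<in> D then T y else z)"
  have X[measurable]: "X \<in> measurable ?P \<mu>"
  proof -
    have Tf: "(\<lambda>x. T (fst x)) \<in> measurable ?P \<mu>"
      by (rule measurable_compose[OF measurable_fst T])
    have "(\<lambda>x. T (fst x)) -` D \<inter> space ?P \<in> sets ?P"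
      by (rule measurable_sets[OF Tf D])
    moreover have "(\<lambda>x. T (fst x)) -` D \<inter> space ?P = {x \<in> space ?P. T (fst x) \<in> D}"
      by auto
    ultimately have S: "{x \<in> space ?P. T (fst x) \<in> D} \<in> sets ?P" by simp
    have "snd \<in> measurable ?P \<mu>"
      using measurable_snd[of \<mu> \<kappa>] measurable_cong_sets[OF refl s\<kappa>] by blast
    from measurable_If[OF Tf this S] show ?thesis unfolding X_def split_beta' .
  qed
  have "distr ?P \<mu> X = \<mu>"
  proof (rule measure_eqI)
    fix A assume "A \<in> sets (distr ?P \<mu> X)"
    then have A[measurable]: "A \<in> sets \<mu>" by simp
    have "emeasure (distr ?P \<mu> X) A = (\<integral>\<^sup>+w. indicator A (X w) \<partial>?P)"
      using nn_integral_distr[OF X, of "indicator A"] A by simp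
    also have "\<dots> = (\<integral>\<^sup>+y. \<integral>\<^sup>+z. indicator A (X (y, z)) \<partial>\<kappa> \<partial>\<mu>)"
      by (rule ka.nn_integral_fst[symmetric]) simp
    also have "\<dots> = (\<integral>\<^sup>+y. indicator (T -` (A \<inter> D) \<inter> space \<mu>) y
        + emeasure \<kappa> A * indicator (T -` (space \<mu> - D) \<inter> space \<mu>) y \<partial>\<mu>)"
    proof (rule nn_integral_cong)
      fix y assume y: "y \<in> space \<mu>"
      have "T y \<in> space \<mu>" using y measurable_space[OF T] by blast
      show "(\<integral>\<^sup>+z. indicator A (X (y, z)) \<partial>\<kappa>) = indicator (T -` (A \<inter> D) \<inter> space \<mu>) y
        + emeasure \<kappa> A * indicator (T -` (space \<mu> - D) \<inter> space \<mu>) y"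
      proof (cases "T y \<in> D")
        case True
        then show ?thesis using y one\<kappa> by (auto simp: X_def indicator_def)
      next
        case False
        then show ?thesis using y \<open>T y \<in> space \<mu>\<close> A by (simp add: X_def)
      qed
    qed
    also have "\<dots> = emeasure N A + emeasure \<kappa> A * e"
      by (subst nn_integral_add) (auto simp: N e_def nn_integral_cmult)
    also have "\<dots> = emeasure \<mu> A"
      using ke[OF A] \<kappa>0[OF A] Nle[OF A] by (simp add: add_diff_inverse_ennreal)
    finally show "emeasure (distr ?P \<mu> X) A = emeasure \<mu> A" .
  qed simp
  then show ?thesis using that[of \<kappa>] one\<kappa> X by (simp add: X_def)
qed

section \<open>Square integrable functions with values in the Lie algebra\<close>

locale subspace_inner_product =
  fixes W :: "'a::euclidean_space set" and ip :: "'a \<Rightarrow> 'a \<Rightarrow> real"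
  assumes W: "subspace W" and ip: "inner_product_on W ip"
begin

lemma ip_commute: "x \<in> W \<Longrightarrow> y \<in> W \<Longrightarrow> ip x y = ip y x"
  and ip_add_left: "x \<in> W \<Longrightarrow> y \<in> W \<Longrightarrow> z \<in> W \<Longrightarrow> ip (x + y) z = ip x z + ip y z"
  and ip_scale_left: "x \<in> W \<Longrightarrow> y \<in> W \<Longrightarrow> ip (a *\<^sub>R x) y = a * ip x y"
  and ip_pos: "x \<in> W \<Longrightarrow> x \<noteq> 0 \<Longrightarrow> 0 < ip x x"
  using ip by (auto simp: inner_product_on_def)

lemma ip_zero_left: "y \<in> W \<Longrightarrow> ip 0 y = 0"
  using ip_scale_left[of 0 y 0] subspace_0[OF W] by simp

lemma ip_diff_left: "x \<in> W \<Longrightarrow> y \<in> W \<Longrightarrow> z \<in> W \<Longrightarrow> ip (x - y) z = ip x z - ip y z"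
  using ip_add_left[of x "(-1) *\<^sub>R y" z] ip_scale_left[of y z "-1"] subspace_scale[OF W, of y "-1"] by simp

lemma ip_sum_left:
  assumes "finite B" "B \<subseteq> W" "y \<in> W"
  shows "ip (\<Sum>b\<in>B. u b *\<^sub>R b) y = (\<Sum>b\<in>B. u b * ip b y)"
  using assms
proof (induction B rule: finite_induct)
  case (insert b B)
  have "(\<Sum>b\<in>B. u b *\<^sub>R b) \<in> W" "u b *\<^sub>R b \<in> W"
    using insert by (auto intro!: subspace_sum subspace_scale W)
  then show ?case using insert by (simp add: ip_add_left ip_scale_left)
qed (simp add: ip_zero_left)

text \<open>Gram-Schmidt, carried out for \<open>ip\<close>, which may differ from the inner product
  of the type. A vector with residue \<open>y = 0\<close> adds nothing to the basis.\<close>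

lemma orthonormal_basis_of_span_exists:
  assumes "finite S" "S \<subseteq> W"
  shows "\<exists>B. orthonormal_basis_of (span S) ip B"
  using assms
proof (induction S rule: finite_induct)
  case empty
  show ?case by (intro exI[of _ "{}"]) (simp add: orthonormal_basis_of_def)
next
  case (insert x S)
  then obtain B where "orthonormal_basis_of (span S) ip B" by auto
  then have B: "finite B" "B \<subseteq> span S" "span B = span S"
    "\<And>b c. b \<in> B \<Longrightarrow> c \<in> B \<Longrightarrow> ip b c = (if b = c then 1 else 0)"
    by (auto simp: orthonormal_basis_of_def)
  have SW: "span S \<subseteq> W" using insert W by (metis insert_subset span_minimal)
  then have BW: "B \<subseteq> W" using B by auto
  have xW: "x \<in> W" using insert by auto
  define y where "y = x - (\<Sum>b\<in>B. ip x b *\<^sub>R b)"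
  have sW: "(\<Sum>b\<in>B. ip x b *\<^sub>R b) \<in> W" using BW by (auto intro!: subspace_sum subspace_scale W)
  have sB: "(\<Sum>b\<in>B. ip x b *\<^sub>R b) \<in> span B" by (intro span_sum span_scale span_base)
  have yW: "y \<in> W" unfolding y_def using xW sW W by (rule subspace_diff[rotated])
  have yb: "ip y c = 0" if "c \<in> B" for c
  proof -
    have "(\<Sum>b\<in>B. ip x b * ip b c) = (\<Sum>b\<in>B. if b = c then ip x c else 0)"
      using B(4) that by (intro sum.cong) auto
    then have "(\<Sum>b\<in>B. ip x b * ip b c) = ip x c" using that B(1) by simp
    moreover have "ip y c = ip x c - ip (\<Sum>b\<in>B. ip x b *\<^sub>R b) c"
      unfolding y_def using xW sW BW that by (intro ip_diff_left) auto
    moreover have "ip (\<Sum>b\<in>B. ip x b *\<^sub>R b) c = (\<Sum>b\<in>B. ip x b * ip b c)"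
      using BW that by (intro ip_sum_left B) auto
    ultimately show ?thesis by simp
  qed
  show ?case
  proof (cases "y = 0")
    case True
    then have "x \<in> span S" using sB B(3) by (simp add: y_def)
    then have "span (insert x S) = span S" by (rule span_redundant)
    then show ?thesis using B by (intro exI[of _ B]) (simp add: orthonormal_basis_of_def)
  next
    case False
    define z where "z = (1 / sqrt (ip y y)) *\<^sub>R y"
    have pos: "ip y y > 0" using ip_pos yW False by blast
    have zW: "z \<in> W" unfolding z_def using yW W by (rule subspace_scale[rotated])
    have zb: "ip z c = 0" "ip c z = 0" if "c \<in> B" for c
    proof -
      show "ip z c = 0" unfolding z_def using ip_scale_left[of y c] yW yb[OF that] BW that by auto
      then show "ip c z = 0" using ip_commute[of c z] zW BW that by auto
    qed
    have zz: "ip z z = 1"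
    proof -
      have "ip z z = (1 / sqrt (ip y y)) * ip y z" unfolding z_def
        using yW zW by (subst ip_scale_left) (auto simp: z_def)
      also have "ip y z = ip z y" using ip_commute yW zW by blast
      also have "ip z y = (1 / sqrt (ip y y)) * ip y y" unfolding z_def using ip_scale_left[OF yW yW] .
      finally show ?thesis using pos by (simp add: real_div_sqrt)
    qed
    have zx: "z \<in> span (insert x S)"
    proof -
      have "(\<Sum>b\<in>B. ip x b *\<^sub>R b) \<in> span (insert x S)"
        using sB B(3) span_mono[of S "insert x S"] by auto
      then show ?thesis unfolding z_def y_def
        by (intro span_scale span_diff) (auto intro: span_base)
    qed
    have "x = sqrt (ip y y) *\<^sub>R z + (\<Sum>b\<in>B. ip x b *\<^sub>R b)"
      using pos by (simp add: z_def y_def)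
    moreover have "\<dots> \<in> span (insert z B)"
      using sB span_mono[of B "insert z B"] by (intro span_add span_scale) (auto intro: span_base)
    ultimately have xz: "x \<in> span (insert z B)" by simp
    have "span (insert z B) = span (insert x S)"
    proof (rule subset_antisym)
      show "span (insert z B) \<subseteq> span (insert x S)"
        using zx B(2) span_mono[of S "insert x S"] by (intro span_minimal) auto
      have "S \<subseteq> span (insert z B)"
        using B(3) span_mono[of B "insert z B"] span_superset[of S] by auto
      then show "span (insert x S) \<subseteq> span (insert z B)"
        using xz by (intro span_minimal) auto
    qed
    moreover have "z \<notin> B" using zb(1)[of z] zz by auto
    ultimately show ?thesis
      using B(1,2,4) zx zb zz span_mono[of S "insert x S"]
      by (intro exI[of _ "insert z B"]) (auto simp: orthonormal_basis_of_def)
  qed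
qed

lemma orthonormal_basis_exists: "\<exists>B. orthonormal_basis_of W ip B"
proof -
  obtain S where "S \<subseteq> W" "independent S" "W \<subseteq> span S" using basis_exists[of W] by metis
  moreover from this have "span S = W" using W by (metis span_minimal subset_antisym)
  ultimately show ?thesis
    using orthonormal_basis_of_span_exists[of S] independent_imp_finite[of S] by auto
qed

text \<open>Literally the choice made inside \<open>lebesgue_V\<close>, so that both refer to the
  same basis.\<close>

definition onb :: "'a set" where
  "onb = (SOME B. orthonormal_basis_of W ip B)"

lemma onb: "finite onb" "onb \<subseteq> W" "span onb = W"
  "\<And>b c. b \<in> onb \<Longrightarrow> c \<in> onb \<Longrightarrow> ip b c = (if b = c then 1 else 0)"
proof -
  have "orthonormal_basis_of W ip onb"
    unfolding onb_def by (rule someI_ex[OF orthonormal_basis_exists])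
  then show "finite onb" "onb \<subseteq> W" "span onb = W"
    "\<And>b c. b \<in> onb \<Longrightarrow> c \<in> onb \<Longrightarrow> ip b c = (if b = c then 1 else 0)"
    by (simp_all only: orthonormal_basis_of_def)
qed

lemma onb_independent: "independent onb"
proof (rule ccontr)
  assume "\<not> independent onb"
  then obtain u v where uv: "v \<in> onb" "u v \<noteq> 0" "(\<Sum>v\<in>onb. u v *\<^sub>R v) = 0"
    unfolding dependent_finite[OF onb(1)] not_not by (elim exE bexE conjE)
  have "(\<Sum>b\<in>onb. u b * ip b v) = 0"
    using ip_sum_left[OF onb(1,2), of v u] uv onb(2) ip_zero_left by auto
  moreover have "(\<Sum>b\<in>onb. u b * ip b v) = (\<Sum>b\<in>onb. if b = v then u v else 0)"
    using uv onb(4) by (intro sum.cong) auto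
  ultimately show False using uv onb(1) by simp
qed

text \<open>The coordinate functionals are extended to the whole space, where they are continuous.\<close>

definition coord :: "'a \<Rightarrow> 'a \<Rightarrow> real" where
  "coord b = (SOME f. linear f \<and> (\<forall>c\<in>onb. f c = (if c = b then 1 else 0)))"

lemma linear_coord: "linear (coord b)"
  and coord_onb: "c \<in> onb \<Longrightarrow> coord b c = (if c = b then 1 else 0)"
proof -
  have "\<exists>f :: 'a \<Rightarrow> real. linear f \<and> (\<forall>c\<in>onb. f c = (if c = b then 1 else 0))"
    by (rule linear_independent_extend[OF onb_independent])
  note * = someI_ex[OF this, folded coord_def]
  show "linear (coord b)" by (rule conjunct1[OF *])
  show "coord b c = (if c = b then 1 else 0)" if "c \<in> onb"
    by (rule bspec[OF conjunct2[OF *] that])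
qed

lemma bounded_linear_coord: "bounded_linear (coord b)"
  by (rule iffD1[OF linear_conv_bounded_linear linear_coord])

lemma coord_sum:
  assumes "c \<in> onb"
  shows "coord c (\<Sum>b\<in>onb. u b *\<^sub>R b) = u c"
proof -
  have "coord c (\<Sum>b\<in>onb. u b *\<^sub>R b) = (\<Sum>b\<in>onb. u b * coord c b)"
    by (simp add: linear_sum[OF linear_coord] linear_scale[OF linear_coord])
  also have "\<dots> = (\<Sum>b\<in>onb. if b = c then u c else 0)"
    by (intro sum.cong) (auto simp: coord_onb)
  finally show ?thesis using assms onb(1) by simp
qed

lemma coord_expansion:
  assumes "x \<in> W"
  shows "x = (\<Sum>b\<in>onb. coord b x *\<^sub>R b)"
proof -
  have "x \<in> range (\<lambda>u. \<Sum>b\<in>onb. u b *\<^sub>R b)"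
    using assms onb(3) by (simp only: span_finite[OF onb(1)])
  then obtain u where u: "x = (\<Sum>b\<in>onb. u b *\<^sub>R b)" by (rule rangeE)
  have "(\<Sum>b\<in>onb. coord b x *\<^sub>R b) = (\<Sum>b\<in>onb. u b *\<^sub>R b)"
    unfolding u by (intro sum.cong refl) (simp add: coord_sum)
  with u show ?thesis by (rule trans[OF _ sym])
qed

text \<open>An extension of the quadratic form \<open>ip x x\<close> from \<open>W\<close> to all
  vectors. Unlike \<open>ip\<close>, it is known to be continuous and hence measurable.\<close>

definition sqn :: "'a \<Rightarrow> real" where
  "sqn x = (\<Sum>b\<in>onb. (coord b x)\<^sup>2)"

lemma ip_self: "x \<in> W \<Longrightarrow> ip x x = sqn x"
proof -
  assume x: "x \<in> W"
  have ipb: "ip b x = coord b x" if b: "b \<in> onb" for b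
  proof -
    have "ip b x = ip x b" using ip_commute b onb(2) x by blast
    also have "\<dots> = ip (\<Sum>c\<in>onb. coord c x *\<^sub>R c) b" using coord_expansion[OF x] by simp
    also have "\<dots> = (\<Sum>c\<in>onb. coord c x * ip c b)"
      using b onb(2) by (intro ip_sum_left onb) auto
    also have "\<dots> = (\<Sum>c\<in>onb. if c = b then coord b x else 0)"
      using b onb(4) by (intro sum.cong) auto
    finally show ?thesis using b onb(1) by simp
  qed
  have "ip x x = ip (\<Sum>c\<in>onb. coord c x *\<^sub>R c) x" using coord_expansion[OF x] by simp
  also have "\<dots> = (\<Sum>c\<in>onb. coord c x * ip c x)" by (intro ip_sum_left onb x)
  finally show ?thesis by (simp add: ipb sqn_def power2_eq_square)
qed

lemma sqn_nonneg: "sqn x \<ge> 0"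
  by (simp add: sqn_def sum_nonneg)

lemma sqn_scale: "sqn (a *\<^sub>R x) = a\<^sup>2 * sqn x"
  by (simp add: sqn_def linear_scale[OF linear_coord] power_mult_distrib sum_distrib_left)

text \<open>Young's inequality in every coordinate. The free weight \<open>l\<close> lets
  \<open>nrm_triangle\<close> recover the sharp triangle inequality; \<open>l = 1\<close> suffices
  for integrability.\<close>

lemma sqn_add_le:
  assumes "l > 0"
  shows "sqn (x + y) \<le> (1 + l) * sqn x + (1 + 1 / l) * sqn y"
proof -
  have "(coord b (x + y))\<^sup>2 \<le> (1 + l) * (coord b x)\<^sup>2 + (1 + 1 / l) * (coord b y)\<^sup>2" for b
  proof -
    have "0 \<le> (sqrt l * coord b x - coord b y / sqrt l)\<^sup>2" by simp
    also have "\<dots> = l * (coord b x)\<^sup>2 + (coord b y)\<^sup>2 / l - 2 * coord b x * coord b y"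
      using assms by (simp add: power2_diff power_mult_distrib power_divide)
    finally show ?thesis by (simp add: linear_add[OF linear_coord] power2_sum algebra_simps)
  qed
  then show ?thesis
    unfolding sqn_def sum_distrib_left sum.distrib[symmetric] by (intro sum_mono)
qed

lemma sqn_measurable: "sqn \<in> borel_measurable borel"
  unfolding sqn_def[abs_def]
  by (intro borel_measurable_sum borel_measurable_power borel_measurable_continuous_onI
      linear_continuous_on bounded_linear_coord)

lemma norm_le_sqn: "\<exists>C\<ge>0. \<forall>x\<in>W. norm x \<le> C * sqrt (sqn x)"
proof (intro exI[of _ "\<Sum>b\<in>onb. norm b"] conjI ballI)
  fix x assume x: "x \<in> W"
  have "norm x \<le> (\<Sum>b\<in>onb. norm (coord b x *\<^sub>R b))"
    using coord_expansion[OF x] norm_sum by metis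
  also have "\<dots> \<le> (\<Sum>b\<in>onb. sqrt (sqn x) * norm b)"
  proof (intro sum_mono)
    fix b assume "b \<in> onb"
    then have "(coord b x)\<^sup>2 \<le> sqn x"
      unfolding sqn_def using onb(1) by (intro member_le_sum) auto
    then have "\<bar>coord b x\<bar> \<le> sqrt (sqn x)" by (intro real_le_rsqrt) simp
    then show "norm (coord b x *\<^sub>R b) \<le> sqrt (sqn x) * norm b"
      by (simp add: mult_right_mono)
  qed
  finally show "norm x \<le> (\<Sum>b\<in>onb. norm b) * sqrt (sqn x)"
    by (simp add: sum_distrib_right mult.commute)
qed (auto intro: sum_nonneg)

lemma sqn_le_norm: "\<exists>C\<ge>0. \<forall>x. sqrt (sqn x) \<le> C * norm x"
proof -
  have "\<exists>C. \<forall>x. \<bar>coord b x\<bar> \<le> norm x * C" for b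
    using bounded_linear.bounded[OF bounded_linear_coord] by auto
  then obtain C where C: "\<And>b x. \<bar>coord b x\<bar> \<le> norm x * C b" by metis
  show ?thesis
  proof (intro exI[of _ "\<Sum>b\<in>onb. \<bar>C b\<bar>"] conjI allI)
    fix x
    have "sqrt (sqn x) \<le> (\<Sum>b\<in>onb. \<bar>coord b x\<bar>)"
      unfolding sqn_def using L2_set_le_sum_abs[of "\<lambda>b. coord b x" onb] by (simp add: L2_set_def)
    also have "\<dots> \<le> (\<Sum>b\<in>onb. norm x * \<bar>C b\<bar>)"
    proof (intro sum_mono)
      fix b
      show "\<bar>coord b x\<bar> \<le> norm x * \<bar>C b\<bar>"
        by (rule order_trans[OF C mult_left_mono[OF abs_ge_self norm_ge_zero]])
    qed
    finally show "sqrt (sqn x) \<le> (\<Sum>b\<in>onb. \<bar>C b\<bar>) * norm x"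
      by (simp add: sum_distrib_left mult.commute)
  qed (auto intro: sum_nonneg)
qed

end

section \<open>The Hilbert space as a pseudometric space\<close>

locale path_space = compact_matrix_group K for K :: "(real^'n^'n) set" +
  fixes ip :: "real^'n^'n \<Rightarrow> real^'n^'n \<Rightarrow> real"
  assumes ip_lie: "inner_product_on (lie_algebra K) ip"
    and ip_Ad: "Ad_invariant K ip"
begin

sublocale subspace_inner_product "lie_algebra K" ip
  using subspace_lie_algebra ip_lie by unfold_locales

abbreviation "L2 \<equiv> L2_space K ip"
abbreviation "unit_leb \<equiv> lebesgue_on {0..1::real}"
abbreviation "nrm f \<equiv> L2_norm ip f"
abbreviation "dst f h \<equiv> L2_dist ip f h"

lemma L2_lie: "f \<in> L2 \<Longrightarrow> t \<in> {0..1} \<Longrightarrow> f t \<in> lie"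
  and L2_measurable: "f \<in> L2 \<Longrightarrow> f \<in> borel_measurable unit_leb"
  by (auto simp: L2_space_def)

lemma sqn_comp_measurable: "f \<in> borel_measurable M \<Longrightarrow> (\<lambda>t. sqn (f t)) \<in> borel_measurable M"
  using measurable_compose sqn_measurable by blast

lemma L2_iff: "f \<in> L2 \<longleftrightarrow> (\<forall>t\<in>{0..1}. f t \<in> lie) \<and> f \<in> borel_measurable unit_leb \<and>
    integrable unit_leb (\<lambda>t. sqn (f t))"
proof -
  have "integrable unit_leb (\<lambda>t. ip (f t) (f t)) \<longleftrightarrow> integrable unit_leb (\<lambda>t. sqn (f t))"
    if "\<forall>t\<in>{0..1}. f t \<in> lie"
    using that ip_self by (intro Bochner_Integration.integrable_cong) auto
  then show ?thesis by (auto simp: L2_space_def)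
qed

lemma nrm_eq: "f \<in> L2 \<Longrightarrow> nrm f = sqrt (\<integral>t. sqn (f t) \<partial>unit_leb)"
  unfolding L2_norm_def
  by (intro arg_cong[of _ _ sqrt] Bochner_Integration.integral_cong) (auto simp: ip_self L2_lie)

lemma nrm_nonneg: "f \<in> L2 \<Longrightarrow> nrm f \<ge> 0"
  by (simp add: nrm_eq sqn_nonneg)

lemma nrm_square: "f \<in> L2 \<Longrightarrow> (nrm f)\<^sup>2 = (\<integral>t. sqn (f t) \<partial>unit_leb)"
  by (simp add: nrm_eq sqn_nonneg)

lemma L2_bounded:
  assumes "\<And>t. t \<in> {0..1} \<Longrightarrow> f t \<in> lie" "f \<in> borel_measurable unit_leb"
    and "AE t in unit_leb. sqn (f t) \<le> C"
  shows "f \<in> L2" "nrm f \<le> sqrt C"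
proof -
  have fin: "finite_measure unit_leb" by (rule finite_measure_lebesgue_on) simp
  have i: "integrable unit_leb (\<lambda>t. sqn (f t))"
    by (rule finite_measure.integrable_const_bound[OF fin, of _ C])
      (use assms sqn_nonneg in \<open>auto intro: sqn_comp_measurable\<close>)
  then show "f \<in> L2" using assms by (simp add: L2_iff)
  have "(\<integral>t. sqn (f t) \<partial>unit_leb) \<le> (\<integral>t. C \<partial>unit_leb)"
    by (rule integral_mono_AE[OF i _ assms(3)]) (simp add: finite_measure.integrable_const[OF fin])
  then have "(\<integral>t. sqn (f t) \<partial>unit_leb) \<le> C" by (simp add: measure_restrict_space)
  then show "nrm f \<le> sqrt C" using \<open>f \<in> L2\<close> by (simp add: nrm_eq)
qed

lemma L2_dominated:
  assumes "\<And>t. t \<in> {0..1} \<Longrightarrow> f t \<in> lie" "f \<in> borel_measurable unit_leb" "h \<in> L2" "k \<ge> 0"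
    and "AE t in unit_leb. sqn (f t) \<le> k\<^sup>2 * sqn (h t)"
  shows "f \<in> L2" "nrm f \<le> k * nrm h"
proof -
  have h: "integrable unit_leb (\<lambda>t. k\<^sup>2 * sqn (h t))"
    using assms(3) by (simp add: L2_iff)
  have i: "integrable unit_leb (\<lambda>t. sqn (f t))"
    by (rule Bochner_Integration.integrable_bound[OF h sqn_comp_measurable[OF assms(2)]])
      (use assms(5) in eventually_elim, simp add: sqn_nonneg)
  then show "f \<in> L2" using assms by (simp add: L2_iff)
  have "(\<integral>t. sqn (f t) \<partial>unit_leb) \<le> (\<integral>t. k\<^sup>2 * sqn (h t) \<partial>unit_leb)"
    by (rule integral_mono_AE[OF i h assms(5)])
  then have "(nrm f)\<^sup>2 \<le> (k * nrm h)\<^sup>2"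
    using \<open>f \<in> L2\<close> assms(3) by (simp add: nrm_square power_mult_distrib)
  then show "nrm f \<le> k * nrm h"
    using nrm_nonneg[OF assms(3)] assms(4) by (auto intro: power2_le_imp_le)
qed

lemma L2_scale: "f \<in> L2 \<Longrightarrow> (\<lambda>t. a *\<^sub>R f t) \<in> L2"
  by (auto simp: L2_iff sqn_scale intro!: subspace_scale[OF subspace_lie_algebra])

lemma L2_add:
  assumes "f \<in> L2" "h \<in> L2"
  shows "(\<lambda>t. f t + h t) \<in> L2"
proof -
  have m: "(\<lambda>t. f t + h t) \<in> borel_measurable unit_leb"
    using assms by (intro borel_measurable_add L2_measurable)
  have "integrable unit_leb (\<lambda>t. (1 + 1) * sqn (f t) + (1 + 1 / 1) * sqn (h t))"
    using assms by (auto simp: L2_iff)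
  then have "integrable unit_leb (\<lambda>t. sqn (f t + h t))"
    by (rule Bochner_Integration.integrable_bound[OF _ sqn_comp_measurable[OF m]])
      (use sqn_add_le[of 1] in \<open>auto simp: sqn_nonneg intro!: AE_I2\<close>)
  then show ?thesis
    using assms m by (auto simp: L2_iff intro!: subspace_add[OF subspace_lie_algebra])
qed

lemma L2_diff:
  assumes "f \<in> L2" "h \<in> L2"
  shows "(\<lambda>t. f t - h t) \<in> L2"
  using L2_add[OF assms(1) L2_scale[OF assms(2), of "-1"]] by simp

text \<open>Minkowski's inequality from the weighted bound with \<open>l = b / a\<close>, the
  optimal weight for norms \<open>a\<close> and \<open>b\<close>. The norms are enlarged by
  \<open>e / 2\<close> to keep the quotient defined.\<close>

lemma nrm_triangle:
  assumes f: "f \<in> L2" and h: "h \<in> L2"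
  shows "nrm (\<lambda>t. f t + h t) \<le> nrm f + nrm h"
proof (rule field_le_epsilon)
  fix e :: real assume "e > 0"
  define a where "a = nrm f + e / 2"
  define b where "b = nrm h + e / 2"
  have pos: "a > 0" "b > 0" and le: "nrm f \<le> a" "nrm h \<le> b"
    using \<open>e > 0\<close> nrm_nonneg[OF f] nrm_nonneg[OF h] by (auto simp: a_def b_def)
  have "(nrm (\<lambda>t. f t + h t))\<^sup>2 = (\<integral>t. sqn (f t + h t) \<partial>unit_leb)"
    by (rule nrm_square[OF L2_add[OF f h]])
  also have "\<dots> \<le> (\<integral>t. (1 + b / a) * sqn (f t) + (1 + 1 / (b / a)) * sqn (h t) \<partial>unit_leb)"
    using L2_add[OF f h] f h pos
    by (intro integral_mono sqn_add_le) (auto simp: L2_iff)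
  also have "\<dots> = (1 + b / a) * (nrm f)\<^sup>2 + (1 + a / b) * (nrm h)\<^sup>2"
    using f h by (simp add: L2_iff nrm_square)
  also have "\<dots> \<le> (1 + b / a) * a\<^sup>2 + (1 + a / b) * b\<^sup>2"
    using pos le nrm_nonneg[OF f] nrm_nonneg[OF h] by (intro add_mono mult_left_mono power_mono) auto
  also have "\<dots> = (a + b)\<^sup>2"
    using pos by (simp add: power2_eq_square field_simps)
  finally show "nrm (\<lambda>t. f t + h t) \<le> nrm f + nrm h + e"
    using pos by (simp add: power2_le_iff_abs_le a_def b_def)
qed

lemma dst_nonneg: "f \<in> L2 \<Longrightarrow> h \<in> L2 \<Longrightarrow> dst f h \<ge> 0"
  unfolding L2_dist_def by (intro nrm_nonneg L2_diff)

lemma dst_triangle: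
  assumes "f \<in> L2" "h \<in> L2" "k \<in> L2"
  shows "dst f k \<le> dst f h + dst h k"
  using nrm_triangle[OF L2_diff[OF assms(1,2)] L2_diff[OF assms(2,3)]]
  by (simp add: L2_dist_def)

lemma nrm_le_dst:
  assumes "f \<in> L2" "h \<in> L2"
  shows "nrm f \<le> dst f h + nrm h"
  using nrm_triangle[OF L2_diff[OF assms] assms(2)] by (simp add: L2_dist_def)

definition L2_open :: "(real \<Rightarrow> real^'n^'n) set \<Rightarrow> bool" where
  "L2_open U \<longleftrightarrow> U \<subseteq> L2 \<and> (\<forall>f\<in>U. \<exists>e>0. \<forall>h\<in>L2. dst f h < e \<longrightarrow> h \<in> U)"

abbreviation "L2_meas \<equiv> L2_borel K ip"

lemma space_L2_borel: "space L2_meas = L2"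
  unfolding L2_borel_def by (rule space_measure_of) auto

lemma L2_open_sets: "L2_open U \<Longrightarrow> U \<in> sets L2_meas"
  unfolding L2_borel_def L2_open_def by (subst sets_measure_of) auto

lemma measurable_L2_borel:
  assumes "\<And>x. x \<in> space M \<Longrightarrow> F x \<in> L2"
    and "\<And>U. L2_open U \<Longrightarrow> F -` U \<inter> space M \<in> sets M"
  shows "F \<in> measurable M L2_meas"
  unfolding L2_borel_def
  by (rule measurable_measure_of) (use assms in \<open>auto simp: L2_open_def\<close>)

lemma nrm_ball_sets: "{f \<in> L2. nrm f \<le> r} \<in> sets L2_meas"
proof -
  have "L2_open {f \<in> L2. r < nrm f}"
    unfolding L2_open_def
  proof (intro conjI ballI)
    fix f assume f: "f \<in> {f \<in> L2. r < nrm f}"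
    show "\<exists>e>0. \<forall>h\<in>L2. dst f h < e \<longrightarrow> h \<in> {f \<in> L2. r < nrm f}"
    proof (intro exI[of _ "nrm f - r"] conjI ballI impI)
      fix h assume "h \<in> L2" "dst f h < nrm f - r"
      then show "h \<in> {f \<in> L2. r < nrm f}" using nrm_le_dst[of f h] f by auto
    qed (use f in auto)
  qed auto
  from sets.compl_sets[OF L2_open_sets[OF this]]
  have "L2 - {f \<in> L2. r < nrm f} \<in> sets L2_meas" by (simp add: space_L2_borel)
  moreover have "L2 - {f \<in> L2. r < nrm f} = {f \<in> L2. nrm f \<le> r}" by auto
  ultimately show ?thesis by simp
qed

lemma L2_ball_open:
  assumes "f \<in> L2"
  shows "L2_open {h \<in> L2. dst f h < e}"
  unfolding L2_open_def
proof (intro conjI ballI)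
  fix h assume h: "h \<in> {h \<in> L2. dst f h < e}"
  show "\<exists>d>0. \<forall>k\<in>L2. dst h k < d \<longrightarrow> k \<in> {h \<in> L2. dst f h < e}"
  proof (intro exI[of _ "e - dst f h"] conjI ballI impI)
    fix k assume "k \<in> L2" "dst h k < e - dst f h"
    then show "k \<in> {h \<in> L2. dst f h < e}" using dst_triangle[OF assms, of h k] h by auto
  qed (use h in auto)
qed auto

lemma L2_open_UN: "(\<And>x. x \<in> X \<Longrightarrow> L2_open (A x)) \<Longrightarrow> L2_open (\<Union>x\<in>X. A x)"
  unfolding L2_open_def by (auto; meson)

text \<open>Continuity on \<open>S\<close> suffices, since the preimage of an open set is
  \<open>S\<close> intersected with a union of open balls. The union may be uncountable, which is
  harmless because it is itself open.\<close>

lemma measurable_restrict_L2_borel: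
  assumes S: "S \<subseteq> L2" and F: "\<And>f. f \<in> S \<Longrightarrow> F f \<in> L2"
    and cont: "\<And>f e. f \<in> S \<Longrightarrow> e > 0 \<Longrightarrow> \<exists>d>0. \<forall>h\<in>S. dst f h < d \<longrightarrow> dst (F f) (F h) < e"
  shows "F \<in> measurable (restrict_space L2_meas S) L2_meas"
proof (rule measurable_L2_borel)
  have sp: "space (restrict_space L2_meas S) = S"
    using S by (auto simp: space_restrict_space space_L2_borel)
  show "F f \<in> L2" if "f \<in> space (restrict_space L2_meas S)" for f
    using that F sp by auto
  fix U assume U: "L2_open U"
  have "\<forall>f\<in>F -` U \<inter> S. \<exists>d. d > 0 \<and> (\<forall>h\<in>S. dst f h < d \<longrightarrow> F h \<in> U)"
  proof
    fix f assume f: "f \<in> F -` U \<inter> S"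
    then obtain e where e: "e > 0" "\<And>h. h \<in> L2 \<Longrightarrow> dst (F f) h < e \<Longrightarrow> h \<in> U"
      using U unfolding L2_open_def by blast
    from cont[of f, OF _ e(1)] f obtain d where "d > 0" "\<forall>h\<in>S. dst f h < d \<longrightarrow> dst (F f) (F h) < e"
      by auto
    then show "\<exists>d. d > 0 \<and> (\<forall>h\<in>S. dst f h < d \<longrightarrow> F h \<in> U)"
      using e(2) F by (intro exI[of _ d]) simp
  qed
  from bchoice[OF this] obtain d
    where d: "\<forall>f\<in>F -` U \<inter> S. d f > 0 \<and> (\<forall>h\<in>S. dst f h < d f \<longrightarrow> F h \<in> U)" by (elim exE)
  define U' where "U' = (\<Union>f\<in>F -` U \<inter> S. {h \<in> L2. dst f h < d f})"
  have "L2_open U'" unfolding U'_def using S by (intro L2_open_UN L2_ball_open) auto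
  have eq: "F -` U \<inter> S = S \<inter> U'"
  proof (intro subset_antisym subsetI)
    fix f assume f: "f \<in> F -` U \<inter> S"
    have "dst f f = 0"
      by (simp add: L2_dist_def L2_norm_def ip_zero_left subspace_0[OF subspace_lie_algebra])
    then have "f \<in> {h \<in> L2. dst f h < d f}" using bspec[OF d f] f S by auto
    then show "f \<in> S \<inter> U'" using f unfolding U'_def by (intro IntI UN_I[OF f]) simp_all
  next
    fix h assume h: "h \<in> S \<inter> U'"
    then obtain f where f: "f \<in> F -` U \<inter> S" "dst f h < d f" unfolding U'_def by blast
    then have "F h \<in> U" using bspec[OF d f(1)] h by simp
    then show "h \<in> F -` U \<inter> S" using h by simp
  qed
  show "F -` U \<inter> space (restrict_space L2_meas S) \<in> sets (restrict_space L2_meas S)"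
    unfolding sp eq sets_restrict_space by (rule imageI[OF L2_open_sets[OF \<open>L2_open U'\<close>]])
qed

end

section \<open>Step functions and the group law\<close>

lemma grid_cell_iff:
  assumes "N \<ge> 1" "t \<ge> 0"
  shows "real i / real N \<le> t \<and> t < real (Suc i) / real N \<longleftrightarrow> i = nat \<lfloor>t * N\<rfloor>"
proof -
  have "real i / real N \<le> t \<and> t < real (Suc i) / real N \<longleftrightarrow> real i \<le> t * N \<and> t * N < real i + 1"
    using assms by (simp add: pos_divide_le_eq pos_less_divide_eq add.commute)
  also have "\<dots> \<longleftrightarrow> \<lfloor>t * N\<rfloor> = int i"
    by (simp add: floor_eq_iff)
  also have "\<dots> \<longleftrightarrow> i = nat \<lfloor>t * N\<rfloor>"
    using assms by auto
  finally show ?thesis .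
qed

context path_space
begin

definition step_value :: "nat \<Rightarrow> (nat \<times> (real^'n^'n) \<Rightarrow> real) \<Rightarrow> nat \<Rightarrow> real^'n^'n" where
  "step_value N c i = (\<Sum>b\<in>onb. (c (i, b) * sqrt (real N)) *\<^sub>R b)"

abbreviation "coords (N :: nat) \<equiv> {..<N} \<times> onb"
abbreviation "cspace N \<equiv> lborel_pow (coords N)"
abbreviation "cdisc N \<equiv> coord_ball (coords N)"
abbreviation "V_borel N \<equiv> restrict_space L2_meas (V K ip N)"
abbreviation "step N c \<equiv> step_of_coords N onb c"

lemma finite_coords: "finite (coords N)"
  using onb(1) by simp

lemma step_value_lie: "step_value N c i \<in> lie"
  unfolding step_value_def using onb(2) by (intro subspace_sum subspace_scale subspace_lie_algebra) auto

lemma sqn_step_value: "sqn (step_value N c i) = real N * (\<Sum>b\<in>onb. (c (i, b))\<^sup>2)"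
  unfolding sqn_def step_value_def by (simp add: coord_sum power_mult_distrib sum_distrib_left mult.commute)

text \<open>The cells are half-open, so the value \<open>0\<close> is taken already at
  \<open>t = 1\<close>.\<close>

lemma step_at:
  assumes "N \<ge> 1" "t \<ge> 0"
  shows "step N c t = (if nat \<lfloor>t * N\<rfloor> < N then step_value N c (nat \<lfloor>t * N\<rfloor>) else 0)"
proof -
  have ind: "indicator (grid_cell N i) t = (if i = nat \<lfloor>t * N\<rfloor> then 1 else 0 :: real)" for i
    using grid_cell_iff[OF assms, of i] by (auto simp: indicator_def)
  have "step N c t = (\<Sum>i<N. \<Sum>b\<in>onb. (c (i, b) * sqrt (real N) * (if i = nat \<lfloor>t * N\<rfloor> then 1 else 0)) *\<^sub>R b)"
    unfolding step_of_coords_def ind sum.cartesian_product ..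
  also have "\<dots> = (\<Sum>i<N. if i = nat \<lfloor>t * N\<rfloor> then step_value N c i else 0)"
    by (intro sum.cong refl) (simp add: step_value_def)
  also have "\<dots> = (if nat \<lfloor>t * N\<rfloor> < N then step_value N c (nat \<lfloor>t * N\<rfloor>) else 0)"
    by (simp add: sum.delta')
  finally show ?thesis .
qed

lemma step_inside:
  assumes "N \<ge> 1" "i < N" "real i / real N \<le> t" "t < real (Suc i) / real N"
  shows "step N c t = step_value N c i"
proof -
  have "t \<ge> 0" using assms(3) by (rule order_trans[rotated]) simp
  moreover from this have "i = nat \<lfloor>t * N\<rfloor>" using grid_cell_iff[OF assms(1), of t i] assms(3,4) by blast
  ultimately show ?thesis using step_at[OF assms(1), of t c] assms(2) by simp
qed

lemma step_lie: "N \<ge> 1 \<Longrightarrow> t \<in> {0..1} \<Longrightarrow> step N c t \<in> lie"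
  using step_at[of N t c] step_value_lie subspace_0[OF subspace_lie_algebra] by auto

lemma step_measurable: "step N c \<in> borel_measurable unit_leb"
proof -
  have "step N c \<in> borel_measurable borel"
    unfolding step_of_coords_def split_beta'
    by (intro borel_measurable_sum borel_measurable_scaleR borel_measurable_times
        borel_measurable_indicator borel_measurable_const) auto
  then show ?thesis
    by (intro measurable_restrict_space1 measurable_completion) simp
qed

lemma sqn_step:
  assumes "N \<ge> 1" "t \<in> {0..1}"
  shows "sqn (step N c t) = (\<Sum>i<N. (real N * (\<Sum>b\<in>onb. (c (i, b))\<^sup>2))
      * indicator (grid_cell N i) t)"
proof -
  have t: "t \<ge> 0" using assms by simp
  have ind: "indicator (grid_cell N i) t = (if i = nat \<lfloor>t * N\<rfloor> then 1 else 0 :: real)" for i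
    using grid_cell_iff[OF assms(1) t, of i] by (auto simp: indicator_def)
  have "(\<Sum>i<N. (real N * (\<Sum>b\<in>onb. (c (i, b))\<^sup>2)) * (if i = nat \<lfloor>t * N\<rfloor> then 1 else 0))
      = (\<Sum>i<N. if i = nat \<lfloor>t * N\<rfloor> then sqn (step_value N c i) else 0)"
    by (intro sum.cong refl) (simp add: sqn_step_value)
  also have "\<dots> = sqn (step N c t)"
    using sqn_scale[of 0 0] by (simp add: step_at[OF assms(1) t])
  finally show ?thesis unfolding ind by simp
qed

lemma cell_measure:
  assumes "i < N"
  shows "measure unit_leb (grid_cell N i) = 1 / real N"
    and "(grid_cell N i) \<in> sets unit_leb"
proof -
  have sub: "(grid_cell N i) \<subseteq> {0..1}"
  proof -
    have "real (Suc i) / real N \<le> 1" using assms by (simp add: divide_le_eq)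
    moreover have "0 \<le> real i / real N" by simp
    ultimately show ?thesis by (meson atLeastLessThan_iff atLeastAtMost_iff less_imp_le order_trans subsetI)
  qed
  then show "(grid_cell N i) \<in> sets unit_leb"
    by (auto simp: sets_restrict_space_iff)
  have "measure unit_leb (grid_cell N i) = measure lebesgue (grid_cell N i)"
    using sub by (intro measure_restrict_space) auto
  also have "\<dots> = 1 / real N" using assms
    by (simp add: add_divide_distrib)
  finally show "measure unit_leb (grid_cell N i) = 1 / real N" .
qed

lemma unit_leb_finite: "finite_measure unit_leb"
  by (rule finite_measure_lebesgue_on) simp

lemma integrable_cell:
  "i < N \<Longrightarrow> integrable unit_leb (\<lambda>t. a * indicator (grid_cell N i) t :: real)"
  using cell_measure(2)[of i N] finite_measure.emeasure_finite[OF unit_leb_finite]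
  by (intro integrable_mult_right integrable_real_indicator) (auto simp: less_top)

lemma integral_cell:
  assumes "i < N"
  shows "(\<integral>t. a * indicator (grid_cell N i) t \<partial>unit_leb) = a / real N"
proof -
  have "(grid_cell N i) \<inter> space unit_leb = (grid_cell N i)"
    using sets.sets_into_space[OF cell_measure(2)[OF assms]] by blast
  then show ?thesis using cell_measure(1)[OF assms] by simp
qed

lemma step_L2: "N \<ge> 1 \<Longrightarrow> step N c \<in> L2"
  and nrm_step_square: "N \<ge> 1 \<Longrightarrow> (nrm (step N c))\<^sup>2 = (\<Sum>p\<in>coords N. (c p)\<^sup>2)"
proof -
  assume N: "N \<ge> 1"
  let ?F = "\<lambda>t. \<Sum>i<N. (real N * (\<Sum>b\<in>onb. (c (i, b))\<^sup>2))
      * indicator (grid_cell N i) t"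
  have "integrable unit_leb ?F" by (intro Bochner_Integration.integrable_sum integrable_cell) simp
  moreover have "integrable unit_leb (\<lambda>t. sqn (step N c t)) \<longleftrightarrow> integrable unit_leb ?F"
    by (rule Bochner_Integration.integrable_cong) (auto simp: sqn_step[OF N])
  ultimately show L: "step N c \<in> L2"
    unfolding L2_iff using step_lie[OF N] step_measurable by blast
  have "(nrm (step N c))\<^sup>2 = (\<integral>t. ?F t \<partial>unit_leb)"
    unfolding nrm_square[OF L] by (rule Bochner_Integration.integral_cong) (auto simp: sqn_step[OF N])
  also have "\<dots> = (\<Sum>i<N. (real N * (\<Sum>b\<in>onb. (c (i, b))\<^sup>2)) / real N)"
    by (subst Bochner_Integration.integral_sum) (auto intro!: integrable_cell sum.cong simp only: integral_cell lessThan_iff)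
  also have "\<dots> = (\<Sum>i<N. \<Sum>b\<in>onb. (c (i, b))\<^sup>2)" using N by simp
  also have "\<dots> = (\<Sum>p\<in>coords N. (c p)\<^sup>2)" by (simp add: sum.cartesian_product)
  finally show "(nrm (step N c))\<^sup>2 = (\<Sum>p\<in>coords N. (c p)\<^sup>2)" .
qed

lemma step_diff: "step N c t - step N c' t = step N (\<lambda>p. c p - c' p) t"
  unfolding step_of_coords_def split_beta' sum_subtractf[symmetric]
  by (intro sum.cong refl) (simp add: algebra_simps)

lemma dst_step_square: "N \<ge> 1 \<Longrightarrow> (dst (step N c) (step N c'))\<^sup>2 = (\<Sum>p\<in>coords N. (c p - c' p)\<^sup>2)"
  unfolding L2_dist_def step_diff by (rule nrm_step_square)

lemma step_AE_value:
  assumes "N \<ge> 1" "i < N"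
  shows "AE t in lebesgue_on (grid_interval N i). step N c t = step_value N c i"
proof -
  have "AE t in lebesgue. t \<notin> {real (Suc i) / real N}"
    by (rule AE_not_in) (simp add: negligible_iff_null_sets[symmetric])
  then have "AE t in lebesgue. t \<in> grid_interval N i \<longrightarrow> step N c t = step_value N c i"
  proof eventually_elim
    case (elim t)
    then show ?case using step_inside[OF assms, of t c] by auto
  qed
  then show ?thesis by (subst AE_restrict_space_iff) auto
qed

lemma V_subset_L2: "V K ip N \<subseteq> L2"
  by (auto simp: V_def)

lemma step_in_V: "N \<ge> 1 \<Longrightarrow> step N c \<in> V K ip N"
  unfolding V_def using step_L2 step_AE_value by blast

text \<open>The constants in the definition of \<open>V\<close> are arbitrary matrices. They lie in
  the Lie algebra because \<open>f\<close> does so at every point and a cell has positive measure.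
  Indices from \<open>N\<close> on receive the value \<open>0\<close>, which makes membership
  unconditional.\<close>

lemma V_values:
  assumes "N \<ge> 1" "f \<in> V K ip N"
  obtains v where "\<And>i. v i \<in> lie"
    "\<And>i. i < N \<Longrightarrow> AE t in lebesgue_on (grid_interval N i). f t = v i"
proof -
  have "\<forall>i\<in>{..<N}. \<exists>c. AE t in lebesgue_on (grid_interval N i). f t = c"
    using assms by (auto simp: V_def)
  from bchoice[OF this] obtain u where
    u: "\<And>i. i < N \<Longrightarrow> AE t in lebesgue_on (grid_interval N i). f t = u i" by auto
  have lie: "u i \<in> lie" if "i < N" for i
  proof (rule ccontr)
    assume n: "u i \<notin> lie"
    let ?I = "(grid_interval N i)"
    have lt: "real i / real N < real (Suc i) / real N" using that by (simp add: divide_strict_right_mono)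
    have "?I \<subseteq> {0..1}"
    proof -
      have "real (Suc i) / real N \<le> 1" using that by (simp add: divide_le_eq)
      moreover have "0 \<le> real i / real N" by simp
      ultimately show ?thesis by (meson atLeastAtMost_iff order_trans subsetI)
    qed
    then have "f t \<noteq> u i" if "t \<in> ?I" for t
      using n that assms(2) L2_lie V_subset_L2 by (metis subsetD)
    then have "AE t in lebesgue_on ?I. False"
      using u[OF that] AE_space[of "lebesgue_on ?I"] by (auto elim: eventually_elim2)
    then have "emeasure (lebesgue_on ?I) (space (lebesgue_on ?I)) = 0"
      unfolding ae_filter_eq_bot_iff[symmetric] trivial_limit_def .
    then have "emeasure lebesgue ?I = 0" by (simp add: emeasure_restrict_space)
    then show False using lt by simp
  qed
  show ?thesis
    by (rule that[of "\<lambda>i. if i < N then u i else 0"])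
      (use u lie subspace_0[OF subspace_lie_algebra] in auto)
qed

text \<open>A single cell already contributes \<open>sqn (v i - v' i) / N\<close> to the squared
  distance. Thus closeness in the mean gives closeness of the values that drive the paths.\<close>

lemma sqn_value_diff_le:
  assumes N: "N \<ge> 1" and "f \<in> L2" "f' \<in> L2" "i < N"
    and v: "\<And>i. i < N \<Longrightarrow> AE t in lebesgue_on (grid_interval N i). f t = v i"
    and v': "\<And>i. i < N \<Longrightarrow> AE t in lebesgue_on (grid_interval N i). f' t = v' i"
  shows "sqn (v i - v' i) \<le> real N * (dst f f')\<^sup>2"
proof -
  note L = L2_diff[OF assms(2,3)]
  have "(\<integral>t. sqn (v i - v' i) * indicator (grid_cell N i) t \<partial>unit_leb)
      \<le> (\<integral>t. sqn (f t - f' t) \<partial>unit_leb)"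
  proof (rule integral_mono_AE[OF integrable_cell[OF \<open>i < N\<close>]])
    show "integrable unit_leb (\<lambda>t. sqn (f t - f' t))" using L by (simp add: L2_iff)
    have "AE t in unit_leb. \<exists>j<N. real j / real N < t \<and> t < real (Suc j) / real N \<and> f t - f' t = v j - v' j"
    proof (rule AE_grid_values[OF N])
      fix j assume "j < N"
      from v[OF this] v'[OF this]
      show "AE t in lebesgue_on (grid_interval N j). f t - f' t = v j - v' j"
        by eventually_elim simp
    qed
    then show "AE t in unit_leb. sqn (v i - v' i) * indicator (grid_cell N i) t \<le> sqn (f t - f' t)"
    proof eventually_elim
      case (elim t)
      then obtain j where j: "j < N" "real j / real N < t" "t < real (Suc j) / real N" "f t - f' t = v j - v' j"
        by blast
      have t: "t \<ge> 0" using j(2) by (rule order_trans[OF _ less_imp_le, rotated]) simp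
      show ?case
      proof (cases "t \<in> grid_cell N i")
        case True
        then have "i = j" using grid_cell_iff[OF N t, of i] grid_cell_iff[OF N t, of j] j(2,3) by auto
        then show ?thesis using j(4) by (simp add: indicator_def sqn_nonneg)
      next
        case False
        then show ?thesis by (auto simp: indicator_def sqn_nonneg)
      qed
    qed
  qed
  then have "sqn (v i - v' i) / real N \<le> (dst f f')\<^sup>2"
    unfolding integral_cell[OF \<open>i < N\<close>] L2_dist_def nrm_square[OF L] .
  then show ?thesis using N by (simp add: field_simps)
qed

section \<open>The adjoint action along paths, and continuity of the group law on step
  functions\<close>

lemma sqn_Ad:
  assumes "u \<in> K" "x \<in> lie"
  shows "sqn (Ad u x) = sqn x"
  using ip_Ad assms ip_self[OF Ad_lie[OF assms]] ip_self[OF assms(2)] unfolding Ad_invariant_def by metis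

text \<open>Telescope \<open>u ** x ** transpose u\<close>. The constant collects the bound of
  matrix multiplication and the equivalence of \<open>ip\<close> and the Frobenius norm on the
  finite-dimensional Lie algebra.\<close>

lemma sqn_Ad_diff:
  "\<exists>C\<ge>0. \<forall>u\<in>K. \<forall>v\<in>K. \<forall>x\<in>lie. sqn (Ad u x - Ad v x) \<le> (C * norm (u - v))\<^sup>2 * sqn x"
proof -
  obtain C1 where C1: "C1 \<ge> 0" "\<And>x. x \<in> lie \<Longrightarrow> norm x \<le> C1 * sqrt (sqn x)"
    using norm_le_sqn by auto
  obtain C2 where C2: "C2 \<ge> 0" "\<And>x. sqrt (sqn x) \<le> C2 * norm x"
    using sqn_le_norm by auto
  obtain k where k: "k > 0" "\<And>(a :: real^'n^'n) (b :: real^'n^'n). norm (a ** b) \<le> norm a * norm b * k"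
    using mm.pos_bounded[where 'n='n] by auto
  show ?thesis
  proof (intro exI[of _ "C2 * (2 * k * C1)"] conjI ballI)
    show "C2 * (2 * k * C1) \<ge> 0" using C1 C2 k by auto
    fix u v x assume u: "u \<in> K" and v: "v \<in> K" and x: "x \<in> lie"
    have "Ad u x - Ad v x = ((u - v) ** x) ** transpose u + v ** (x ** transpose (u - v))"
      using linear_diff[OF bounded_linear.linear[OF bounded_linear_transpose], of u v]
      by (simp add: Ad_eq u v mm.diff_left mm.diff_right matrix_mul_assoc)
    also have "norm \<dots> \<le> norm ((u - v) ** x) + norm (x ** transpose (u - v))"
      using norm_triangle_ineq[of "((u - v) ** x) ** transpose u" "v ** (x ** transpose (u - v))"]
        norm_orthogonal_mult_right[of "transpose u"] norm_orthogonal_mult_left[of v]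
        K_orthogonal[OF u] K_orthogonal[OF v] by (simp add: orthogonal_matrix_transpose)
    also have "\<dots> \<le> 2 * k * norm (u - v) * norm x"
      using k(2)[of "u - v" x] k(2)[of x "transpose (u - v)"] by (simp add: norm_transpose mult_ac)
    also have "\<dots> \<le> 2 * k * norm (u - v) * (C1 * sqrt (sqn x))"
      using C1(2)[OF x] k(1) by (intro mult_left_mono) auto
    finally have n: "norm (Ad u x - Ad v x) \<le> 2 * k * norm (u - v) * (C1 * sqrt (sqn x))" .
    have "sqrt (sqn (Ad u x - Ad v x)) \<le> C2 * norm (Ad u x - Ad v x)" by (rule C2)
    also have "\<dots> \<le> C2 * (2 * k * norm (u - v) * (C1 * sqrt (sqn x)))"
      using n C2(1) by (rule mult_left_mono)
    also have "\<dots> = C2 * (2 * k * C1) * norm (u - v) * sqrt (sqn x)" by (simp only: mult_ac)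
    finally have "(sqrt (sqn (Ad u x - Ad v x)))\<^sup>2 \<le> (C2 * (2 * k * C1) * norm (u - v) * sqrt (sqn x))\<^sup>2"
      by (rule power_mono) (simp add: sqn_nonneg)
    then show "sqn (Ad u x - Ad v x) \<le> (C2 * (2 * k * C1) * norm (u - v))\<^sup>2 * sqn x"
      by (simp add: sqn_nonneg power_mult_distrib)
  qed
qed

text \<open>On \<open>K\<close> the inverse is the transpose, so \<open>Ad\<close> is given by a
  continuous expression in its arguments.\<close>

lemma Ad_path_measurable:
  assumes r: "r \<in> borel_measurable unit_leb" "\<And>t. t \<in> {0..1} \<Longrightarrow> r t \<in> K" and g: "g \<in> borel_measurable unit_leb"
  shows "(\<lambda>t. Ad (r t) (g t)) \<in> borel_measurable unit_leb"
proof -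
  have mult: "(\<lambda>t. A t ** B t) \<in> borel_measurable unit_leb"
    if "A \<in> borel_measurable unit_leb" "B \<in> borel_measurable unit_leb" for A B :: "real \<Rightarrow> real^'n^'n"
    using that by (rule borel_measurable_continuous_Pair)
      (intro mm.continuous_on continuous_on_fst continuous_on_snd continuous_on_id)
  have "(\<lambda>t. transpose (r t)) \<in> borel_measurable unit_leb"
    using r(1) by (rule measurable_compose)
      (intro borel_measurable_continuous_onI linear_continuous_on bounded_linear_transpose)
  then have "(\<lambda>t. r t ** g t ** transpose (r t)) \<in> borel_measurable unit_leb"
    using r(1) g by (intro mult)
  moreover have "(\<lambda>t. Ad (r t) (g t)) \<in> borel_measurable unit_leb \<longleftrightarrow>
      (\<lambda>t. r t ** g t ** transpose (r t)) \<in> borel_measurable unit_leb"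
    by (rule measurable_cong) (use r(2) in \<open>auto simp: Ad_eq\<close>)
  ultimately show ?thesis by simp
qed

text \<open>By \<open>Ad\<close>-invariance, twisting by any path in \<open>K\<close> preserves
  pointwise lengths; the discretization error of \<open>g\<close> is therefore not enlarged by the
  path.\<close>

lemma Ad_path_L2:
  assumes r: "r \<in> borel_measurable unit_leb" "\<And>t. t \<in> {0..1} \<Longrightarrow> r t \<in> K" and g: "g \<in> L2"
  shows "(\<lambda>t. Ad (r t) (g t)) \<in> L2" "nrm (\<lambda>t. Ad (r t) (g t)) \<le> nrm g"
proof -
  have "AE t in unit_leb. sqn (Ad (r t) (g t)) \<le> 1\<^sup>2 * sqn (g t)"
    by (rule AE_I2) (use r(2) L2_lie[OF g] sqn_Ad in auto)
  from L2_dominated[OF _ Ad_path_measurable[OF r L2_measurable[OF g]] g _ this]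
  show "(\<lambda>t. Ad (r t) (g t)) \<in> L2" "nrm (\<lambda>t. Ad (r t) (g t)) \<le> nrm g"
    using r(2) L2_lie[OF g] Ad_lie by auto
qed

lemma step_path_measurable:
  assumes "\<And>i. i < k \<Longrightarrow> skew (c i)"
  shows "step_path N c k \<in> borel_measurable unit_leb"
proof -
  let ?L = "\<Sum>i<k. norm (c i)"
  have "?L-lipschitz_on {0..1} (step_path N c k)"
    using step_path_lipschitz[of k c N] assms
    by (intro lipschitz_onI) (auto simp: dist_norm intro: sum_nonneg)
  then have "continuous_on {0..1} (step_path N c k)" by (rule lipschitz_on_continuous_on)
  then show ?thesis by (rule continuous_imp_measurable_on_sets_lebesgue) simp
qed

lemma group_law_V:
  assumes N: "N \<ge> 1" and f: "f \<in> L2" and v: "\<And>i. v i \<in> lie"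
    "\<And>i. i < N \<Longrightarrow> AE t in lebesgue_on (grid_interval N i). f t = v i"
    and g: "g \<in> L2"
  shows "group_law K f g \<in> L2"
    and "\<And>t. t \<in> {0..1} \<Longrightarrow> group_law K f g t = f t + Ad (step_path N v N t) (g t)"
    and "(\<lambda>t. Ad (step_path N v N t) (g t)) \<in> L2"
proof -
  have pi: "prod_integral K f = restrict (step_path N v N) {0..1}"
    by (rule prod_integral_eq_step_path[OF N v(1) v(2)])
  show eq: "group_law K f g t = f t + Ad (step_path N v N t) (g t)" if "t \<in> {0..1}" for t
    using that by (simp add: group_law_def pi)
  have sp: "step_path N v N \<in> borel_measurable unit_leb" "\<And>t. step_path N v N t \<in> K"
    using v(1) lie_skew by (auto intro: step_path_measurable step_path_in_K)
  show A: "(\<lambda>t. Ad (step_path N v N t) (g t)) \<in> L2"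
    by (rule Ad_path_L2(1)[OF sp g])
  have "(\<lambda>t. f t + Ad (step_path N v N t) (g t)) \<in> L2" by (rule L2_add[OF f A])
  moreover have "group_law K f g \<in> borel_measurable unit_leb \<longleftrightarrow>
      (\<lambda>t. f t + Ad (step_path N v N t) (g t)) \<in> borel_measurable unit_leb"
    by (rule measurable_cong) (simp add: eq)
  moreover have "integrable unit_leb (\<lambda>t. sqn (group_law K f g t)) \<longleftrightarrow>
      integrable unit_leb (\<lambda>t. sqn (f t + Ad (step_path N v N t) (g t)))"
    by (rule Bochner_Integration.integrable_cong) (simp_all add: eq)
  ultimately show "group_law K f g \<in> L2" by (auto simp: L2_iff eq)
qed

lemma nrm_cong:
  assumes "\<And>t. t \<in> {0..1} \<Longrightarrow> f t = h t"
  shows "nrm f = nrm h"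
  unfolding L2_norm_def using assms
  by (intro arg_cong[of _ _ sqrt] Bochner_Integration.integral_cong) auto

text \<open>The constant grows like \<open>sqrt N\<close>, coming from the passage from distances to
  values on cells. This is good enough, as only measurability for each fixed \<open>N\<close> is
  drawn from it.\<close>

lemma group_law_lipschitz:
  assumes N: "N \<ge> 1" and g: "g \<in> L2"
  shows "\<exists>L\<ge>0. \<forall>f\<in>V K ip N. \<forall>h\<in>V K ip N. dst (group_law K f g) (group_law K h g) \<le> L * dst f h"
proof -
  obtain C1 where C1: "C1 \<ge> 0" "\<And>x. x \<in> lie \<Longrightarrow> norm x \<le> C1 * sqrt (sqn x)"
    using norm_le_sqn by auto
  obtain C where C: "C \<ge> 0"
    "\<And>u v x. u \<in> K \<Longrightarrow> v \<in> K \<Longrightarrow> x \<in> lie \<Longrightarrow> sqn (Ad u x - Ad v x) \<le> (C * norm (u - v))\<^sup>2 * sqn x"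
    using sqn_Ad_diff by auto
  define L where "L = 1 + C * (C1 * sqrt N) * nrm g"
  have "L \<ge> 0" using C C1 nrm_nonneg[OF g] by (simp add: L_def)
  moreover have "dst (group_law K f g) (group_law K h g) \<le> L * dst f h"
    if fV: "f \<in> V K ip N" and hV: "h \<in> V K ip N" for f h
  proof -
    have f: "f \<in> L2" and h: "h \<in> L2" using fV hV V_subset_L2 by auto
    obtain v where v: "\<And>i. v i \<in> lie"
      "\<And>i. i < N \<Longrightarrow> AE t in lebesgue_on (grid_interval N i). f t = v i"
      using V_values[OF N fV] by blast
    obtain w where w: "\<And>i. w i \<in> lie"
      "\<And>i. i < N \<Longrightarrow> AE t in lebesgue_on (grid_interval N i). h t = w i"
      using V_values[OF N hV] by blast
    note F = group_law_V[OF N f v g] and H = group_law_V[OF N h w g]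
    define A where "A t = Ad (step_path N v N t) (g t)" for t
    define B where "B t = Ad (step_path N w N t) (g t)" for t
    have AB: "A \<in> L2" "B \<in> L2" using F(3) H(3) by (auto simp: A_def[abs_def] B_def[abs_def])
    define D where "D = C1 * sqrt N * dst f h"
    have D0: "D \<ge> 0" using C1 dst_nonneg[OF f h] by (simp add: D_def)
    have "norm (v i - w i) \<le> D" if "i < N" for i
    proof -
      have "sqn (v i - w i) \<le> real N * (dst f h)\<^sup>2"
        by (rule sqn_value_diff_le[OF N f h that v(2) w(2)])
      then have "sqrt (sqn (v i - w i)) \<le> sqrt (real N * (dst f h)\<^sup>2)" by (rule real_sqrt_le_mono)
      also have "\<dots> = sqrt N * dst f h" using dst_nonneg[OF f h] by (simp add: real_sqrt_mult)
      finally have "C1 * sqrt (sqn (v i - w i)) \<le> C1 * (sqrt N * dst f h)"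
        using C1(1) by (rule mult_left_mono)
      moreover have "norm (v i - w i) \<le> C1 * sqrt (sqn (v i - w i))"
        by (intro C1(2) subspace_diff[OF subspace_lie_algebra] v w)
      ultimately show ?thesis by (simp add: D_def mult.assoc)
    qed
    then have "(\<Sum>i<N. norm (v i - w i)) \<le> (\<Sum>i<N. D)" by (intro sum_mono) auto
    then have sD: "(\<Sum>i<N. norm (v i - w i)) / N \<le> D" using N by (simp add: pos_divide_le_eq mult.commute)
    have pd: "norm (step_path N v N t - step_path N w N t) \<le> D" for t
      using step_path_diff_le[of N v w N t] v(1) w(1) lie_skew sD by force
    have "nrm (\<lambda>t. A t - B t) \<le> (C * D) * nrm g"
    proof (rule L2_dominated(2)[OF _ _ g])
      show "A t - B t \<in> lie" if "t \<in> {0..1}" for t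
        using L2_lie[OF L2_diff[OF AB] that] .
      show "(\<lambda>t. A t - B t) \<in> borel_measurable unit_leb" by (rule L2_measurable[OF L2_diff[OF AB]])
      show "C * D \<ge> 0" using C D0 by simp
      show "AE t in unit_leb. sqn (A t - B t) \<le> (C * D)\<^sup>2 * sqn (g t)"
      proof (rule AE_I2)
        fix t assume "t \<in> space unit_leb"
        then have gt: "g t \<in> lie" using L2_lie[OF g] by simp
        have "sqn (A t - B t) \<le> (C * norm (step_path N v N t - step_path N w N t))\<^sup>2 * sqn (g t)"
          unfolding A_def B_def by (intro C gt step_path_in_K v w)
        also have "\<dots> \<le> (C * D)\<^sup>2 * sqn (g t)"
          using pd[of t] C(1) by (intro mult_right_mono power_mono mult_left_mono) (auto simp: sqn_nonneg)
        finally show "sqn (A t - B t) \<le> (C * D)\<^sup>2 * sqn (g t)" .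
      qed
    qed
    moreover have "dst (group_law K f g) (group_law K h g) = nrm (\<lambda>t. (f t - h t) + (A t - B t))"
      unfolding L2_dist_def by (rule nrm_cong) (simp add: F(2) H(2) A_def B_def)
    moreover have "\<dots> \<le> dst f h + nrm (\<lambda>t. A t - B t)"
      unfolding L2_dist_def by (rule nrm_triangle[OF L2_diff[OF f h] L2_diff[OF AB]])
    ultimately show ?thesis by (simp add: L_def D_def algebra_simps)
  qed
  ultimately show ?thesis by blast
qed

lemma group_law_measurable:
  assumes N: "N \<ge> 1" and g: "g \<in> L2"
  shows "(\<lambda>f. group_law K f g) \<in> measurable (V_borel N) L2_meas"
proof (rule measurable_restrict_L2_borel[OF V_subset_L2])
  fix f assume f: "f \<in> V K ip N"
  obtain v where "\<And>i. v i \<in> lie"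
      "\<And>i. i < N \<Longrightarrow> AE t in lebesgue_on (grid_interval N i). f t = v i"
    using V_values[OF N f] by blast
  then show "group_law K f g \<in> L2" using group_law_V(1)[OF N _ _ _ g] f V_subset_L2 by blast
next
  fix f and e :: real assume f: "f \<in> V K ip N" and "e > 0"
  obtain L where L: "L \<ge> 0"
    "\<forall>f\<in>V K ip N. \<forall>h\<in>V K ip N. dst (group_law K f g) (group_law K h g) \<le> L * dst f h"
    using group_law_lipschitz[OF N g] by blast
  show "\<exists>d>0. \<forall>h\<in>V K ip N. dst f h < d \<longrightarrow> dst (group_law K f g) (group_law K h g) < e"
  proof (intro exI[of _ "e / (L + 1)"] conjI ballI impI)
    show "e / (L + 1) > 0" using L \<open>e > 0\<close> by simp
    fix h assume h: "h \<in> V K ip N" and d: "dst f h < e / (L + 1)"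
    have "dst (group_law K f g) (group_law K h g) \<le> L * dst f h" using L f h by blast
    also have "\<dots> \<le> L * (e / (L + 1))" using d L(1) by (intro mult_left_mono) auto
    also have "\<dots> < e" using L(1) \<open>e > 0\<close> by (simp add: field_simps)
    finally show "dst (group_law K f g) (group_law K h g) < e" .
  qed
qed

lemma step_borel_measurable:
  assumes N: "N \<ge> 1"
  shows "step N \<in> measurable (cspace N) (V_borel N)"
proof (rule measurable_restrict_space2)
  show "step N \<in> space (cspace N) \<rightarrow> V K ip N" using step_in_V[OF N] by simp
  show "step N \<in> measurable (cspace N) L2_meas"
  proof (rule measurable_L2_borel)
    fix U assume U: "L2_open U"
    show "step N -` U \<inter> space (cspace N) \<in> sets (cspace N)"
    proof (rule open_in_coordinates_measurable[OF finite_coords])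
      show "step N -` U \<inter> space (cspace N) \<subseteq> extensional (coords N)"
        by (auto simp: space_lborel_pow)
      fix c assume c: "c \<in> step N -` U \<inter> space (cspace N)"
      then obtain e where e: "e > 0" "\<And>h. h \<in> L2 \<Longrightarrow> dst (step N c) h < e \<Longrightarrow> h \<in> U"
        using U unfolding L2_open_def by blast
      \<comment> \<open>One more than the number of coordinates, so that the sum of
        \<open>k - 1\<close> terms \<open>e / k\<close> is strictly below \<open>e\<close>, even
        when the Lie algebra is trivial and there are no coordinates.\<close>
      define k where "k = real (card (coords N)) + 1"
      have "k > 0" by (simp add: k_def)
      show "\<exists>d>0. \<forall>c'\<in>extensional (coords N). (\<forall>p\<in>coords N. \<bar>c' p - c p\<bar> < d) \<longrightarrow>
          c' \<in> step N -` U \<inter> space (cspace N)"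
      proof (intro exI[of _ "e / k"] conjI ballI impI)
        show "e / k > 0" using e \<open>k > 0\<close> by simp
        fix c' assume c': "c' \<in> extensional (coords N)" "\<forall>p\<in>coords N. \<bar>c' p - c p\<bar> < e / k"
        have "dst (step N c) (step N c') = sqrt (\<Sum>p\<in>coords N. (c p - c' p)\<^sup>2)"
          using dst_step_square[OF N, of c c'] dst_nonneg[OF step_L2[OF N] step_L2[OF N], of c c']
          by (metis real_sqrt_abs abs_of_nonneg)
        also have "\<dots> \<le> (\<Sum>p\<in>coords N. \<bar>c p - c' p\<bar>)"
          using L2_set_le_sum_abs[of "\<lambda>p. c p - c' p" "coords N"] by (simp add: L2_set_def)
        also have "\<dots> \<le> (\<Sum>p\<in>coords N. e / k)"
          using c'(2) by (intro sum_mono) (auto simp: abs_minus_commute less_imp_le)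
        also have "\<dots> = (k - 1) * (e / k)" by (simp add: k_def)
        also have "\<dots> < e" using e(1) \<open>k > 0\<close> by (simp add: field_simps)
        finally have "step N c' \<in> U" by (intro e step_L2[OF N])
        then show "c' \<in> step N -` U \<inter> space (cspace N)"
          using c'(1) by (simp add: space_lborel_pow)
      qed
    qed
  qed (rule step_L2[OF N])
qed

end

section \<open>The coupling\<close>

lemma lipschitz_in_coordinates_measurable:
  fixes F :: "('a \<Rightarrow> real) \<Rightarrow> 'b::real_normed_vector"
  assumes I: "finite I"
    and F: "\<And>c c' d. c \<in> extensional I \<Longrightarrow> c' \<in> extensional I \<Longrightarrow> (\<And>p. p \<in> I \<Longrightarrow> \<bar>c' p - c p\<bar> \<le> d)
      \<Longrightarrow> d \<ge> 0 \<Longrightarrow> norm (F c' - F c) \<le> Q * d"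
    and Q: "Q \<ge> 0"
  shows "F \<in> borel_measurable (lborel_pow I)"
proof (rule borel_measurableI)
  fix S :: "'b set" assume "open S"
  show "F -` S \<inter> space (lborel_pow I) \<in> sets (lborel_pow I)"
  proof (rule open_in_coordinates_measurable[OF I])
    show "F -` S \<inter> space (lborel_pow I) \<subseteq> extensional I" by (auto simp: space_lborel_pow)
    fix c assume c: "c \<in> F -` S \<inter> space (lborel_pow I)"
    then obtain e where e: "e > 0" "\<And>y. dist y (F c) < e \<Longrightarrow> y \<in> S"
      using \<open>open S\<close> unfolding open_dist by blast
    show "\<exists>d>0. \<forall>c'\<in>extensional I. (\<forall>p\<in>I. \<bar>c' p - c p\<bar> < d) \<longrightarrow> c' \<in> F -` S \<inter> space (lborel_pow I)"
    proof (intro exI[of _ "e / (Q + 1)"] conjI ballI impI)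
      show pos: "e / (Q + 1) > 0" using e Q by simp
      fix c' assume c': "c' \<in> extensional I" "\<forall>p\<in>I. \<bar>c' p - c p\<bar> < e / (Q + 1)"
      have "norm (F c' - F c) \<le> Q * (e / (Q + 1))"
        by (rule F) (use c c' pos in \<open>auto simp: space_lborel_pow intro: less_imp_le\<close>)
      also have "\<dots> < e" using e Q by (simp add: field_simps)
      finally show "c' \<in> F -` S \<inter> space (lborel_pow I)"
        using e(2) c' by (auto simp: dist_norm space_lborel_pow)
    qed
  qed
qed

text \<open>Conditioning commutes with push-forward; this moves \<open>nu\<close> back to coordinate
  space.\<close>

lemma uniform_measure_distr:
  assumes f: "f \<in> measurable M N" and A: "A \<in> sets N"
  shows "uniform_measure (distr M N f) A = distr (uniform_measure M (f -` A \<inter> space M)) N f"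
proof (rule measure_eqI)
  fix B assume "B \<in> sets (uniform_measure (distr M N f) A)"
  then have B: "B \<in> sets N" by simp
  have f': "f \<in> measurable (uniform_measure M (f -` A \<inter> space M)) N"
    using f by (simp add: measurable_cong_sets[OF sets_uniform_measure refl])
  have "f -` (A \<inter> B) \<inter> space M = (f -` A \<inter> space M) \<inter> (f -` B \<inter> space M)" by auto
  then show "emeasure (uniform_measure (distr M N f) A) B
      = emeasure (distr (uniform_measure M (f -` A \<inter> space M)) N f) B"
    using A B f f' by (simp add: emeasure_distr measurable_sets)
qed simp

text \<open>The integral is a supremum over simple functions below \<open>f\<close>, and each of
  these pulls back along \<open>T\<close>. In this form the inequality applies to the transport cost
  without deciding its measurability for the product sigma-algebra.\<close>

lemma nn_integral_distr_le:
  assumes T: "T \<in> measurable M N"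
  shows "(\<integral>\<^sup>+x. f x \<partial>distr M N T) \<le> (\<integral>\<^sup>+x. f (T x) \<partial>M)"
  unfolding nn_integral_def[of "distr M N T"]
proof (rule SUP_least, clarify)
  fix g assume g: "simple_function (distr M N T) g" "g \<le> f"
  have "integral\<^sup>S (distr M N T) g = (\<integral>\<^sup>+x. g x \<partial>distr M N T)"
    by (rule nn_integral_eq_simple_integral[OF g(1), symmetric])
  also have "\<dots> = (\<integral>\<^sup>+x. g (T x) \<partial>M)"
    using borel_measurable_simple_function[OF g(1)] by (intro nn_integral_distr T) simp
  also have "\<dots> \<le> (\<integral>\<^sup>+x. f (T x) \<partial>M)"
    using g(2) by (intro nn_integral_mono) (auto simp: le_fun_def)
  finally show "integral\<^sup>S (distr M N T) g \<le> (\<integral>\<^sup>+x. f (T x) \<partial>M)" .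
qed

lemma distr_fst_pair:
  assumes "sigma_finite_measure \<kappa>" "emeasure \<kappa> (space \<kappa>) = 1"
  shows "distr (\<mu> \<Otimes>\<^sub>M \<kappa>) \<mu> fst = \<mu>"
proof (rule measure_eqI)
  interpret sigma_finite_measure \<kappa> by fact
  fix A assume "A \<in> sets (distr (\<mu> \<Otimes>\<^sub>M \<kappa>) \<mu> fst)"
  then have A: "A \<in> sets \<mu>" by simp
  have "fst -` A \<inter> space (\<mu> \<Otimes>\<^sub>M \<kappa>) = A \<times> space \<kappa>"
    using sets.sets_into_space[OF A] by (auto simp: space_pair_measure)
  then show "emeasure (distr (\<mu> \<Otimes>\<^sub>M \<kappa>) \<mu> fst) A = emeasure \<mu> A"
    using A assms(2) by (simp add: emeasure_distr emeasure_pair_measure_Times)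
qed simp

context path_space
begin

section \<open>Lipschitz functions and the transport distance\<close>

lemma bounded_1_Lipschitz_measurable:
  assumes F: "F \<in> bounded_1_Lipschitz K ip"
  shows "F \<in> borel_measurable L2_meas"
proof (rule borel_measurableI)
  fix S :: "real set" assume S: "open S"
  have "L2_open (F -` S \<inter> L2)"
    unfolding L2_open_def
  proof (intro conjI ballI)
    fix f assume f: "f \<in> F -` S \<inter> L2"
    then obtain e where e: "e > 0" "\<And>y. dist y (F f) < e \<Longrightarrow> y \<in> S"
      using S unfolding open_dist by blast
    show "\<exists>e>0. \<forall>h\<in>L2. dst f h < e \<longrightarrow> h \<in> F -` S \<inter> L2"
    proof (intro exI[of _ e] conjI ballI impI)
      fix h assume h: "h \<in> L2" "dst f h < e"
      have "\<bar>F f - F h\<bar> \<le> dst f h" using F f h by (auto simp: bounded_1_Lipschitz_def)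
      then have "F h \<in> S" using h by (intro e(2)) (simp add: dist_real_def abs_minus_commute)
      then show "h \<in> F -` S \<inter> L2" using h by simp
    qed (rule e)
  qed auto
  then show "F -` S \<inter> space L2_meas \<in> sets L2_meas"
    using L2_open_sets by (simp add: space_L2_borel)
qed

text \<open>The easy half of Kantorovich duality. The factor \<open>1 / 2\<close> arises because
  \<open>\<bar>F x - F y\<bar>\<close> may reach \<open>2\<close>, while the metric is truncated at
  \<open>1\<close>.\<close>

lemma Lipschitz_integral_diff_le_MK_dist:
  assumes F: "F \<in> bounded_1_Lipschitz K ip"
    and sets: "sets \<mu> = sets L2_meas" "sets \<mu>' = sets L2_meas"
    and one: "emeasure \<mu> (space \<mu>) = 1"
  shows "ennreal (\<bar>(\<integral>f. F f \<partial>\<mu>) - (\<integral>f. F f \<partial>\<mu>')\<bar> / 2) \<le> MK_dist (\<lambda>f h. min (dst f h) 1) \<mu> \<mu>'"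
  unfolding MK_dist_def
proof (rule INF_greatest)
  fix \<gamma> assume "\<gamma> \<in> couplings \<mu> \<mu>'"
  then have \<gamma>: "sets \<gamma> = sets (\<mu> \<Otimes>\<^sub>M \<mu>')" "distr \<gamma> \<mu> fst = \<mu>" "distr \<gamma> \<mu>' snd = \<mu>'"
    by (auto simp: couplings_def)
  have sp: "space \<mu> = L2" "space \<mu>' = L2" "space \<gamma> = L2 \<times> L2"
    using sets_eq_imp_space_eq[OF \<gamma>(1)] sets_eq_imp_space_eq[OF sets(1)] sets_eq_imp_space_eq[OF sets(2)]
    by (auto simp: space_pair_measure space_L2_borel)
  have fst_m: "fst \<in> measurable \<gamma> \<mu>" and snd_m: "snd \<in> measurable \<gamma> \<mu>'"
    using measurable_fst[of \<mu> \<mu>'] measurable_snd[of \<mu> \<mu>']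
    by (simp_all only: measurable_cong_sets[OF \<gamma>(1) refl])
  have Fm: "F \<in> borel_measurable \<mu>" "F \<in> borel_measurable \<mu>'"
    using bounded_1_Lipschitz_measurable[OF F]
    by (simp_all only: measurable_cong_sets[OF sets(1) refl] measurable_cong_sets[OF sets(2) refl])
  have "emeasure \<gamma> (space \<gamma>) = 1"
  proof -
    have "emeasure (distr \<gamma> \<mu> fst) (space \<mu>) = emeasure \<gamma> (space \<gamma>)"
      using measurable_space[OF fst_m] by (subst emeasure_distr[OF fst_m]) (auto intro!: arg_cong[of _ _ "emeasure \<gamma>"])
    then show ?thesis using \<gamma>(2) one by simp
  qed
  then have fin: "finite_measure \<gamma>" by (intro finite_measureI) simp
  have Fb: "\<bar>F f\<bar> \<le> 1" if "f \<in> L2" for f using F that by (auto simp: bounded_1_Lipschitz_def)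
  have m1: "(\<lambda>w. F (fst w)) \<in> borel_measurable \<gamma>" and m2: "(\<lambda>w. F (snd w)) \<in> borel_measurable \<gamma>"
    using measurable_compose[OF fst_m Fm(1)] measurable_compose[OF snd_m Fm(2)] by auto
  have i1: "integrable \<gamma> (\<lambda>w. F (fst w))" and i2: "integrable \<gamma> (\<lambda>w. F (snd w))"
    by (rule finite_measure.integrable_const_bound[OF fin, of _ 1], use Fb sp m1 m2 in auto)+
  have "(\<integral>f. F f \<partial>\<mu>) = (\<integral>w. F (fst w) \<partial>\<gamma>)" using integral_distr[OF fst_m Fm(1)] \<gamma>(2) by simp
  moreover have "(\<integral>f. F f \<partial>\<mu>') = (\<integral>w. F (snd w) \<partial>\<gamma>)" using integral_distr[OF snd_m Fm(2)] \<gamma>(3) by simp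
  ultimately have "((\<integral>f. F f \<partial>\<mu>) - (\<integral>f. F f \<partial>\<mu>')) / 2 = (\<integral>w. (F (fst w) - F (snd w)) / 2 \<partial>\<gamma>)"
    using i1 i2 by simp
  moreover have "ennreal (norm (\<integral>w. (F (fst w) - F (snd w)) / 2 \<partial>\<gamma>))
      \<le> (\<integral>\<^sup>+w. ennreal (norm ((F (fst w) - F (snd w)) / 2)) \<partial>\<gamma>)"
    using i1 i2 by (intro integral_norm_bound_ennreal) auto
  moreover have "\<bar>(\<integral>f. F f \<partial>\<mu>) - (\<integral>f. F f \<partial>\<mu>')\<bar> / 2 = norm (((\<integral>f. F f \<partial>\<mu>) - (\<integral>f. F f \<partial>\<mu>')) / 2)"
    by simp
  ultimately have "ennreal (\<bar>(\<integral>f. F f \<partial>\<mu>) - (\<integral>f. F f \<partial>\<mu>')\<bar> / 2)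
      \<le> (\<integral>\<^sup>+w. ennreal (norm ((F (fst w) - F (snd w)) / 2)) \<partial>\<gamma>)"
    by (simp only:)
  also have "\<dots> \<le> (\<integral>\<^sup>+(x, y). ennreal (min (dst x y) 1) \<partial>\<gamma>)"
  proof (rule nn_integral_mono)
    fix w assume "w \<in> space \<gamma>"
    then obtain x y where w: "w = (x, y)" and x: "x \<in> L2" and y: "y \<in> L2" using sp by auto
    have "\<bar>F x - F y\<bar> \<le> dst x y" using F x y by (auto simp: bounded_1_Lipschitz_def)
    then have "\<bar>F x - F y\<bar> / 2 \<le> min (dst x y) 1"
      using Fb[OF x] Fb[OF y] by (auto simp: min_def)
    then show "ennreal (norm ((F (fst w) - F (snd w)) / 2)) \<le> (case w of (x, y) \<Rightarrow> ennreal (min (dst x y) 1))"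
      by (simp add: w ennreal_leI)
  qed
  finally show "ennreal (\<bar>(\<integral>f. F f \<partial>\<mu>) - (\<integral>f. F f \<partial>\<mu>')\<bar> / 2) \<le> (\<integral>\<^sup>+(x, y). ennreal (min (dst x y) 1) \<partial>\<gamma>)" .
qed

definition coord_uniform :: "nat \<Rightarrow> real \<Rightarrow> (nat \<times> (real^'n^'n) \<Rightarrow> real) measure" where
  "coord_uniform N r = uniform_measure (cspace N) (cdisc N r)"

lemma step_in_ball_iff:
  assumes "N \<ge> 1" "r > 0"
  shows "nrm (step N c) \<le> r \<longleftrightarrow> (\<Sum>p\<in>coords N. (c p)\<^sup>2) \<le> r\<^sup>2"
  using nrm_step_square[OF assms(1), of c] nrm_nonneg[OF step_L2[OF assms(1)], of c] assms(2)
  by (metis abs_le_square_iff abs_of_nonneg less_imp_le)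

text \<open>From here on the probability space is the Euclidean ball of coordinates:
  \<open>step N\<close> is isometric, so the ball of \<open>V\<close> pulls back to it.\<close>

lemma nu_eq:
  assumes N: "N \<ge> 1" and r: "r > 0"
  shows "nu K ip N r = distr (coord_uniform N r) (V_borel N) (step N)"
proof -
  let ?V = "V_borel N"
  have leb: "lebesgue_V K ip N = distr (cspace N) ?V (step N)"
    unfolding lebesgue_V_def Let_def onb_def ..
  have A: "{f \<in> V K ip N. nrm f \<le> r} \<in> sets ?V"
  proof -
    have "{f \<in> V K ip N. nrm f \<le> r} = V K ip N \<inter> {f \<in> L2. nrm f \<le> r}" using V_subset_L2 by auto
    then show ?thesis using nrm_ball_sets by (auto simp: sets_restrict_space)
  qed
  have "step N -` {f \<in> V K ip N. nrm f \<le> r} \<inter> space (cspace N) = cdisc N r"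
    using step_in_V[OF N] step_in_ball_iff[OF N r] by (auto simp: coord_ball_def)
  then show ?thesis
    unfolding nu_def leb uniform_measure_distr[OF step_borel_measurable[OF N] A] coord_uniform_def by simp
qed

lemma step_uniform_measurable:
  assumes "N \<ge> 1"
  shows "step N \<in> measurable (coord_uniform N r) (V_borel N)"
  using step_borel_measurable[OF assms] unfolding coord_uniform_def
  by (simp only: measurable_cong_sets[OF sets_uniform_measure refl])

lemma nu_L2_eq:
  assumes N: "N \<ge> 1" and r: "r > 0"
  shows "nu_L2 K ip N r = distr (coord_uniform N r) L2_meas (step N)"
proof -
  have "(\<lambda>f. f) \<in> measurable (V_borel N) L2_meas"
    by (intro measurable_restrict_space1) simp
  from distr_distr[OF this step_uniform_measurable[OF N]] show ?thesis
    unfolding nu_L2_def nu_eq[OF N r] by (simp add: o_def)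
qed

lemma nu_mult_eq:
  assumes N: "N \<ge> 1" and r: "r > 0" and g: "g \<in> L2"
  shows "nu_mult K ip N r g = distr (coord_uniform N r) L2_meas (\<lambda>c. group_law K (step N c) g)"
  using distr_distr[OF group_law_measurable[OF N g] step_uniform_measurable[OF N]]
  unfolding nu_mult_def nu_eq[OF N r] by (simp add: o_def)

lemma coord_ball_pos:
  assumes "r > 0"
  shows "measure (cspace N) (cdisc N r) > 0"
    and "emeasure (cspace N) (cdisc N r)
      = ennreal (measure (cspace N) (cdisc N r))"
  using measure_coord_ball[OF finite_coords assms] emeasure_coord_ball[OF finite_coords assms] assms
  by (simp_all add: unit_ball_vol_pos)

lemma coord_uniform_one:
  assumes "r > 0"
  shows "emeasure (coord_uniform N r) (space (coord_uniform N r)) = 1"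
proof -
  let ?M = "cspace N" and ?D = "cdisc N r"
  have "?D \<inter> space ?M = ?D" using sets.sets_into_space[OF coord_ball_measurable] by blast
  then show ?thesis
    using coord_ball_pos[OF assms, of N] coord_ball_measurable[of "coords N" r]
    by (simp add: coord_uniform_def ennreal_divide_self)
qed

text \<open>
  The coupling: apply the triangular shift \<open>T\<close> to a uniform point of the ball and resample if the
  result has left the ball.
\<close>

lemma MK_dist_le_exit_probability:
  assumes N: "N \<ge> 1" and r: "r > 0" and g: "g \<in> L2"
    and T: "T \<in> measurable (cspace N) (cspace N)"
    and TM: "distr (cspace N) (cspace N) T = cspace N"
    and d: "\<And>c. c \<in> cdisc N r \<Longrightarrow> dst (step N (T c)) (group_law K (step N c) g) \<le> \<delta>"
    and "\<delta> \<ge> 0"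
    and exit: "measure (cspace N) {c \<in> cdisc N r. T c \<notin> cdisc N r}
      \<le> q * measure (cspace N) (cdisc N r)"
  shows "MK_dist (\<lambda>f h. min (dst f h) 1) (nu_L2 K ip N r) (nu_mult K ip N r g) \<le> ennreal (\<delta> + q)"
proof -
  let ?M = "cspace N" and ?D = "cdisc N r"
  let ?S = "{c \<in> ?D. T c \<in> ?D}"
  define \<mu> where "\<mu> = coord_uniform N r"
  have sets\<mu>: "sets \<mu> = sets ?M" and space\<mu>: "space \<mu> = space ?M"
    by (auto simp: \<mu>_def coord_uniform_def)
  have D: "?D \<in> sets ?M" by (rule coord_ball_measurable)
  have "?S = ?D \<inter> (T -` ?D \<inter> space ?M)" using sets.sets_into_space[OF D] by auto
  then have S: "?S \<in> sets ?M" using D measurable_sets[OF T D] by (simp only: sets.Int)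
  have em: "emeasure \<mu> A = emeasure ?M (?D \<inter> A) / emeasure ?M ?D" if "A \<in> sets ?M" for A
    unfolding \<mu>_def coord_uniform_def by (rule emeasure_uniform_measure[OF D that])
  have one: "emeasure \<mu> (space \<mu>) = 1" unfolding \<mu>_def by (rule coord_uniform_one[OF r])
  have T\<mu>: "T \<in> measurable \<mu> \<mu>" using T by (simp only: measurable_cong_sets[OF sets\<mu> sets\<mu>])
  \<comment> \<open>Measure preservation of \<open>T\<close> yields the domination needed for
    resampling: intersecting the preimage of \<open>A\<close> with the ball only loses mass, while
    \<open>A\<close> lies in the ball entirely.\<close>
  have dom: "emeasure \<mu> (T -` A \<inter> space \<mu>) \<le> emeasure \<mu> A" if "A \<in> sets \<mu>" "A \<subseteq> ?D" for A
  proof -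
    have A: "A \<in> sets ?M" using that sets\<mu> by simp
    have TA: "T -` A \<inter> space ?M \<in> sets ?M" by (rule measurable_sets[OF T A])
    have "emeasure ?M (?D \<inter> (T -` A \<inter> space ?M)) \<le> emeasure ?M (T -` A \<inter> space ?M)"
      by (rule emeasure_mono[OF _ TA]) auto
    also have "\<dots> = emeasure ?M A" using emeasure_distr[OF T A] TM by simp
    also have "\<dots> = emeasure ?M (?D \<inter> A)" using that(2) by (simp add: Int_absorb1)
    finally show ?thesis unfolding space\<mu> em[OF TA] em[OF A] by (rule divide_right_mono_ennreal)
  qed
  obtain \<kappa> where \<kappa>: "sets \<kappa> = sets \<mu>" "emeasure \<kappa> (space \<kappa>) = 1"
    "(\<lambda>(y, z). if T y \<in> ?D then T y else z) \<in> measurable (\<mu> \<Otimes>\<^sub>M \<kappa>) \<mu>"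
    "distr (\<mu> \<Otimes>\<^sub>M \<kappa>) \<mu> (\<lambda>(y, z). if T y \<in> ?D then T y else z) = \<mu>"
    by (rule resampling_measure[OF one T\<mu> D[folded sets\<mu>] dom])
  interpret \<kappa>: finite_measure \<kappa> using \<kappa>(2) by (intro finite_measureI) simp
  let ?P = "\<mu> \<Otimes>\<^sub>M \<kappa>"
  define X where "X = (\<lambda>(y, z). if T y \<in> ?D then T y else z)"
  have X: "X \<in> measurable ?P \<mu>" unfolding X_def by (rule \<kappa>(3))
  define \<nu>1 where "\<nu>1 = nu_L2 K ip N r"
  define \<nu>2 where "\<nu>2 = nu_mult K ip N r g"
  define Gl where "Gl c = group_law K (step N c) g" for c
  have \<nu>1: "\<nu>1 = distr \<mu> L2_meas (step N)"
    unfolding \<nu>1_def \<mu>_def by (rule nu_L2_eq[OF N r])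
  have \<nu>2: "\<nu>2 = distr \<mu> L2_meas Gl"
    unfolding \<nu>2_def \<mu>_def Gl_def[abs_def] by (rule nu_mult_eq[OF N r g])
  have sv: "sets \<nu>1 = sets L2_meas" "sets \<nu>2 = sets L2_meas" by (simp_all add: \<nu>1 \<nu>2)
  have stm: "step N \<in> measurable \<mu> \<nu>1"
    unfolding measurable_cong_sets[OF refl sv(1)] \<mu>_def
    by (rule measurable_compose[OF step_uniform_measurable[OF N]]) (intro measurable_restrict_space1, simp)
  have glm: "Gl \<in> measurable \<mu> \<nu>2"
    unfolding measurable_cong_sets[OF refl sv(2)] \<mu>_def Gl_def[abs_def]
    by (rule measurable_compose[OF step_uniform_measurable[OF N] group_law_measurable[OF N g]])
  have sX: "(\<lambda>w. step N (X w)) \<in> measurable ?P \<nu>1" by (rule measurable_compose[OF X stm])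
  have gF: "(\<lambda>w. Gl (fst w)) \<in> measurable ?P \<nu>2" by (rule measurable_compose[OF measurable_fst glm])
  \<comment> \<open>The second component multiplies the original point by \<open>g\<close>; the
    first uses the resampled point, which is again uniform on the ball and so has the law of
    \<open>nu_L2\<close>.\<close>
  define \<Phi> where "\<Phi> w = (step N (X w), Gl (fst w))" for w
  have \<Phi>: "\<Phi> \<in> measurable ?P (\<nu>1 \<Otimes>\<^sub>M \<nu>2)"
    unfolding \<Phi>_def[abs_def] by (rule measurable_Pair[OF sX gF])
  have fstd: "distr ?P \<mu> fst = \<mu>"
    by (rule distr_fst_pair[OF \<kappa>.sigma_finite_measure_axioms \<kappa>(2)])
  define \<gamma> where "\<gamma> = distr ?P (\<nu>1 \<Otimes>\<^sub>M \<nu>2) \<Phi>"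
  have "\<gamma> \<in> couplings \<nu>1 \<nu>2"
    unfolding couplings_def
  proof (intro CollectI conjI)
    show "sets \<gamma> = sets (\<nu>1 \<Otimes>\<^sub>M \<nu>2)" by (simp add: \<gamma>_def)
    have "distr \<gamma> \<nu>1 fst = distr ?P \<nu>1 (step N \<circ> X)"
      unfolding \<gamma>_def distr_distr[OF measurable_fst \<Phi>] by (simp add: \<Phi>_def[abs_def] o_def)
    also have "\<dots> = distr (distr ?P \<mu> X) \<nu>1 (step N)" by (rule distr_distr[OF stm X, symmetric])
    also have "\<dots> = distr \<mu> \<nu>1 (step N)" using \<kappa>(4) by (simp add: X_def)
    also have "\<dots> = \<nu>1" unfolding \<nu>1 by (rule distr_cong) (simp_all)
    finally show "distr \<gamma> \<nu>1 fst = \<nu>1" .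
    have "distr \<gamma> \<nu>2 snd = distr ?P \<nu>2 (Gl \<circ> fst)"
      unfolding \<gamma>_def distr_distr[OF measurable_snd \<Phi>] by (simp add: \<Phi>_def[abs_def] o_def)
    also have "\<dots> = distr (distr ?P \<mu> fst) \<nu>2 Gl" by (rule distr_distr[OF glm measurable_fst, symmetric])
    also have "\<dots> = distr \<mu> \<nu>2 Gl" by (simp add: fstd)
    also have "\<dots> = \<nu>2" unfolding \<nu>2 by (rule distr_cong) (simp_all)
    finally show "distr \<gamma> \<nu>2 snd = \<nu>2" .
  qed
  then have "MK_dist (\<lambda>f h. min (dst f h) 1) \<nu>1 \<nu>2 \<le> (\<integral>\<^sup>+(x, y). ennreal (min (dst x y) 1) \<partial>\<gamma>)"
    unfolding MK_dist_def by (rule INF_lower)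
  also have "\<dots> \<le> (\<integral>\<^sup>+w. (case \<Phi> w of (x, y) \<Rightarrow> ennreal (min (dst x y) 1)) \<partial>?P)"
    unfolding \<gamma>_def by (rule nn_integral_distr_le[OF \<Phi>])
  \<comment> \<open>Without resampling the cost is at most \<open>\<delta>\<close> by
    \<open>d\<close>; on the exit event it is at most \<open>1\<close> by truncation.\<close>
  also have "\<dots> \<le> (\<integral>\<^sup>+w. ennreal \<delta> + indicator (space \<mu> - ?S) (fst w) \<partial>?P)"
  proof (rule nn_integral_mono)
    fix w assume "w \<in> space ?P"
    then have fw: "fst w \<in> space \<mu>" by (auto simp: space_pair_measure)
    show "(case \<Phi> w of (x, y) \<Rightarrow> ennreal (min (dst x y) 1))
        \<le> ennreal \<delta> + indicator (space \<mu> - ?S) (fst w)"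
    proof (cases "fst w \<in> ?S")
      case True
      then have "X w = T (fst w)" by (simp add: X_def split_beta')
      then have "min (dst (fst (\<Phi> w)) (snd (\<Phi> w))) 1 \<le> \<delta>"
        using d[of "fst w"] True by (simp add: \<Phi>_def Gl_def min.coboundedI1)
      then show ?thesis using True by (simp add: split_beta' ennreal_leI)
    next
      case False
      have "ennreal (min (dst (fst (\<Phi> w)) (snd (\<Phi> w))) 1) \<le> ennreal 1" by (intro ennreal_leI) simp
      moreover have "fst w \<in> space \<mu> - ?S" using False fw by blast
      ultimately show ?thesis by (simp add: split_beta' add_increasing)
    qed
  qed
  also have "\<dots> = ennreal \<delta> + emeasure \<mu> (space \<mu> - ?S)"
  proof -
    have E: "space \<mu> - ?S \<in> sets \<mu>" unfolding sets\<mu> space\<mu> by (rule sets.compl_sets[OF S])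
    have im: "(\<lambda>w. indicator (space \<mu> - ?S) (fst w) :: ennreal) \<in> borel_measurable ?P"
      by (rule measurable_compose[OF measurable_fst borel_measurable_indicator[OF E]])
    have p1: "emeasure ?P (space ?P) = 1"
      using \<kappa>(2) one by (simp add: space_pair_measure \<kappa>.emeasure_pair_measure_Times)
    have "(\<integral>\<^sup>+w. indicator (space \<mu> - ?S) (fst w) \<partial>?P)
        = (\<integral>\<^sup>+c. indicator (space \<mu> - ?S) c \<partial>\<mu>)"
      by (rule nn_integral_distr[OF measurable_fst[of \<mu> \<kappa>], unfolded fstd,
          OF borel_measurable_indicator[OF E], symmetric])
    also have "\<dots> = emeasure \<mu> (space \<mu> - ?S)" by (rule nn_integral_indicator[OF E])
    finally show ?thesis using im p1 by (simp add: nn_integral_add)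
  qed
  also have "emeasure \<mu> (space \<mu> - ?S) \<le> ennreal q"
  proof -
    note E = sets.compl_sets[OF S]
    have eq: "?D \<inter> (space ?M - ?S) = {c \<in> ?D. T c \<notin> ?D}"
      using sets.sets_into_space[OF D] by auto
    have fin: "emeasure ?M {c \<in> ?D. T c \<notin> ?D} \<noteq> top"
      using emeasure_mono[of "{c \<in> ?D. T c \<notin> ?D}" ?D ?M] D coord_ball_pos(2)[OF r, of N]
      by (auto simp: top_unique)
    have "emeasure \<mu> (space \<mu> - ?S) = emeasure ?M {c \<in> ?D. T c \<notin> ?D} / emeasure ?M ?D"
      unfolding space\<mu> em[OF E] eq ..
    also have "\<dots> = ennreal (measure ?M {c \<in> ?D. T c \<notin> ?D} / measure ?M ?D)"
      using coord_ball_pos[OF r, of N] fin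
      by (simp add: emeasure_eq_ennreal_measure divide_ennreal measure_nonneg)
    also have "\<dots> \<le> ennreal q"
      using exit coord_ball_pos(1)[OF r, of N] by (intro ennreal_leI) (simp add: pos_divide_le_eq)
    finally show ?thesis .
  qed
  finally have "MK_dist (\<lambda>f h. min (dst f h) 1) \<nu>1 \<nu>2 \<le> ennreal \<delta> + ennreal q"
    by (simp add: add_left_mono)
  moreover have "q \<ge> 0"
  proof -
    have "0 \<le> q * measure ?M ?D" using exit measure_nonneg order_trans by blast
    then show ?thesis using coord_ball_pos(1)[OF r, of N] by (simp add: zero_le_mult_iff)
  qed
  ultimately show ?thesis using \<open>\<delta> \<ge> 0\<close> by (simp add: \<nu>1_def \<nu>2_def ennreal_plus)
qed

end

section \<open>The triangular shift that approximates right multiplication\<close>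

text \<open>The grid of \<open>g\<close> is fixed while \<open>N\<close> varies over all integers,
  so the two grids are in general incompatible; hence the discretization error of
  \<open>g\<close>.\<close>

locale step_translation = path_space K ip for K :: "(real^'n^'n) set" and ip +
  fixes g :: "real \<Rightarrow> real^'n^'n" and m :: nat and y :: "nat \<Rightarrow> real^'n^'n"
  assumes m: "m \<ge> 1" and gV: "g \<in> V K ip m" and y_lie: "\<And>i. y i \<in> lie"
    and y: "\<And>i. i < m \<Longrightarrow> AE t in lebesgue_on (grid_interval m i). g t = y i"
begin

lemma g_L2: "g \<in> L2"
  using gV V_subset_L2 by blast

text \<open>A pointwise representative: \<open>g\<close> itself is known only up to null sets and
  cannot be sampled at grid points.\<close>

definition grep :: "real \<Rightarrow> real^'n^'n" where
  "grep t = y (nat \<lfloor>t * real m\<rfloor>)"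

text \<open>The index \<open>m\<close> is included because \<open>grep 1\<close> equals
  \<open>y m\<close>.\<close>

definition bnd :: real where
  "bnd = sqrt (\<Sum>i\<le>m. sqn (y i))"

definition gdisc :: "nat \<Rightarrow> real \<Rightarrow> real^'n^'n" where
  "gdisc N t = grep (real (nat \<lfloor>t * real N\<rfloor>) / real N)"

lemma bnd_nonneg: "bnd \<ge> 0"
  by (simp add: bnd_def sum_nonneg sqn_nonneg)

lemma sqn_grep:
  assumes "t \<in> {0..1}"
  shows "sqn (grep t) \<le> bnd\<^sup>2"
proof -
  have "t * real m \<le> real m" using assms by (simp add: mult_left_le_one_le)
  then have "\<lfloor>t * real m\<rfloor> \<le> int m" by linarith
  then have "nat \<lfloor>t * real m\<rfloor> \<le> m" by linarith
  then have "sqn (grep t) \<le> (\<Sum>i\<le>m. sqn (y i))"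
    unfolding grep_def by (intro member_le_sum[of _ "{..m}" "\<lambda>i. sqn (y i)"]) (auto simp: sqn_nonneg)
  then show ?thesis by (simp add: bnd_def sum_nonneg sqn_nonneg)
qed

lemma grep_lie: "grep t \<in> lie"
  by (simp add: grep_def y_lie)

lemma grid_point_bounds:
  assumes "t \<in> {0..1}"
  shows "real (nat \<lfloor>t * real N\<rfloor>) / real N \<in> {0..1}" "real (nat \<lfloor>t * real N\<rfloor>) / real N \<le> t"
proof -
  have "real (nat \<lfloor>t * real N\<rfloor>) \<le> t * real N" using assms by (simp add: of_nat_nat)
  then show le: "real (nat \<lfloor>t * real N\<rfloor>) / real N \<le> t"
    using assms by (cases "N = 0") (auto simp: pos_divide_le_eq)
  then show "real (nat \<lfloor>t * real N\<rfloor>) / real N \<in> {0..1}" using assms by auto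
qed

lemma gdisc_lie: "gdisc N t \<in> lie"
  by (simp add: gdisc_def grep_lie)

lemma sqn_gdisc: "t \<in> {0..1} \<Longrightarrow> sqn (gdisc N t) \<le> bnd\<^sup>2"
  unfolding gdisc_def by (intro sqn_grep grid_point_bounds)

lemma gdisc_measurable: "gdisc N \<in> borel_measurable unit_leb"
proof -
  have "(\<lambda>t::real. t * real N) \<in> borel_measurable borel" by simp
  from measurable_compose[OF this measurable_real_floor]
  have "(\<lambda>t. \<lfloor>t * real N\<rfloor>) \<in> measurable borel (count_space UNIV)" .
  from measurable_compose[OF this, of "\<lambda>k. grep (real (nat k) / real N)" borel]
  have "gdisc N \<in> borel_measurable borel" by (simp add: gdisc_def[abs_def])
  then show ?thesis by (intro measurable_restrict_space1 measurable_completion) simp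
qed

lemma gdisc_L2: "gdisc N \<in> L2"
  by (rule L2_bounded(1)[OF gdisc_lie gdisc_measurable AE_I2[OF sqn_gdisc]]) simp_all

lemma g_AE: "AE t in unit_leb. \<exists>j<m. real j / real m < t \<and> t < real (Suc j) / real m \<and> g t = y j"
  by (rule AE_grid_values[OF m y])

lemma sqn_diff_le: "sqn (u - v) \<le> 2 * sqn u + 2 * sqn v"
  using sqn_add_le[of 1 u "- v"] sqn_scale[of "-1" v] by simp

abbreviation "disc_error N \<equiv> nrm (\<lambda>t. gdisc N t - g t)"

text \<open>At an interior point \<open>t\<close> of a cell of the \<open>m\<close>-grid the
  sampling point lies in the same cell as soon as \<open>1 / N\<close> is smaller than the distance
  of \<open>t\<close> to its left end. The integrand is then zero, and dominated convergence
  applies.\<close>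

lemma gdisc_tendsto: "disc_error \<longlonglongrightarrow> 0"
proof -
  have L: "(\<lambda>t. gdisc N t - g t) \<in> L2" for N by (rule L2_diff[OF gdisc_L2 g_L2])
  have "(\<lambda>N. \<integral>t. sqn (gdisc N t - g t) \<partial>unit_leb) \<longlonglongrightarrow> (\<integral>t. 0 \<partial>unit_leb)"
  proof (rule integral_dominated_convergence[where w="\<lambda>t. 4 * bnd\<^sup>2"])
    show "integrable unit_leb (\<lambda>t. 4 * bnd\<^sup>2)"
      by (rule finite_measure.integrable_const[OF unit_leb_finite])
    show "(\<lambda>t. sqn (gdisc N t - g t)) \<in> borel_measurable unit_leb" for N
      by (intro sqn_comp_measurable L2_measurable L)
    show "AE t in unit_leb. norm (sqn (gdisc N t - g t)) \<le> 4 * bnd\<^sup>2" for N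
      using g_AE AE_space
    proof eventually_elim
      case (elim t)
      then obtain j where j: "j < m" "real j / real m < t" "t < real (Suc j) / real m" "g t = y j" by blast
      have t: "t \<in> {0..1}" using elim(2) by simp
      have "j = nat \<lfloor>t * real m\<rfloor>" using grid_cell_iff[OF m, of t j] t j by auto
      then have "g t = grep t" using j(4) by (simp add: grep_def)
      then have "sqn (gdisc N t - g t) \<le> 2 * bnd\<^sup>2 + 2 * bnd\<^sup>2"
        using sqn_diff_le[of "gdisc N t" "g t"] sqn_gdisc[OF t, of N] sqn_grep[OF t] by simp
      then show ?case by (simp add: sqn_nonneg)
    qed
    show "AE t in unit_leb. (\<lambda>N. sqn (gdisc N t - g t)) \<longlonglongrightarrow> 0"
      using g_AE AE_space
    proof eventually_elim
      case (elim t)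
      then obtain j where j: "j < m" "real j / real m < t" "t < real (Suc j) / real m" "g t = y j" by blast
      have t: "t \<in> {0..1}" using elim(2) by simp
      have "eventually (\<lambda>N. 1 / real N < t - real j / real m) sequentially"
        using j(2) by (intro order_tendstoD(2)[OF lim_1_over_n]) simp
      then have "eventually (\<lambda>N. sqn (gdisc N t - g t) = 0) sequentially"
        using eventually_ge_at_top[of 1]
      proof eventually_elim
        case (elim N)
        define s where "s = real (nat \<lfloor>t * real N\<rfloor>) / real N"
        have "t * real N < real (nat \<lfloor>t * real N\<rfloor>) + 1" using t by (simp add: of_nat_nat)
        then have "(t * real N - 1) / real N < s"
          unfolding s_def using elim(2) by (intro divide_strict_right_mono) auto
        then have "t - 1 / real N < s" using elim(2) by (simp add: diff_divide_distrib)
        then have "real j / real m \<le> s" using elim(1) by simp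
        moreover have "s < real (Suc j) / real m"
          using grid_point_bounds(2)[OF t, of N] j(3) by (simp add: s_def)
        moreover have "s \<ge> 0" by (simp add: s_def)
        ultimately have "j = nat \<lfloor>s * real m\<rfloor>" using grid_cell_iff[OF m, of s j] by blast
        then have "gdisc N t = y j" by (simp add: gdisc_def grep_def s_def)
        then show ?case using j(4) sqn_scale[of 0 0] by simp
      qed
      then show ?case by (rule tendsto_eventually)
    qed
  qed simp
  then have "(\<lambda>N. sqrt (\<integral>t. sqn (gdisc N t - g t) \<partial>unit_leb)) \<longlonglongrightarrow> sqrt 0"
    by (intro tendsto_real_sqrt) simp
  then show ?thesis by (simp add: nrm_eq[OF L])
qed

definition grid_path :: "nat \<Rightarrow> (nat \<times> (real^'n^'n) \<Rightarrow> real) \<Rightarrow> nat \<Rightarrow> real^'n^'n" where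
  "grid_path N c i = step_path N (step_value N c) i (real i / real N)"

text \<open>The division by \<open>sqrt N\<close> converts a value on a cell into orthonormal
  coordinates, since \<open>step_value\<close> multiplies by the same factor.\<close>

definition shift :: "nat \<Rightarrow> nat \<times> (real^'n^'n) \<Rightarrow> (nat \<times> (real^'n^'n) \<Rightarrow> real) \<Rightarrow> real" where
  "shift N p c = coord (snd p) (Ad (grid_path N c (fst p)) (grep (real (fst p) / real N))) / sqrt (real N)"

abbreviation "tshift N \<equiv> triangular_shift (coords N) (shift N)"

lemma grid_path_in_K: "grid_path N c i \<in> K"
  unfolding grid_path_def by (intro step_path_in_K step_value_lie)

lemma grid_path_measurable:
  assumes "i < N"
  shows "(\<lambda>c. grid_path N c i) \<in> borel_measurable (cspace N)"
proof (rule lipschitz_in_coordinates_measurable[OF finite_coords])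
  define Q where "Q = (\<Sum>j<i. \<Sum>b\<in>onb. sqrt (real N) * norm b) / real N"
  show "Q \<ge> 0" unfolding Q_def by (intro divide_nonneg_nonneg sum_nonneg) auto
  fix c c' :: "nat \<times> (real^'n^'n) \<Rightarrow> real" and d :: real
  assume d: "\<And>p. p \<in> coords N \<Longrightarrow> \<bar>c' p - c p\<bar> \<le> d" "d \<ge> 0"
  have "norm (step_value N c' j - step_value N c j) \<le> (\<Sum>b\<in>onb. sqrt (real N) * norm b) * d" if "j < i" for j
  proof -
    have "step_value N c' j - step_value N c j = (\<Sum>b\<in>onb. ((c' (j, b) - c (j, b)) * sqrt (real N)) *\<^sub>R b)"
      unfolding step_value_def sum_subtractf[symmetric] by (intro sum.cong refl) (simp add: algebra_simps)
    also have "norm \<dots> \<le> (\<Sum>b\<in>onb. norm (((c' (j, b) - c (j, b)) * sqrt (real N)) *\<^sub>R b))"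
      by (rule norm_sum)
    also have "\<dots> \<le> (\<Sum>b\<in>onb. d * (sqrt (real N) * norm b))"
    proof (rule sum_mono)
      fix b assume "b \<in> onb"
      then have "\<bar>c' (j, b) - c (j, b)\<bar> \<le> d" using d(1)[of "(j, b)"] that assms by simp
      then have "\<bar>c' (j, b) - c (j, b)\<bar> * (sqrt (real N) * norm b) \<le> d * (sqrt (real N) * norm b)"
        by (rule mult_right_mono) simp
      then show "norm (((c' (j, b) - c (j, b)) * sqrt (real N)) *\<^sub>R b) \<le> d * (sqrt (real N) * norm b)"
        by (simp add: abs_mult mult.assoc)
    qed
    also have "\<dots> = (\<Sum>b\<in>onb. sqrt (real N) * norm b) * d"
      unfolding sum_distrib_left[symmetric] by (rule mult.commute)
    finally show ?thesis .
  qed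
  then have "(\<Sum>j<i. norm (step_value N c' j - step_value N c j))
      \<le> (\<Sum>j<i. (\<Sum>b\<in>onb. sqrt (real N) * norm b) * d)"
    by (intro sum_mono) auto
  then have "(\<Sum>j<i. norm (step_value N c' j - step_value N c j)) / real N \<le> Q * d"
    unfolding Q_def sum_distrib_right[symmetric] by (simp add: divide_right_mono)
  moreover have "norm (grid_path N c' i - grid_path N c i)
      \<le> (\<Sum>j<i. norm (step_value N c' j - step_value N c j)) / real N"
    unfolding grid_path_def by (intro step_path_diff_le lie_skew step_value_lie)
  ultimately show "norm (grid_path N c' i - grid_path N c i) \<le> Q * d" by linarith
qed

lemma shift_measurable:
  assumes "p \<in> coords N"
  shows "shift N p \<in> borel_measurable (cspace N)"
proof -
  let ?x = "grep (real (fst p) / real N)"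
  have i: "fst p < N" using assms by auto
  have "continuous_on UNIV (\<lambda>u. coord (snd p) (u ** ?x ** transpose u) / sqrt (real N))"
    unfolding divide_inverse
    by (intro continuous_on_mult_right bounded_linear.continuous_on[OF bounded_linear_coord]
        mm.continuous_on continuous_on_id continuous_on_const
        linear_continuous_on bounded_linear_transpose)
  from measurable_compose[OF grid_path_measurable[OF i] borel_measurable_continuous_onI[OF this]]
  show ?thesis by (simp add: shift_def[abs_def] Ad_eq[OF grid_path_in_K])
qed

lemma shift_cong:
  assumes "p \<in> coords N" and c: "\<And>q. q \<in> coords N \<Longrightarrow> fst q < fst p \<Longrightarrow> c q = c' q"
  shows "shift N p c = shift N p c'"
proof -
  have "step_value N c j = step_value N c' j" if "j < fst p" for j
    unfolding step_value_def using assms(1) that by (intro sum.cong refl) (auto simp: c)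
  then have "grid_path N c (fst p) = grid_path N c' (fst p)"
    unfolding grid_path_def by (rule step_path_cong)
  then show ?thesis by (simp add: shift_def)
qed

lemma sqn_Ad_grep:
  assumes "i < N"
  shows "sqn (Ad (grid_path N c i) (grep (real i / real N))) \<le> bnd\<^sup>2"
proof -
  have "real i / real N \<in> {0..1}" using assms by (simp add: divide_le_eq)
  then show ?thesis using sqn_grep by (simp add: sqn_Ad[OF grid_path_in_K grep_lie])
qed

text \<open>\<open>Ad\<close> preserves \<open>sqn\<close>, so the squared length of the shift is an
  average of the values \<open>sqn (grep (i / N))\<close>, and a single coordinate carries at most
  one summand of this average.\<close>

lemma bounded_triangular_shift:
  assumes N: "N \<ge> 1"
  shows "bounded_triangular (coords N) (shift N) fst bnd (bnd\<^sup>2 / real N)"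
proof unfold_locales
  show "finite (coords N)" by (rule finite_coords)
  show "shift N p \<in> borel_measurable (cspace N)" if "p \<in> coords N" for p
    by (rule shift_measurable[OF that])
  show "shift N p c = shift N p c'" if "p \<in> coords N" "\<And>q. q \<in> coords N \<Longrightarrow> fst q < fst p \<Longrightarrow> c q = c' q"
    for p c c' by (rule shift_cong[OF that])
  show "(shift N p c)\<^sup>2 \<le> bnd\<^sup>2 / real N" if p: "p \<in> coords N" for p c
  proof -
    let ?z = "Ad (grid_path N c (fst p)) (grep (real (fst p) / real N))"
    have "(coord (snd p) ?z)\<^sup>2 \<le> sqn ?z"
      unfolding sqn_def by (rule member_le_sum) (use p onb(1) in auto)
    also have "\<dots> \<le> bnd\<^sup>2" using p by (intro sqn_Ad_grep) auto
    finally show ?thesis by (simp add: shift_def power_divide divide_right_mono)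
  qed
  show "(\<Sum>p\<in>coords N. (shift N p c)\<^sup>2) \<le> bnd\<^sup>2" for c
  proof -
    have "(\<Sum>p\<in>coords N. (shift N p c)\<^sup>2) = (\<Sum>i<N. \<Sum>b\<in>onb. (shift N (i, b) c)\<^sup>2)"
      by (simp add: sum.cartesian_product)
    also have "\<dots> = (\<Sum>i<N. sqn (Ad (grid_path N c i) (grep (real i / real N))) / real N)"
      by (simp add: shift_def power_divide sqn_def sum_divide_distrib)
    also have "\<dots> \<le> (\<Sum>i<N. bnd\<^sup>2 / real N)"
      by (intro sum_mono divide_right_mono sqn_Ad_grep) auto
    also have "\<dots> = bnd\<^sup>2" using N by simp
    finally show ?thesis .
  qed
qed

lemma step_value_triangular_shift:
  assumes "N \<ge> 1" "i < N"
  shows "step_value N (tshift N c) i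
    = step_value N c i + Ad (grid_path N c i) (grep (real i / real N))"
proof -
  let ?z = "Ad (grid_path N c i) (grep (real i / real N))"
  have "step_value N (tshift N c) i
      = (\<Sum>b\<in>onb. (c (i, b) * sqrt (real N)) *\<^sub>R b + coord b ?z *\<^sub>R b)"
    unfolding step_value_def triangular_shift_def shift_def using assms
    by (intro sum.cong refl) (simp add: algebra_simps)
  also have "\<dots> = step_value N c i + (\<Sum>b\<in>onb. coord b ?z *\<^sub>R b)"
    by (simp add: sum.distrib step_value_def)
  also have "(\<Sum>b\<in>onb. coord b ?z *\<^sub>R b) = ?z"
    by (rule coord_expansion[symmetric]) (intro Ad_lie grid_path_in_K grep_lie)
  finally show ?thesis .
qed

text \<open>The difference splits into \<open>A2\<close>, where \<open>g\<close> is replaced by its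
  samples along the exact path, and \<open>A1\<close>, where the path is frozen on each cell. On a
  cell the path moves by at most a multiple of the current value of \<open>step N c\<close> divided
  by \<open>N\<close>, so \<open>A1\<close> is dominated pointwise by a multiple of
  \<open>step N c\<close> divided by \<open>N\<close>, and the norm of \<open>step N c\<close> is at
  most \<open>r\<close>.\<close>

lemma shift_approximates_group_law:
  "\<exists>C\<ge>0. \<forall>N\<ge>1. \<forall>r>0. \<forall>c\<in>cdisc N r.
    dst (step N (tshift N c)) (group_law K (step N c) g)
      \<le> C * (r / real N) + disc_error N"
proof -
  obtain C1 where C1: "C1 \<ge> 0" "\<And>x. x \<in> lie \<Longrightarrow> norm x \<le> C1 * sqrt (sqn x)"
    using norm_le_sqn by auto
  obtain C where C: "C \<ge> 0"
    "\<And>u v x. u \<in> K \<Longrightarrow> v \<in> K \<Longrightarrow> x \<in> lie \<Longrightarrow> sqn (Ad u x - Ad v x) \<le> (C * norm (u - v))\<^sup>2 * sqn x"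
    using sqn_Ad_diff by auto
  define C' where "C' = C * C1 * bnd"
  have C'0: "C' \<ge> 0" using C C1 bnd_nonneg by (simp add: C'_def)
  have "dst (step N (tshift N c)) (group_law K (step N c) g)
      \<le> C' * (r / real N) + disc_error N"
    if N: "N \<ge> 1" and r: "r > 0" and c: "c \<in> cdisc N r" for N r c
  proof -
    define v where "v = step_value N c"
    have v: "\<And>i. v i \<in> lie" by (simp add: v_def step_value_lie)
    define Tc where "Tc = tshift N c"
    note sL = step_L2[OF N]
    have val: "\<And>i. i < N \<Longrightarrow> AE t in lebesgue_on (grid_interval N i). step N c t = v i"
      unfolding v_def by (rule step_AE_value[OF N])
    define path where "path = step_path N v N"
    have pK: "path t \<in> K" for t unfolding path_def by (intro step_path_in_K v)
    have G1: "group_law K (step N c) g \<in> L2"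
      by (rule group_law_V(1)[OF N sL v val g_L2])
    have G2: "group_law K (step N c) g t = step N c t + Ad (path t) (g t)" if "t \<in> {0..1}" for t
      unfolding path_def by (rule group_law_V(2)[OF N sL v val g_L2 that])
    have pm: "path \<in> borel_measurable unit_leb" unfolding path_def by (intro step_path_measurable lie_skew v)
    define D where "D t = step N Tc t - group_law K (step N c) g t" for t
    have D: "D \<in> L2" unfolding D_def[abs_def] by (rule L2_diff[OF sL G1])
    define A2 where "A2 t = Ad (path t) (gdisc N t - g t)" for t
    have A2: "A2 \<in> L2" "nrm A2 \<le> disc_error N"
      unfolding A2_def[abs_def] by (rule Ad_path_L2[OF pm pK L2_diff[OF gdisc_L2 g_L2]])+
    define A1 where "A1 t = D t - A2 t" for t
    have A1: "A1 \<in> L2" unfolding A1_def[abs_def] by (rule L2_diff[OF D A2(1)])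
    have "nrm A1 \<le> (C' / real N) * nrm (step N c)"
    proof (rule L2_dominated(2)[OF L2_lie[OF A1] L2_measurable[OF A1] sL])
      show "C' / real N \<ge> 0" using C'0 by simp
      show "AE t in unit_leb. sqn (A1 t) \<le> (C' / real N)\<^sup>2 * sqn (step N c t)"
        using AE_interior_of_grid[OF N] AE_space
      proof eventually_elim
        case (elim t)
        then obtain i where i: "i < N" "real i / real N < t" "t < real (Suc i) / real N" and t: "t \<in> {0..1}"
          by auto
        have it: "i = nat \<lfloor>t * real N\<rfloor>" using grid_cell_iff[OF N, of t i] i t by auto
        have gd: "gdisc N t = grep (real i / real N)" by (simp add: gdisc_def it)
        have st: "step N c t = v i" "step N Tc t = v i + Ad (grid_path N c i) (gdisc N t)"
          using step_inside[OF N i(1) less_imp_le[OF i(2)] i(3)] step_value_triangular_shift[OF N i(1)]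
          by (simp_all add: v_def Tc_def gd)
        have "A1 t = Ad (grid_path N c i) (gdisc N t) - Ad (path t) (gdisc N t)"
          unfolding A1_def D_def A2_def G2[OF t] st Ad_diff by simp
        also have "sqn \<dots> \<le> (C * norm (grid_path N c i - path t))\<^sup>2 * sqn (gdisc N t)"
          by (intro C grid_path_in_K pK gdisc_lie)
        also have "\<dots> \<le> (C * (C1 * sqrt (sqn (v i)) / real N))\<^sup>2 * bnd\<^sup>2"
        proof (intro mult_mono power_mono mult_left_mono)
          have "norm (path t - grid_path N c i) \<le> norm (v i) / real N"
            unfolding path_def grid_path_def v_def
            by (rule step_path_near_grid) (use i in \<open>auto intro: lie_skew step_value_lie\<close>)
          also have "\<dots> \<le> C1 * sqrt (sqn (v i)) / real N"
            by (intro divide_right_mono C1(2) v) simp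
          finally show "norm (grid_path N c i - path t) \<le> C1 * sqrt (sqn (v i)) / real N"
            by (simp only: norm_minus_commute)
          show "sqn (gdisc N t) \<le> bnd\<^sup>2" by (rule sqn_gdisc[OF t])
        qed (use C(1) in \<open>auto simp: sqn_nonneg\<close>)
        also have "\<dots> = (C' / real N)\<^sup>2 * (sqrt (sqn (v i)))\<^sup>2"
          by (simp only: C'_def power_mult_distrib power_divide times_divide_eq_left times_divide_eq_right mult_ac)
        also have "(sqrt (sqn (v i)))\<^sup>2 = sqn (step N c t)" by (simp add: st(1) sqn_nonneg)
        finally show ?case .
      qed
    qed
    also have "\<dots> \<le> (C' / real N) * r"
    proof (rule mult_left_mono)
      show "nrm (step N c) \<le> r" using c step_in_ball_iff[OF N r] by (simp add: coord_ball_def)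
    qed (use C'0 in simp)
    finally have n1: "nrm A1 \<le> C' * (r / real N)" by simp
    have "dst (step N Tc) (group_law K (step N c) g) = nrm (\<lambda>t. A1 t + A2 t)"
      unfolding L2_dist_def A1_def D_def by simp
    also have "\<dots> \<le> nrm A1 + nrm A2" by (rule nrm_triangle[OF A1 A2(1)])
    finally show ?thesis using n1 A2(2) by (simp add: Tc_def)
  qed
  then show ?thesis using C'0 by blast
qed

text \<open>
  The exit probability of the shift from the ball of radius \<open>r = \<rho> sqrt N\<close> is estimated with
  the slightly larger ball given by \<open>s = \<rho> powr (3/2)\<close> in \<open>triangular_shift_exit\<close>.
\<close>

lemma shift_exit_bound:
  assumes N: "N \<ge> 1" and r: "r > 0"
  defines "\<rho> \<equiv> r / sqrt (real N)"
  shows "measure (cspace N) {c \<in> cdisc N r.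
      tshift N c \<notin> cdisc N r}
    \<le> (bnd\<^sup>2 / \<rho> + (exp (real (card onb) * (bnd\<^sup>2 / \<rho>\<^sup>2 + 2 / sqrt \<rho>) / 2) - 1))
      * measure (cspace N) (cdisc N r)"
proof -
  interpret bounded_triangular "coords N" "shift N" fst bnd "bnd\<^sup>2 / real N"
    by (rule bounded_triangular_shift[OF N])
  have \<rho>: "\<rho> > 0" using r N by (simp add: \<rho>_def)
  have rr: "r\<^sup>2 = real N * \<rho>\<^sup>2" using N by (simp add: \<rho>_def power_divide)
  \<comment> \<open>In the normalization of the uniform ball the drift has second moment at most
    \<open>bnd\<^sup>2 * \<rho>\<^sup>2\<close>, so Chebyshev requires \<open>s\<close> to be much
    larger than \<open>\<rho>\<close>; the exponent of the volume ratio is of order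
    \<open>s / \<rho>\<^sup>2\<close>, which requires \<open>s\<close> to be much smaller than
    \<open>\<rho>\<^sup>2\<close>. The geometric mean of the two scales satisfies both.\<close>
  define s where "s = \<rho> * sqrt \<rho>"
  have s: "s > 0" using \<rho> by (simp add: s_def)
  define x where "x = (bnd\<^sup>2 + 2 * s) / r\<^sup>2"
  define r' where "r' = sqrt (r\<^sup>2 + bnd\<^sup>2 + 2 * s)"
  have pos: "r\<^sup>2 + bnd\<^sup>2 + 2 * s > 0" using r s by (simp add: add_pos_nonneg add_pos_pos)
  have r': "r' > 0" "r'\<^sup>2 = r\<^sup>2 + bnd\<^sup>2 + 2 * s" using pos by (simp_all add: r'_def)
  have card: "card (coords N) = N * card onb" by (simp add: card_cartesian_product)
  \<comment> \<open>The denominator of \<open>x\<close> is \<open>N * \<rho>\<^sup>2\<close>, so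
    raising to the power \<open>N * card onb\<close> cancels \<open>N\<close> and leaves a bound in
    terms of \<open>\<rho>\<close> alone.\<close>
  have "(r' / r)\<^sup>2 = 1 + x" using r r' by (simp add: x_def power_divide field_simps)
  also have "\<dots> \<le> exp x" by (rule exp_ge_add_one_self)
  also have "\<dots> = (exp (x / 2))\<^sup>2" by (simp add: exp_double[symmetric])
  finally have "r' / r \<le> exp (x / 2)" by (rule power2_le_imp_le) simp
  then have "(r' / r) ^ card (coords N) \<le> exp (x / 2) ^ card (coords N)"
    using r r' by (intro power_mono) auto
  also have "\<dots> = exp (real (card onb) * (real N * x) / 2)"
    by (simp add: exp_of_nat_mult[symmetric] card mult_ac)
  also have "real N * x = bnd\<^sup>2 / \<rho>\<^sup>2 + 2 / sqrt \<rho>"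
  proof -
    have "real N * x = (bnd\<^sup>2 + 2 * s) / \<rho>\<^sup>2" using N by (simp add: x_def rr)
    also have "\<dots> = bnd\<^sup>2 / \<rho>\<^sup>2 + 2 * (s / \<rho>\<^sup>2)" by (simp add: add_divide_distrib)
    also have "s / \<rho>\<^sup>2 = 1 / sqrt \<rho>"
      using \<rho> by (simp add: s_def power2_eq_square real_div_sqrt field_simps)
    finally show ?thesis by simp
  qed
  finally have 1: "(r' / r) ^ card (coords N) \<le> exp (real (card onb) * (bnd\<^sup>2 / \<rho>\<^sup>2 + 2 / sqrt \<rho>) / 2)" .
  have 2: "bnd\<^sup>2 / real N * r\<^sup>2 / s\<^sup>2 = bnd\<^sup>2 / \<rho>"
    unfolding rr s_def power_mult_distrib using \<rho> N by (simp add: power2_eq_square)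
  have "measure (cspace N) {c \<in> cdisc N r.
      tshift N c \<notin> cdisc N r}
    \<le> (bnd\<^sup>2 / real N * r\<^sup>2 / s\<^sup>2 + ((r' / r) ^ card (coords N) - 1))
      * measure (cspace N) (cdisc N r)"
    using r s r' by (intro triangular_shift_exit) auto
  also have "\<dots> \<le> (bnd\<^sup>2 / \<rho> + (exp (real (card onb) * (bnd\<^sup>2 / \<rho>\<^sup>2 + 2 / sqrt \<rho>) / 2) - 1))
      * measure (cspace N) (cdisc N r)"
    using 1 2 by (intro mult_right_mono) auto
  finally show ?thesis .
qed

lemma MK_dist_tendsto:
  assumes R: "\<And>N. N \<ge> 1 \<Longrightarrow> R N > 0"
    and R1: "filterlim (\<lambda>N. R N / sqrt (real N)) at_top sequentially"
    and R2: "(\<lambda>N. R N / real N) \<longlonglongrightarrow> 0"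
  shows "(\<lambda>N. MK_dist (\<lambda>f h. min (dst f h) 1) (nu_L2 K ip N (R N)) (nu_mult K ip N (R N) g)) \<longlonglongrightarrow> 0"
proof -
  obtain C where C: "C \<ge> 0" "\<forall>N\<ge>1. \<forall>r>0. \<forall>c\<in>cdisc N r.
    dst (step N (tshift N c)) (group_law K (step N c) g)
      \<le> C * (r / real N) + disc_error N"
    using shift_approximates_group_law by (elim exE conjE)
  define q where "q \<rho> = bnd\<^sup>2 / \<rho> + (exp (real (card onb) * (bnd\<^sup>2 / \<rho>\<^sup>2 + 2 / sqrt \<rho>) / 2) - 1)" for \<rho>
  \<comment> \<open>Freezing error, discretization error and exit probability: the first vanishes by
    \<open>R2\<close>, the second because \<open>g\<close> is a step function, the third by
    \<open>R1\<close>.\<close>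
  define B where "B N = C * (R N / real N) + disc_error N + q (R N / sqrt (real N))" for N
  have "((\<lambda>\<rho>::real. 1 / \<rho>) \<longlongrightarrow> 0) at_top" "((\<lambda>\<rho>::real. 1 / \<rho>\<^sup>2) \<longlongrightarrow> 0) at_top"
    "((\<lambda>\<rho>::real. 1 / sqrt \<rho>) \<longlongrightarrow> 0) at_top" by real_asymp+
  then have "((\<lambda>\<rho>. bnd\<^sup>2 * (1 / \<rho>) + (exp (real (card onb) * (bnd\<^sup>2 * (1 / \<rho>\<^sup>2) + 2 * (1 / sqrt \<rho>)) / 2) - 1))
      \<longlongrightarrow> bnd\<^sup>2 * 0 + (exp (real (card onb) * (bnd\<^sup>2 * 0 + 2 * 0) / 2) - 1)) at_top"
    by (intro tendsto_intros) simp_all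
  then have "(q \<longlongrightarrow> 0) at_top" by (simp add: q_def[abs_def])
  from filterlim_compose[OF this R1] have "(\<lambda>N. q (R N / sqrt (real N))) \<longlonglongrightarrow> 0" .
  from tendsto_add[OF tendsto_add[OF tendsto_mult_right_zero[OF R2, of C] gdisc_tendsto] this]
  have B: "B \<longlonglongrightarrow> 0" unfolding B_def[abs_def] by simp
  have "MK_dist (\<lambda>f h. min (dst f h) 1) (nu_L2 K ip N (R N)) (nu_mult K ip N (R N) g) \<le> ennreal (B N)"
    if N: "N \<ge> 1" for N
  proof -
    interpret T: bounded_triangular "coords N" "shift N" fst bnd "bnd\<^sup>2 / real N"
      by (rule bounded_triangular_shift[OF N])
    show ?thesis
      unfolding B_def
    proof (rule MK_dist_le_exit_probability[OF N R[OF N] g_L2 T.triangular_shift_measurable T.distr_triangular_shift])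
      show "dst (step N (tshift N c)) (group_law K (step N c) g)
          \<le> C * (R N / real N) + disc_error N"
        if "c \<in> cdisc N (R N)" for c
        using C(2) N R[OF N] that by blast
      show "0 \<le> C * (R N / real N) + disc_error N"
        using C(1) less_imp_le[OF R[OF N]] nrm_nonneg[OF L2_diff[OF gdisc_L2 g_L2]] by simp
    qed (unfold q_def, rule shift_exit_bound[OF N R[OF N]])
  qed
  then have ev: "eventually (\<lambda>N. MK_dist (\<lambda>f h. min (dst f h) 1) (nu_L2 K ip N (R N)) (nu_mult K ip N (R N) g)
      \<le> ennreal (B N)) sequentially"
    by (intro eventually_sequentiallyI[of 1])
  have "(\<lambda>N. ennreal (B N)) \<longlonglongrightarrow> 0" using tendsto_ennrealI[OF B] by simp
  from tendsto_sandwich[OF _ ev tendsto_const this] show ?thesis by simp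
qed

end

theorem lemma3p1:
  fixes K :: "(real^'n^'n) set"
    and ip :: "real^'n^'n \<Rightarrow> real^'n^'n \<Rightarrow> real"
    and R :: "nat \<Rightarrow> real"
    and g :: "real \<Rightarrow> real^'n^'n"
  assumes "compact_connected_orthogonal_group K"
    and "inner_product_on (lie_algebra K) ip"
    and "Ad_invariant K ip"
    and "\<And>N. N \<ge> 1 \<Longrightarrow> R N > 0"
    and "filterlim (\<lambda>N. R N / sqrt (real N)) at_top sequentially"
    and "(\<lambda>N. R N / real N) \<longlonglongrightarrow> 0"
    and "g \<in> V_infinity K ip"
  shows "((\<lambda>N. MK_dist (\<lambda>f h. min (L2_dist ip f h) 1)
             (nu_L2 K ip N (R N)) (nu_mult K ip N (R N) g)) \<longlonglongrightarrow> 0) \<and>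
         uniform_limit (bounded_1_Lipschitz K ip)
           (\<lambda>N F. (\<integral>f. F f \<partial>nu_L2 K ip N (R N)) - (\<integral>f. F f \<partial>nu_mult K ip N (R N) g))
           (\<lambda>F. 0) sequentially"
proof -
  interpret path_space K ip using assms(1-3) by unfold_locales
  obtain m where m: "m \<ge> 1" "g \<in> V K ip m" using assms(7) by (auto simp: V_infinity_def)
  obtain y where y: "\<And>i. y i \<in> lie_algebra K"
    "\<And>i. i < m \<Longrightarrow> AE t in lebesgue_on (grid_interval m i). g t = y i"
    using V_values[OF m] by blast
  interpret step_translation K ip g m y using m y by unfold_locales
  let ?MK = "\<lambda>N. MK_dist (\<lambda>f h. min (L2_dist ip f h) 1) (nu_L2 K ip N (R N)) (nu_mult K ip N (R N) g)"
  have MK: "?MK \<longlonglongrightarrow> 0" by (rule MK_dist_tendsto[OF assms(4-6)])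
  moreover have "uniform_limit (bounded_1_Lipschitz K ip)
           (\<lambda>N F. (\<integral>f. F f \<partial>nu_L2 K ip N (R N)) - (\<integral>f. F f \<partial>nu_mult K ip N (R N) g))
           (\<lambda>F. 0) sequentially"
  proof (rule uniform_limitI)
    fix e :: real assume "e > 0"
    \<comment> \<open>This threshold does not involve \<open>F\<close>, which gives the uniformity;
      the \<open>2\<close> compensates the factor in the comparison of integrals with the transport
      distance.\<close>
    then have "eventually (\<lambda>N. ?MK N < ennreal (e / 2)) sequentially"
      by (intro order_tendstoD(2)[OF MK]) simp
    then show "\<forall>\<^sub>F N in sequentially. \<forall>F\<in>bounded_1_Lipschitz K ip.
        dist ((\<integral>f. F f \<partial>nu_L2 K ip N (R N)) - (\<integral>f. F f \<partial>nu_mult K ip N (R N) g)) 0 < e"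
      using eventually_ge_at_top[of 1]
    proof eventually_elim
      case (elim N)
      show ?case
      proof
        fix F assume F: "F \<in> bounded_1_Lipschitz K ip"
        have r: "R N > 0" using elim assms(4) by simp
        have "emeasure (nu_L2 K ip N (R N)) (space (nu_L2 K ip N (R N))) = 1"
        proof -
          have st: "step N \<in> measurable (coord_uniform N (R N)) L2_meas"
            by (rule measurable_compose[OF step_uniform_measurable[OF elim(2)]])
              (intro measurable_restrict_space1, simp)
          have "step N -` L2 \<inter> space (coord_uniform N (R N)) = space (coord_uniform N (R N))"
            using step_L2[OF elim(2)] by auto
          then show ?thesis
            unfolding nu_L2_eq[OF elim(2) r] using emeasure_distr[OF st sets.top] coord_uniform_one[OF r]
            by (simp add: space_L2_borel)
        qed
        then have "ennreal (\<bar>(\<integral>f. F f \<partial>nu_L2 K ip N (R N)) - (\<integral>f. F f \<partial>nu_mult K ip N (R N) g)\<bar> / 2) \<le> ?MK N"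
          by (intro Lipschitz_integral_diff_le_MK_dist F) (simp_all add: nu_L2_def nu_mult_def)
        also have "\<dots> < ennreal (e / 2)" by (rule elim(1))
        finally show "dist ((\<integral>f. F f \<partial>nu_L2 K ip N (R N)) - (\<integral>f. F f \<partial>nu_mult K ip N (R N) g)) 0 < e"
          by (simp add: ennreal_less_iff)
      qed
    qed
  qed
  ultimately show ?thesis by blast
qed

end
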